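(* Let $\varepsilon>0$, $\beta\in(0,\tfrac12)$ and $\ell_{\max}\in\mathbb{N}$. Let $\mathcal{M}$ be the randomized algorithm $\mathrm{DPDistinctCount}(\,\cdot\,;\ell_{\max},\varepsilon,\beta)$ described in the context, which on input $D$ outputs a pair $(\hat\ell,\hat\nu)\in[\ell_{\max}]\times\mathbb{R}$. Then: (1) Privacy: $\mathcal{M}$ is $\varepsilon$-differentially private. (2) Lower bound: for every $D\in(\Omega^* )^n$, $\Pr_{(\hat\ell,\hat\nu)\gets\mathcal{M}(D)}\big[\hat\nu\le \mathrm{DC}(D)\big]\ge 1-\beta$. (3) Upper bound: for every $D\in(\Omega^* )^n$, \[\Pr_{(\hat\ell,\hat\nu)\gets\mathcal{M}(D)}\Big[\hat\nu\ge \max_{\ell\in[\ell_{\max}]}\Big(\mathrm{DC}(D;\ell)-\frac{10\ell+18\ell_A^*}{\varepsilon}\log\Big(\frac{\ell_{\max}}{\beta}\Big)\Big)\Big]\ge 1-2\beta,\] where $\ell_A^*=\arg\max_{\ell\in[\ell_{\max}]}\Big(\mathrm{DC}(D;\ell)-\frac{\ell}{\varepsilon}\log\big(\frac{1}{2\beta}\big)\Big)$. (4) Computational efficiency: $\mathcal{M}(D)$ has running time $O(|D|^{1.5}\cdot\ell_{\max}^2)$, where $|D|:=\sum_i|u_i|$.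
   Context: $\Omega$ is a (possibly infinite) universe of elements and $\Omega^*$ denotes the collection of finite subsets of $\Omega$. A dataset is $D=(u_1,\dots,u_n)\in(\Omega^* )^n$, where $u_i$ is the finite set contributed by person $i$; $[k]=\{1,\dots,k\}$. Define $\mathrm{DC}(D)=\big|\bigcup_{i\in[n]}u_i\big|$ and, for $\ell\in\mathbb{N}$, $\mathrm{DC}(D;\ell)=\max\{|\bigcup_{i\in[n]}v_i| : v_i\subseteq u_i,\ |v_i|\le\ell \text{ for all } i\}$. Two datasets are neighboring if one is obtained from the other by adding or removing one person's entry $u_i$. A randomized algorithm $M$ is $\varepsilon$-differentially private if for all neighboring $D,D'$ and all measurable sets $S$, $\Pr[M(D)\in S]\le e^{\varepsilon}\Pr[M(D')\in S]$. $\mathrm{Lap}(b)$ denotes the Laplace distribution with mean $0$ and density $\frac{1}{2b}e^{-|x|/b}$. Generalized exponential mechanism $\mathrm{GEM}(D;\{q_i\}_{i\in[m]},\{\Delta_i\}_{i\in[m]},\varepsilon',\beta)$ (for real-valued queries $q_i$ with sensitivity at most $\Delta_i>0$): set $t=\frac{2}{\varepsilon'}\log(m/\beta)$, compute $s_i=\min_{j\in[m]}\frac{(q_i(D)-t\Delta_i)-(q_j(D)-t\Delta_j)}{\Delta_i+\Delta_j}$ for each $i$, and output $\hat i\in[m]$ with probability $\exp(\varepsilon' s_i/2)/\sum_{k}\exp(\varepsilon' s_k/2)$. Algorithm $\mathrm{DPDistinctCount}(D;\ell_{\max},\varepsilon,\beta)$: for each $\ell\in[\ell_{\max}]$, compute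 $\mathrm{DC}(D;\ell)$ as the size of a maximum matching (via the Hopcroft–Karp/Karzanov algorithm) in the bipartite graph with left vertices $\bigcup_i \{i\}\times[\min\{\ell,|u_i|\}]$, right vertices $\bigcup_i u_i$, and an edge between $(i,j)$ and $v$ iff $v\in u_i$; define $q_\ell(D)=\mathrm{DC}(D;\ell)-\frac{2\ell}{\varepsilon}\log\big(\frac{1}{2\beta}\big)$. Then set $\hat\ell\gets\mathrm{GEM}(D;\{q_\ell\}_{\ell\in[\ell_{\max}]},\{\ell\}_{\ell\in[\ell_{\max}]},\varepsilon/2,\beta)$, $\hat\nu\gets q_{\hat\ell}(D)+\mathrm{Lap}(2\hat\ell/\varepsilon)$, and output $(\hat\ell,\hat\nu)$. *)

theory Defs
  imports "HOL-Probability.Probability" "HOL-Library.FSet"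
begin

section \<open>Datasets and distinct counts\<close>

text \<open>
  The universe of elements is the type \<open>'a\<close>. A dataset is a list of finite sets, one per person;
  persons are numbered from 0.
\<close>

type_synonym 'a dataset = "'a fset list"

definition data_size :: "'a dataset \<Rightarrow> nat" where
  "data_size D = (\<Sum>u\<leftarrow>D. fcard u)"

definition DC :: "'a dataset \<Rightarrow> nat" where
  "DC D = card (\<Union>i<length D. fset (D ! i))"

definition DC_bounded :: "'a dataset \<Rightarrow> nat \<Rightarrow> nat" where
  "DC_bounded D l = Max {card (\<Union>i<length D. v i) | v :: nat \<Rightarrow> 'a set.
     \<forall>i<length D. v i \<subseteq> fset (D ! i) \<and> card (v i) \<le> l}"

definition neighboring :: "'a dataset \<Rightarrow> 'a dataset \<Rightarrow> bool" where
  "neighboring D D' \<longleftrightarrow>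
     (\<exists>xs u ys. (D = xs @ u # ys \<and> D' = xs @ ys) \<or> (D' = xs @ u # ys \<and> D = xs @ ys))"

section \<open>Differential privacy\<close>

definition differentially_private ::
  "'b measure \<Rightarrow> real \<Rightarrow> ('a dataset \<Rightarrow> 'b measure) \<Rightarrow> bool" where
  "differentially_private Y \<epsilon> M \<longleftrightarrow>
     (\<forall>D D'. neighboring D D' \<longrightarrow>
       (\<forall>S\<in>sets Y. measure (M D) S \<le> exp \<epsilon> * measure (M D') S))"

definition Lap :: "real \<Rightarrow> real measure" where
  "Lap b = density lborel (\<lambda>x. ennreal (1 / (2 * b) * exp (- \<bar>x\<bar> / b)))"

section \<open>The generalized exponential mechanism\<close>

definition gem_score ::
  "(nat \<Rightarrow> 'd \<Rightarrow> real) \<Rightarrow> (nat \<Rightarrow> real) \<Rightarrow> nat \<Rightarrow> real \<Rightarrow> real \<Rightarrow> 'd \<Rightarrow> nat \<Rightarrow> real" where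
  "gem_score q \<Delta> m \<epsilon> \<beta> D i =
     (let t = 2 / \<epsilon> * ln (real m / \<beta>) in
      MIN j\<in>{1..m}. ((q i D - t * \<Delta> i) - (q j D - t * \<Delta> j)) / (\<Delta> i + \<Delta> j))"

definition GEM ::
  "'d \<Rightarrow> (nat \<Rightarrow> 'd \<Rightarrow> real) \<Rightarrow> (nat \<Rightarrow> real) \<Rightarrow> nat \<Rightarrow> real \<Rightarrow> real \<Rightarrow> nat pmf" where
  "GEM D q \<Delta> m \<epsilon> \<beta> =
     embed_pmf (\<lambda>i. if i \<in> {1..m}
       then exp (\<epsilon> * gem_score q \<Delta> m \<epsilon> \<beta> D i / 2) /
            (\<Sum>k\<in>{1..m}. exp (\<epsilon> * gem_score q \<Delta> m \<epsilon> \<beta> D k / 2))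
       else 0)"

section \<open>The algorithm\<close>

text \<open>
  Person \<open>i\<close> has \<open>min l (fcard (D ! i))\<close> copies on the left-hand side of the bipartite graph.
\<close>

definition contribution_graph :: "'a dataset \<Rightarrow> nat \<Rightarrow> ((nat \<times> nat) \<times> 'a) set" where
  "contribution_graph D l =
     {((i, j), v). i < length D \<and> j \<in> {1..min l (fcard (D ! i))} \<and> v |\<in>| D ! i}"

definition bipartite_matching :: "('l \<times> 'r) set \<Rightarrow> ('l \<times> 'r) set \<Rightarrow> bool" where
  "bipartite_matching E F \<longleftrightarrow> F \<subseteq> E \<and> inj_on fst F \<and> inj_on snd F"

definition max_matching_size :: "('l \<times> 'r) set \<Rightarrow> nat" where
  "max_matching_size E = Max {card F | F. bipartite_matching E F}"

definition dc_query :: "real \<Rightarrow> real \<Rightarrow> nat \<Rightarrow> 'a dataset \<Rightarrow> real" where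
  "dc_query \<epsilon> \<beta> l D =
     real (max_matching_size (contribution_graph D l)) - 2 * real l / \<epsilon> * ln (1 / (2 * \<beta>))"

abbreviation output_space :: "(nat \<times> real) measure" where
  "output_space \<equiv> count_space UNIV \<Otimes>\<^sub>M borel"

definition DPDistinctCount ::
  "nat \<Rightarrow> real \<Rightarrow> real \<Rightarrow> 'a dataset \<Rightarrow> (nat \<times> real) measure" where
  "DPDistinctCount lmax \<epsilon> \<beta> D =
     measure_pmf (GEM D (dc_query \<epsilon> \<beta>) real lmax (\<epsilon> / 2) \<beta>) \<bind>
       (\<lambda>l. distr (Lap (2 * real l / \<epsilon>)) output_space (\<lambda>x. (l, dc_query \<epsilon> \<beta> l D + x)))"

section \<open>Randomized real-RAM programs and their running time\<close>

text \<open>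
  Running time is measured in the real-RAM model with unit-cost instructions and random access to
  named arrays. An array of naturals and an array of reals are attached to every name; scalars are
  kept at index 0. Naturals (which also serve as addresses) can only be added, subtracted (with
  truncation at 0) and compared, so that unit cost for them is not abused. There are no
  conversions from reals to naturals. \<open>Draw\<close> is the only source of randomness and yields a
  fresh uniform sample from the open unit interval.
\<close>

datatype nexp =
    NConst nat
  | NIdx string nexp
  | NAdd nexp nexp
  | NSub nexp nexp

datatype rexp =
    RNat nexp
  | RIdx string nexp
  | RAdd rexp rexp
  | RSub rexp rexp
  | RMul rexp rexp
  | RDiv rexp rexp
  | RExp rexp
  | RLn rexp

datatype bexp =
    BNatLess nexp nexp
  | BRealLess rexp rexp
  | BNeg bexp
  | BConj bexp bexp

datatype com =
    SKIP
  | NAssign string nexp nexp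
  | RAssign string nexp rexp
  | Draw string nexp
  | Seq com com
  | Cond bexp com com
  | While bexp com

record state =
  nmem :: "string \<Rightarrow> nat \<Rightarrow> nat"
  rmem :: "string \<Rightarrow> nat \<Rightarrow> real"
  drawn :: nat

primrec nval :: "nexp \<Rightarrow> state \<Rightarrow> nat" where
  "nval (NConst n) s = n"
| "nval (NIdx x e) s = nmem s x (nval e s)"
| "nval (NAdd a b) s = nval a s + nval b s"
| "nval (NSub a b) s = nval a s - nval b s"

primrec rval :: "rexp \<Rightarrow> state \<Rightarrow> real" where
  "rval (RNat e) s = real (nval e s)"
| "rval (RIdx x e) s = rmem s x (nval e s)"
| "rval (RAdd a b) s = rval a s + rval b s"
| "rval (RSub a b) s = rval a s - rval b s"
| "rval (RMul a b) s = rval a s * rval b s"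
| "rval (RDiv a b) s = rval a s / rval b s"
| "rval (RExp a) s = exp (rval a s)"
| "rval (RLn a) s = ln (rval a s)"

primrec bval :: "bexp \<Rightarrow> state \<Rightarrow> bool" where
  "bval (BNatLess a b) s = (nval a s < nval b s)"
| "bval (BRealLess a b) s = (rval a s < rval b s)"
| "bval (BNeg a) s = (\<not> bval a s)"
| "bval (BConj a b) s = (bval a s \<and> bval b s)"

primrec ncost :: "nexp \<Rightarrow> nat" where
  "ncost (NConst n) = 1"
| "ncost (NIdx x e) = 1 + ncost e"
| "ncost (NAdd a b) = 1 + ncost a + ncost b"
| "ncost (NSub a b) = 1 + ncost a + ncost b"

primrec rcost :: "rexp \<Rightarrow> nat" where
  "rcost (RNat e) = 1 + ncost e"
| "rcost (RIdx x e) = 1 + ncost e"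
| "rcost (RAdd a b) = 1 + rcost a + rcost b"
| "rcost (RSub a b) = 1 + rcost a + rcost b"
| "rcost (RMul a b) = 1 + rcost a + rcost b"
| "rcost (RDiv a b) = 1 + rcost a + rcost b"
| "rcost (RExp a) = 1 + rcost a"
| "rcost (RLn a) = 1 + rcost a"

primrec bcost :: "bexp \<Rightarrow> nat" where
  "bcost (BNatLess a b) = 1 + ncost a + ncost b"
| "bcost (BRealLess a b) = 1 + rcost a + rcost b"
| "bcost (BNeg a) = 1 + bcost a"
| "bcost (BConj a b) = 1 + bcost a + bcost b"

text \<open>
  \<open>exec \<omega> c s t s'\<close>: started in \<open>s\<close>, program \<open>c\<close> halts in \<open>s'\<close> after exactly \<open>t\<close> steps, if the
  successive random draws are \<open>\<omega> 0\<close>, \<open>\<omega> 1\<close>, and so on.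
\<close>

inductive exec :: "(nat \<Rightarrow> real) \<Rightarrow> com \<Rightarrow> state \<Rightarrow> nat \<Rightarrow> state \<Rightarrow> bool" for \<omega> where
  Skip: "exec \<omega> SKIP s 1 s"
| NAssign: "exec \<omega> (NAssign x i e) s (1 + ncost i + ncost e)
    (s\<lparr>nmem := (nmem s)(x := (nmem s x)(nval i s := nval e s))\<rparr>)"
| RAssign: "exec \<omega> (RAssign x i e) s (1 + ncost i + rcost e)
    (s\<lparr>rmem := (rmem s)(x := (rmem s x)(nval i s := rval e s))\<rparr>)"
| Draw: "exec \<omega> (Draw x i) s (1 + ncost i)
    (s\<lparr>rmem := (rmem s)(x := (rmem s x)(nval i s := \<omega> (drawn s))), drawn := Suc (drawn s)\<rparr>)"
| Seq: "exec \<omega> c1 s1 t1 s2 \<Longrightarrow> exec \<omega> c2 s2 t2 s3 \<Longrightarrow> exec \<omega> (Seq c1 c2) s1 (1 + t1 + t2) s3"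
| CondTrue: "bval b s \<Longrightarrow> exec \<omega> c1 s t s' \<Longrightarrow> exec \<omega> (Cond b c1 c2) s (1 + bcost b + t) s'"
| CondFalse: "\<not> bval b s \<Longrightarrow> exec \<omega> c2 s t s' \<Longrightarrow> exec \<omega> (Cond b c1 c2) s (1 + bcost b + t) s'"
| WhileFalse: "\<not> bval b s \<Longrightarrow> exec \<omega> (While b c) s (1 + bcost b) s"
| WhileTrue: "bval b s1 \<Longrightarrow> exec \<omega> c s1 t1 s2 \<Longrightarrow> exec \<omega> (While b c) s2 t2 s3 \<Longrightarrow>
    exec \<omega> (While b c) s1 (1 + bcost b + t1 + t2) s3"

definition coins :: "(nat \<Rightarrow> real) measure" where
  "coins = PiM UNIV (\<lambda>_. restrict_space lborel {0<..<1})"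

text \<open>
  \<open>samples_within P s T \<mu>\<close>: started in \<open>s\<close>, program \<open>P\<close> halts after at most \<open>T\<close> steps whatever the
  random draws are, and the pair it leaves in its output cells has law \<open>\<mu>\<close>.
\<close>

definition samples_within :: "com \<Rightarrow> state \<Rightarrow> real \<Rightarrow> (nat \<times> real) measure \<Rightarrow> bool" where
  "samples_within P s T \<mu> \<longleftrightarrow>
     (\<exists>out \<in> measurable coins output_space.
        (\<forall>\<omega>\<in>space coins. \<exists>t s'. exec \<omega> P s t s' \<and> real t \<le> T \<and>
           out \<omega> = (nmem s' ''l_hat'' 0, rmem s' ''nu_hat'' 0)) \<and>
        distr coins output_space out = \<mu>)"

text \<open>
  A dataset is presented to a program as the list of all pairs (person, element), grouped by person
  and in arbitrary order within each person. Elements are named by arbitrary distinct naturals.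
  The number of records is \<open>data_size D\<close>.
\<close>

definition encodes :: "(nat \<times> nat) list \<Rightarrow> 'a dataset \<Rightarrow> bool" where
  "encodes rs D \<longleftrightarrow> distinct rs \<and> sorted (map fst rs) \<and>
     (\<exists>name :: 'a \<Rightarrow> nat. inj_on name (\<Union>u\<in>set D. fset u) \<and>
        set rs = {(i, name x) | i x. i < length D \<and> x |\<in>| D ! i})"

definition array_of :: "'v::zero list \<Rightarrow> nat \<Rightarrow> 'v" where
  "array_of xs k = (if k < length xs then xs ! k else 0)"

definition input_state :: "(nat \<times> nat) list \<Rightarrow> nat \<Rightarrow> real \<Rightarrow> real \<Rightarrow> state" where
  "input_state rs lmax \<epsilon> \<beta> =
     \<lparr>nmem = (\<lambda>_. array_of [])
        (''size'' := array_of [length rs], ''l_max'' := array_of [lmax],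
         ''person'' := array_of (map fst rs), ''elem'' := array_of (map snd rs)),
      rmem = (\<lambda>_. array_of [])(''eps'' := array_of [\<epsilon>], ''beta'' := array_of [\<beta>]),
      drawn = 0\<rparr>"

end

theory Submission
  imports Defs "HOL-Real_Asymp.Real_Asymp"
begin

text \<open>
  Capping at \<open>l\<close> makes the distinct count change by at most \<open>l\<close> between neighbouring datasets, so
  each score of the generalized exponential mechanism changes by at most 1 and the final Laplace
  noise hides the rest. The best cap has score 0, hence with high probability the selected one has
  score at least \<open>-t\<close>, and comparing it with the other caps gives the accuracy bounds.

  For the running time the Hopcroft-Karp algorithm is replaced by a simpler one with the same bound.
  For every cap \<open>l\<close>, an auction with about \<open>sqrt |D|\<close> price levels takes time
  \<open>O(l |D| sqrt |D|)\<close> and leaves a matching that is at most \<open>sqrt |D| + 1\<close> short of the maximum;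
  it is completed by breadth-first searches for augmenting paths from all free vertices at once,
  each of cost \<open>O(l |D|)\<close>. The output is sampled by inverting distribution functions at two
  uniform draws.
\<close>

section \<open>Matchings and vertex covers\<close>

text \<open>A person with d elements has min(l, d) copies, each adjacent to all d elements, so the
  graph for cap \<open>l\<close> has at most l |D| edges; about sqrt |D| linear passes per cap,
  summed over the caps up to \<open>lmax\<close>, give |D|^1.5 \<open>lmax\<close>^2. Hopcroft-Karp
  works with maximal families of disjoint shortest augmenting paths; the auction replaces them by a
  local bidding rule whose invariants concern single edges, and only a search for single paths
  remains. Near-optimality and optimality are both certified by vertex covers. The probabilistic
  half hardly sees a matching: there \<open>DC_bounded\<close> is a maximum over capped selections,
  whose change is transparent when a person is added or removed. The two views meet in
  \<open>max_matching_size_eq_DC_bounded\<close>. The privacy budget is split evenly between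
  selection and noise. A further obstacle is the machine model: programs cannot multiply naturals or
  turn reals into naturals, so even the number of price levels has to be found by additions, and the
  law of the output must be reproduced exactly, not approximately.\<close>

lemma finite_contribution_graph: "finite (contribution_graph D l)"
proof (rule finite_subset)
  show "contribution_graph D l \<subseteq>
    ({..<length D} \<times> {1..l}) \<times> (\<Union>i<length D. fset (D ! i))"
    by (auto simp: contribution_graph_def)
qed auto

lemma finite_matching_sizes:
  assumes "finite E"
  shows "finite {card F | F. bipartite_matching E F}"
proof -
  have "{F. bipartite_matching E F} \<subseteq> Pow E" by (auto simp: bipartite_matching_def)
  then have "finite {F. bipartite_matching E F}" using assms finite_subset by blast
  then show ?thesis by simp
qed

lemma matching_empty: "bipartite_matching E {}"
  by (simp add: bipartite_matching_def)

lemma matching_le_max_matching_size: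
  assumes "finite E" "bipartite_matching E F"
  shows "card F \<le> max_matching_size E"
  unfolding max_matching_size_def
  using finite_matching_sizes[OF assms(1)] assms(2) by (intro Max_ge) auto

lemma max_matching_size_attained:
  assumes "finite E"
  obtains F where "bipartite_matching E F" "card F = max_matching_size E"
proof -
  have "max_matching_size E \<in> {card F | F. bipartite_matching E F}"
    unfolding max_matching_size_def
    using finite_matching_sizes[OF assms] matching_empty by (intro Max_in) auto
  then show ?thesis using that by auto
qed

lemma max_matching_size_le_image:
  assumes "finite E" "inj_on f (fst ` E)" "inj_on g (snd ` E)"
  shows "max_matching_size E \<le> max_matching_size (map_prod f g ` E)"
proof -
  obtain F where F: "bipartite_matching E F" "card F = max_matching_size E"
    using max_matching_size_attained[OF assms(1)] by blast
  then have FE: "F \<subseteq> E" "inj_on fst F" "inj_on snd F" by (auto simp: bipartite_matching_def)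
  have f: "inj_on f (fst ` F)" "inj_on g (snd ` F)"
    using FE(1) assms(2,3) by (auto intro: inj_on_subset)
  have "inj_on (f \<circ> fst) F" "inj_on (g \<circ> snd) F"
    using comp_inj_on FE f by auto
  then have inj': "inj_on (fst \<circ> map_prod f g) F" "inj_on (snd \<circ> map_prod f g) F"
    by (simp_all add: inj_on_def)
  then have inj: "inj_on (map_prod f g) F" by (blast intro: inj_on_imageI2)
  then have "bipartite_matching (map_prod f g ` E) (map_prod f g ` F)"
    using FE(1) inj' by (auto simp: bipartite_matching_def inj_on_imageI)
  from matching_le_max_matching_size[OF _ this] show ?thesis
    using assms(1) F(2) card_image[OF inj] by simp
qed

text \<open>Lets the record positions and element names seen by the program stand in for the copies
  and elements of \<open>contribution_graph\<close>. The upper bound is the previous lemma applied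
  to the inverse renamings.\<close>

lemma max_matching_size_image:
  assumes "finite E" "inj_on f (fst ` E)" "inj_on g (snd ` E)"
  shows "max_matching_size (map_prod f g ` E) = max_matching_size E"
proof (rule antisym)
  let ?f = "inv_into (fst ` E) f" and ?g = "inv_into (snd ` E) g"
  have inv: "?f (f a) = a" "?g (g b) = b" if "(a, b) \<in> E" for a b
    using that assms(2,3) by (force intro: inv_into_f_f)+
  have "map_prod ?f ?g ` map_prod f g ` E = E"
    using inv by (force simp: image_image)
  moreover have "inj_on ?f (fst ` map_prod f g ` E)" "inj_on ?g (snd ` map_prod f g ` E)"
    by (auto intro!: inj_on_inv_into simp: image_subset_iff; force)+
  ultimately show "max_matching_size (map_prod f g ` E) \<le> max_matching_size E"
    using max_matching_size_le_image[of "map_prod f g ` E" ?f ?g] assms(1) by simp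
qed (rule max_matching_size_le_image[OF assms])

text \<open>The easy half of Koenig's theorem: each matching edge is charged to an endpoint in the
  cover, and no vertex is charged twice. The optimality arguments for the auction and for the search
  both rest on it.\<close>

lemma matching_le_cover:
  assumes F: "bipartite_matching E F" and fin: "finite A" "finite B"
    and cov: "\<And>a b. (a, b) \<in> E \<Longrightarrow> a \<in> A \<or> b \<in> B"
  shows "card F \<le> card A + card B"
proof -
  let ?FA = "{x \<in> F. fst x \<in> A}" and ?FB = "{x \<in> F. snd x \<in> B}"
  have FE: "F \<subseteq> E" and inj: "inj_on fst F" "inj_on snd F"
    using F by (auto simp: bipartite_matching_def)
  have injA: "inj_on fst ?FA" and injB: "inj_on snd ?FB"
    using inj by (auto intro: inj_on_subset)
  have A: "card ?FA \<le> card A"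
    using card_inj_on_le[OF injA _ fin(1)] by auto
  have B: "card ?FB \<le> card B"
    using card_inj_on_le[OF injB _ fin(2)] by auto
  \<comment> \<open>\<open>F\<close> is not assumed finite; its two parts inherit finiteness from
    the cover through the injective projections.\<close>
  have finA: "finite ?FA" using finite_imageD[OF finite_subset[OF _ fin(1)] injA] by auto
  have finB: "finite ?FB" using finite_imageD[OF finite_subset[OF _ fin(2)] injB] by auto
  have "F \<subseteq> ?FA \<union> ?FB"
  proof
    fix x assume "x \<in> F"
    then show "x \<in> ?FA \<union> ?FB" using FE cov[of "fst x" "snd x"] by auto
  qed
  then have "card F \<le> card (?FA \<union> ?FB)" using finA finB by (intro card_mono) auto
  also have "\<dots> \<le> card ?FA + card ?FB" by (rule card_Un_le)
  finally have "card F \<le> card ?FA + card ?FB" .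
  with A B show ?thesis by linarith
qed

section \<open>Sorted record lists\<close>

lemma downward_closed_nat_eq_lessThan:
  fixes A :: "nat set"
  assumes "finite A" "\<And>x y. x \<in> A \<Longrightarrow> y < x \<Longrightarrow> y \<in> A"
  shows "A = {..<card A}"
proof (cases "A = {}")
  case False
  have "A = {..Max A}"
  proof
    show "A \<subseteq> {..Max A}" using assms(1) by auto
    show "{..Max A} \<subseteq> A" using assms(2)[OF Max_in[OF assms(1) False]] Max_in[OF assms(1) False]
      by (auto simp: le_less)
  qed
  then have "A = {..<Suc (Max A)}" by (simp add: lessThan_Suc_atMost)
  then show ?thesis by (metis card_lessThan)
qed simp

lemma card_filter_eq_sum:
  "finite A \<Longrightarrow> card {x \<in> A. P x} = (\<Sum>x\<in>A. if P x then 1 else 0)"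
  unfolding card_eq_sum by (rule sum.inter_filter)

text \<open>
  Record \<open>r < m\<close> consists of person \<open>p r\<close> and element \<open>el r\<close>. The records of the person of \<open>r\<close>
  occupy the positions \<open>st r..<en r\<close>, and position \<open>r\<close> doubles as the copy number \<open>r - st r\<close>
  of that person on the left-hand side of the contribution graph.
\<close>

locale records =
  fixes p el :: "nat \<Rightarrow> nat" and m :: nat
  assumes p_mono: "\<And>i j. i \<le> j \<Longrightarrow> j < m \<Longrightarrow> p i \<le> p j"
    and records_distinct: "\<And>i j. i < m \<Longrightarrow> j < m \<Longrightarrow> p i = p j \<Longrightarrow> el i = el j \<Longrightarrow> i = j"
begin

text \<open>As counts, \<open>st\<close> and \<open>en\<close> depend on \<open>r\<close> only
  through the person \<open>p r\<close>; sortedness then identifies the counts with positions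
  (\<open>below_eq\<close>, \<open>upto_eq\<close>).\<close>

definition st :: "nat \<Rightarrow> nat" where "st r = card {x. x < m \<and> p x < p r}"
definition en :: "nat \<Rightarrow> nat" where "en r = card {x. x < m \<and> p x \<le> p r}"
definition R :: "nat set" where "R = el ` {..<m}"
definition copies :: "nat \<Rightarrow> nat set" where "copies l = {r. r < m \<and> r < st r + l}"
definition edges :: "nat \<Rightarrow> (nat \<times> nat) set" where
  "edges l = {(r, el x) | r x. r \<in> copies l \<and> x < m \<and> p x = p r}"

lemma below_eq: "{x. x < m \<and> p x < p r} = {..<st r}"
  unfolding st_def
  by (rule downward_closed_nat_eq_lessThan) (auto dest: p_mono[OF less_imp_le])

lemma upto_eq: "{x. x < m \<and> p x \<le> p r} = {..<en r}"
  unfolding en_def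
  by (rule downward_closed_nat_eq_lessThan) (auto dest: p_mono[OF less_imp_le])

lemma less_st_iff: "x < st r \<longleftrightarrow> x < m \<and> p x < p r"
  using below_eq[of r] by blast

lemma less_en_iff: "x < en r \<longleftrightarrow> x < m \<and> p x \<le> p r"
  using upto_eq[of r] by blast

lemma st_le_en: "st r \<le> en r"
  by (metis less_en_iff less_st_iff less_imp_le not_le order_less_irrefl)

lemma st_le: "r < m \<Longrightarrow> st r \<le> r"
  by (metis less_st_iff not_le order_less_irrefl)

lemma less_en: "r < m \<Longrightarrow> r < en r"
  by (simp add: less_en_iff)

lemma same_person_iff: "x < m \<and> p x = p r \<longleftrightarrow> st r \<le> x \<and> x < en r"
  using less_st_iff[of x r] less_en_iff[of x r] by (auto simp: not_le[symmetric])

text \<open>The program does not store \<open>en\<close>. It ends a scan by comparing persons, and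
  this equivalence translates that test.\<close>

lemma scan_guard: "st r \<le> x \<Longrightarrow> (x < m \<and> \<not> p r < p x) \<longleftrightarrow> x < en r"
  using less_st_iff[of x r] less_en_iff[of x r] by auto

lemma st_0: "st 0 = 0"
  using less_st_iff[of 0 0] p_mono[of 0] by (metis gr0I less_nat_zero_code less_st_iff not_less p_mono zero_le)

text \<open>The recurrence by which one pass from left to right fills the \<open>st\<close>
  array.\<close>

lemma st_step: "0 < r \<Longrightarrow> r < m \<Longrightarrow> st r = (if p (r - 1) < p r then r else st (r - 1))"
proof -
  assume r: "0 < r" "r < m"
  show ?thesis
  proof (cases "p (r - 1) < p r")
    case True
    have "x < st r \<longleftrightarrow> x < r" for x
      using less_st_iff[of x r] p_mono[of r x] p_mono[of x "r - 1"] True r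
      by (metis (no_types, lifting) One_nat_def Suc_pred diff_less le_less_trans less_Suc_eq_le not_less
          less_trans zero_less_one)
    then have "st r = r" by (metis linorder_neqE_nat order_less_irrefl)
    then show ?thesis using True by simp
  next
    case False
    then have "p (r - 1) = p r" using p_mono[of "r - 1" r] r by simp
    then show ?thesis using False by (simp add: st_def)
  qed
qed

lemma copies_subset: "copies l \<subseteq> {..<m}" by (auto simp: copies_def)
lemma finite_copies: "finite (copies l)" using copies_subset finite_subset by blast
lemma copies_less: "r \<in> copies l \<Longrightarrow> r < m" by (auto simp: copies_def)
lemma finite_R: "finite R" by (simp add: R_def)
lemma card_R: "card R \<le> m" unfolding R_def using card_image_le[of "{..<m}" el] by simp
lemma el_in_R: "x < m \<Longrightarrow> el x \<in> R" by (simp add: R_def)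

lemma edges_iff: "(r, e) \<in> edges l \<longleftrightarrow> r \<in> copies l \<and> (\<exists>x. st r \<le> x \<and> x < en r \<and> e = el x)"
  unfolding edges_def using same_person_iff[of _ r] by auto

lemma edgeI: "r \<in> copies l \<Longrightarrow> st r \<le> x \<Longrightarrow> x < en r \<Longrightarrow> (r, el x) \<in> edges l"
  by (auto simp: edges_iff)

lemma edgesD: "(r, e) \<in> edges l \<Longrightarrow> r \<in> copies l \<and> r < m \<and> e \<in> R"
  by (auto simp: edges_def dest: copies_less intro: el_in_R)

lemma finite_edges: "finite (edges l)"
  by (rule finite_subset[of _ "{..<m} \<times> R"]) (auto simp: finite_R dest: edgesD)

text \<open>Double counting from the right: record \<open>x\<close> is adjacent only to copies of
  its own person, and these lie in a window of \<open>l\<close> positions starting at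
  \<open>st x\<close>. This is the edge bound behind all running times below.\<close>

lemma sum_degrees: "(\<Sum>r\<in>copies l. en r - st r) \<le> l * m"
proof -
  have "(\<Sum>r\<in>copies l. en r - st r) = (\<Sum>r\<in>copies l. card {x\<in>{..<m}. p x = p r})"
  proof (rule sum.cong[OF refl])
    fix r
    have "{x\<in>{..<m}. p x = p r} = {st r..<en r}"
      by (rule set_eqI) (simp add: same_person_iff)
    then show "en r - st r = card {x\<in>{..<m}. p x = p r}" by simp
  qed
  also have "\<dots> = (\<Sum>r\<in>copies l. \<Sum>x<m. if p x = p r then 1 else 0)"
    by (rule sum.cong[OF refl], rule card_filter_eq_sum) simp
  also have "\<dots> = (\<Sum>x<m. \<Sum>r\<in>copies l. if p x = p r then 1 else 0)"
    by (rule sum.swap)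
  also have "\<dots> \<le> (\<Sum>x<m. l)"
  proof (rule sum_mono)
    fix x assume "x \<in> {..<m}"
    have "(\<Sum>r\<in>copies l. if p x = p r then 1 else 0) = card {r\<in>copies l. p x = p r}"
      by (rule card_filter_eq_sum[symmetric, OF finite_copies])
    also have "\<dots> \<le> card {st x..<st x + l}"
    proof (rule card_mono)
      show "{r\<in>copies l. p x = p r} \<subseteq> {st x..<st x + l}"
        using st_le by (auto simp: copies_def st_def)
    qed simp
    finally show "(\<Sum>r\<in>copies l. if p x = p r then 1 else 0) \<le> l" by simp
  qed
  also have "\<dots> = l * m" by simp
  finally show ?thesis .
qed

end

section \<open>Matchings stored in arrays and their elementary updates\<close>

context records
begin

text \<open>
  A matching is kept in two arrays: \<open>mt r = Suc e\<close> (equivalently \<open>ow e = Suc r\<close>) if left vertex \<open>r\<close>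
  is matched to \<open>e\<close>, and \<open>0\<close> marks a free vertex.
\<close>

definition matching :: "nat \<Rightarrow> (nat \<Rightarrow> nat) \<Rightarrow> (nat \<Rightarrow> nat) \<Rightarrow> bool" where
  "matching l ow mt \<longleftrightarrow>
     (\<forall>r<m. \<forall>e. mt r = Suc e \<longrightarrow> (r, e) \<in> edges l \<and> ow e = Suc r) \<and>
     (\<forall>e\<in>R. \<forall>r. ow e = Suc r \<longrightarrow> r < m \<and> mt r = Suc e)"

definition matched :: "(nat \<Rightarrow> nat) \<Rightarrow> nat set" where "matched mt = {r. r < m \<and> 0 < mt r}"

lemma finite_matched: "finite (matched mt)" by (simp add: matched_def)

lemma card_matched_le: "card (matched mt) \<le> m"
  unfolding matched_def using card_mono[of "{..<m}" "{r. r < m \<and> 0 < mt r}"] by auto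

lemma matched_D:
  assumes "matching l ow mt" "r < m" "mt r = Suc e"
  shows "(r, e) \<in> edges l" "ow e = Suc r" "r \<in> copies l" "e \<in> R"
  using assms edgesD unfolding matching_def by blast+

lemma owner_D:
  assumes "matching l ow mt" "e \<in> R" "ow e = Suc r"
  shows "r < m" "mt r = Suc e" "r \<in> copies l" "(r, e) \<in> edges l"
  using assms edgesD unfolding matching_def by blast+

lemma bipartite_matching_of:
  assumes V: "matching l ow mt"
  shows "bipartite_matching (edges l) {(r, mt r - 1) | r. r \<in> matched mt}"
    and "card {(r, mt r - 1) | r. r \<in> matched mt} = card (matched mt)"
proof -
  have eq: "{(r, mt r - 1) | r. r \<in> matched mt} = (\<lambda>r. (r, mt r - 1)) ` matched mt" by auto
  have m: "(r, mt r - 1) \<in> edges l \<and> ow (mt r - 1) = Suc r" if "r \<in> matched mt" for r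
    using V that by (auto simp: matching_def matched_def gr0_conv_Suc)
  show "bipartite_matching (edges l) {(r, mt r - 1) | r. r \<in> matched mt}"
    unfolding bipartite_matching_def eq
    using m by (auto simp: inj_on_def) (metis Suc_inject)
  show "card {(r, mt r - 1) | r. r \<in> matched mt} = card (matched mt)"
    unfolding eq by (rule card_image) (auto simp: inj_on_def)
qed

lemma card_matched_le_max:
  assumes "matching l ow mt"
  shows "card (matched mt) \<le> max_matching_size (edges l)"
  using matching_le_max_matching_size[OF finite_edges bipartite_matching_of(1)[OF assms]]
    bipartite_matching_of(2)[OF assms] by simp

text \<open>Trades the right half of a vertex cover for the left partners, so that both halves of
  the cover can be counted inside \<open>matched mt\<close>.\<close>

lemma owner_image:
  assumes V: "matching l ow mt" and B: "B \<subseteq> R" "\<And>e. e \<in> B \<Longrightarrow> ow e \<noteq> 0"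
  shows "card B = card ((\<lambda>e. ow e - 1) ` B)" "(\<lambda>e. ow e - 1) ` B \<subseteq> matched mt"
proof -
  have *: "ow e - 1 < m \<and> mt (ow e - 1) = Suc e" if "e \<in> B" for e
    using owner_D[OF V, of e "ow e - 1"] that B by auto
  show "card B = card ((\<lambda>e. ow e - 1) ` B)"
  proof (rule card_image[symmetric], rule inj_onI)
    fix e e' assume "e \<in> B" "e' \<in> B" "ow e - 1 = ow e' - 1"
    then show "e = e'" using *[of e] *[of e'] by simp
  qed
  show "(\<lambda>e. ow e - 1) ` B \<subseteq> matched mt"
    using * by (auto simp: matched_def)
qed

lemma max_matching_size_le_cover:
  assumes "finite A" "finite B" "\<And>r e. (r, e) \<in> edges l \<Longrightarrow> r \<in> A \<or> e \<in> B"
  shows "max_matching_size (edges l) \<le> card A + card B"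
proof -
  obtain F where "bipartite_matching (edges l) F" "card F = max_matching_size (edges l)"
    using max_matching_size_attained[OF finite_edges] by blast
  then show ?thesis using matching_le_cover[OF _ assms] by metis
qed

lemma matching_empty_arrays:
  "(\<And>r. r < m \<Longrightarrow> mt r = 0) \<Longrightarrow> (\<And>e. e \<in> R \<Longrightarrow> ow e = 0) \<Longrightarrow> matching l ow mt"
  by (simp add: matching_def)

lemma matching_take:
  assumes V: "matching l ow mt" and e: "(r, e) \<in> edges l" "mt r = 0" "ow e = 0"
  shows "matching l (ow(e := Suc r)) (mt(r := Suc e))"
    and "card (matched (mt(r := Suc e))) = Suc (card (matched mt))"
proof -
  have r: "r < m" "e \<in> R" using edgesD e by auto
  show "matching l (ow(e := Suc r)) (mt(r := Suc e))"
    unfolding matching_def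
  proof (intro conjI allI impI ballI)
    fix r1 e1 assume a: "r1 < m" "(mt(r := Suc e)) r1 = Suc e1"
    then show "(r1, e1) \<in> edges l" "(ow(e := Suc r)) e1 = Suc r1"
      using e matched_D[OF V, of r1 e1] by (auto split: if_splits)
  next
    fix r1 e1 assume a: "e1 \<in> R" "(ow(e := Suc r)) e1 = Suc r1"
    then show "r1 < m" using r owner_D(1)[OF V, of e1 r1] by (auto split: if_splits)
    show "(mt(r := Suc e)) r1 = Suc e1"
      using a r e owner_D(2)[OF V, of e1 r1] by (auto split: if_splits)
  qed
  have "matched (mt(r := Suc e)) = insert r (matched mt)" "r \<notin> matched mt"
    using r e by (auto simp: matched_def)
  then show "card (matched (mt(r := Suc e))) = Suc (card (matched mt))"
    using finite_matched by simp
qed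

text \<open>The bid of the auction on an owned element: the former owner \<open>d\<close> becomes
  free, so the size does not change.\<close>

lemma matching_displace:
  assumes V: "matching l ow mt" and e: "(r, e) \<in> edges l" "mt r = 0" "ow e = Suc d"
  shows "matching l (ow(e := Suc r)) (mt(r := Suc e, d := 0))"
    and "card (matched (mt(r := Suc e, d := 0))) = card (matched mt)"
proof -
  have r: "r < m" "e \<in> R" using edgesD e by auto
  have d: "d < m" "mt d = Suc e" using owner_D[OF V r(2) e(3)] by auto
  have "r \<noteq> d" using d e by auto
  show "matching l (ow(e := Suc r)) (mt(r := Suc e, d := 0))"
    unfolding matching_def
  proof (intro conjI allI impI ballI)
    fix r' e' assume "r' < m" "(mt(r := Suc e, d := 0)) r' = Suc e'"
    then show "(r', e') \<in> edges l" "(ow(e := Suc r)) e' = Suc r'"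
      using V e d matched_D[OF V, of r' e'] by (auto split: if_splits)
  next
    fix r' e' assume a: "e' \<in> R" "(ow(e := Suc r)) e' = Suc r'"
    then show "r' < m" using r owner_D(1)[OF V, of e' r'] by (auto split: if_splits)
    show "(mt(r := Suc e, d := 0)) r' = Suc e'"
      using a r e d \<open>r \<noteq> d\<close> owner_D(2)[OF V, of e' r'] by (auto split: if_splits)
  qed
  have "matched (mt(r := Suc e, d := 0)) = insert r (matched mt - {d})" "r \<notin> matched mt" "d \<in> matched mt"
    using r e d \<open>r \<noteq> d\<close> by (auto simp: matched_def)
  then show "card (matched (mt(r := Suc e, d := 0))) = card (matched mt)"
    using finite_matched card_Suc_Diff1[OF finite_matched, of d mt] by simp
qed

text \<open>One step of an augmentation carried out from its free right end: the hole moves from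
  \<open>e\<close> to \<open>e'\<close>, and the arrays describe a matching at every moment.\<close>

lemma matching_shift:
  assumes V: "matching l ow mt" and e: "(r, e) \<in> edges l" "mt r = Suc e'" "ow e = 0"
  shows "matching l (ow(e := Suc r, e' := 0)) (mt(r := Suc e))"
    and "card (matched (mt(r := Suc e))) = card (matched mt)"
proof -
  have r: "r < m" "e \<in> R" using edgesD e by auto
  have e': "ow e' = Suc r" using matched_D[OF V r(1) e(2)] by auto
  have ne: "e \<noteq> e'" using e e' by auto
  show "matching l (ow(e := Suc r, e' := 0)) (mt(r := Suc e))"
    unfolding matching_def
  proof (intro conjI allI impI ballI)
    fix r1 e1 assume a: "r1 < m" "(mt(r := Suc e)) r1 = Suc e1"
    show "(r1, e1) \<in> edges l" 
      using a e matched_D(1)[OF V, of r1 e1] by (auto split: if_splits)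
    show "(ow(e := Suc r, e' := 0)) e1 = Suc r1"
      using a e ne e' matched_D(2)[OF V, of r1 e1] by (auto split: if_splits)
  next
    fix r1 e1 assume a: "e1 \<in> R" "(ow(e := Suc r, e' := 0)) e1 = Suc r1"
    then show "r1 < m" using r owner_D(1)[OF V, of e1 r1] by (auto split: if_splits)
    show "(mt(r := Suc e)) r1 = Suc e1"
      using a r e owner_D(2)[OF V, of e1 r1] by (auto split: if_splits)
  qed
  have "matched (mt(r := Suc e)) = matched mt"
    using r e by (auto simp: matched_def)
  then show "card (matched (mt(r := Suc e))) = card (matched mt)" by simp
qed

subsection \<open>Auction\<close>

text \<open>
  \<open>lv r\<close> is a lower bound on the prices \<open>pr\<close> of the neighbours of \<open>r\<close>; those before the current
  arc \<open>pt r\<close> are already known to be more expensive. \<open>act = Suc r\<close> if \<open>r\<close> is the left vertex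
  that is currently bidding, and the left vertices from \<open>i\<close> on have not been considered yet.
\<close>

definition auction_inv where
  "auction_inv l k ow mt pr lv pt i act cnt \<longleftrightarrow>
     matching l ow mt \<and>
     (\<forall>r\<in>copies l. \<forall>x. st r \<le> x \<longrightarrow> x < en r \<longrightarrow> lv r \<le> pr (el x)) \<and>
     (\<forall>r\<in>copies l. \<forall>x. st r \<le> x \<longrightarrow> x < pt r \<longrightarrow> lv r < pr (el x)) \<and>
     (\<forall>r\<in>copies l. st r \<le> pt r \<and> pt r \<le> en r \<and> lv r \<le> k) \<and>
     (\<forall>r<m. \<forall>e. mt r = Suc e \<longrightarrow> pr e = Suc (lv r)) \<and>
     (\<forall>e\<in>R. 0 < pr e \<longrightarrow> ow e \<noteq> 0) \<and>
     i \<le> m \<and>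
     (\<forall>r. act = Suc r \<longrightarrow> r \<in> copies l \<and> r < i \<and> mt r = 0 \<and> lv r < k) \<and>
     (\<forall>r\<in>copies l. r < i \<longrightarrow> 0 < mt r \<or> act = Suc r \<or> k \<le> lv r) \<and>
     (\<forall>r<m. i \<le> r \<longrightarrow> mt r = 0 \<and> lv r = 0) \<and>
     cnt = card (matched mt)"

text \<open>A potential that pays for every iteration of the bidding loop. Each of the
  \<open>k - lv r\<close> levels left to climb buys one full scan of the arcs of \<open>r\<close>
  and one unit for the raise itself; \<open>en r - pt r\<close> is what remains of the current scan,
  and \<open>m - i\<close> pays for the vertices not yet considered.\<close>

definition auction_work where
  "auction_work l k lv pt i =
     (\<Sum>r\<in>copies l. (k - lv r) * Suc (en r - st r) + (en r - pt r)) + (m - i)"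

lemma auction_work_less:
  assumes "r \<in> copies l"
    and "\<And>r'. r' \<noteq> r \<Longrightarrow> lv' r' = lv r' \<and> pt' r' = pt r'"
    and "(k - lv' r) * Suc (en r - st r) + (en r - pt' r) < (k - lv r) * Suc (en r - st r) + (en r - pt r)"
  shows "auction_work l k lv' pt' i < auction_work l k lv pt i"
  unfolding auction_work_def
proof (rule add_strict_right_mono, rule sum_strict_mono_ex1[OF finite_copies])
  show "\<forall>r'\<in>copies l. (k - lv' r') * Suc (en r' - st r') + (en r' - pt' r')
      \<le> (k - lv r') * Suc (en r' - st r') + (en r' - pt r')"
  proof
    fix r'
    show "(k - lv' r') * Suc (en r' - st r') + (en r' - pt' r')
      \<le> (k - lv r') * Suc (en r' - st r') + (en r' - pt r')"
      using assms(2)[of r'] less_imp_le[OF assms(3)] by (cases "r' = r") auto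
  qed
qed (use assms(1,3) in blast)

lemma auction_init:
  assumes "\<And>r. r < m \<Longrightarrow> mt r = 0 \<and> lv r = 0 \<and> pt r = st r" "\<And>e. e \<in> R \<Longrightarrow> ow e = 0 \<and> pr e = 0"
  shows "auction_inv l k ow mt pr lv pt 0 0 0"
    and "auction_work l k lv pt 0 \<le> (k + 1) * (l + 1) * m + m"
proof -
  have "matched mt = {}" using assms by (auto simp: matched_def)
  then show "auction_inv l k ow mt pr lv pt 0 0 0"
    unfolding auction_inv_def using assms matching_empty_arrays[of mt ow l] st_le_en
    by (auto simp: copies_less)
  have "(\<Sum>r\<in>copies l. (k - lv r) * Suc (en r - st r) + (en r - pt r))
     \<le> (\<Sum>r\<in>copies l. (k + 1) * (en r - st r) + k)"
    by (rule sum_mono) (use assms copies_less in auto)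
  also have "\<dots> = (k + 1) * (\<Sum>r\<in>copies l. en r - st r) + k * card (copies l)"
    by (simp add: sum.distrib sum_distrib_left)
  also have "\<dots> \<le> (k + 1) * (l * m) + (k + 1) * m"
  proof -
    have "card (copies l) \<le> m" using card_mono[OF _ copies_subset[of l]] by simp
    then show ?thesis using sum_degrees[of l] by (intro add_mono mult_mono) auto
  qed
  finally show "auction_work l k lv pt 0 \<le> (k + 1) * (l + 1) * m + m"
    unfolding auction_work_def by (simp add: algebra_simps)
qed

lemma auction_skip:
  assumes "auction_inv l k ow mt pr lv pt i 0 cnt" "i < m" "\<not> i < st i + l"
  shows "auction_inv l k ow mt pr lv pt (Suc i) 0 cnt"
  using assms unfolding auction_inv_def by (auto simp: less_Suc_eq copies_def)

lemma auction_inject: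
  assumes "auction_inv l k ow mt pr lv pt i 0 cnt" "i < m" "i < st i + l" "0 < k"
  shows "auction_inv l k ow mt pr lv pt (Suc i) (Suc i) cnt"
  using assms unfolding auction_inv_def by (auto simp: less_Suc_eq copies_def)

lemma auction_work_Suc: "i < m \<Longrightarrow> auction_work l k lv pt (Suc i) < auction_work l k lv pt i"
  by (simp add: auction_work_def)

text \<open>Prices never fall, so an arc found too expensive stays so until the level of
  \<open>r\<close> rises. This is why each arc is looked at only once per level.\<close>

lemma auction_advance:
  assumes I: "auction_inv l k ow mt pr lv pt i (Suc r) cnt" and x: "pt r < en r"
    "lv r < pr (el (pt r))"
  shows "auction_inv l k ow mt pr lv (pt(r := Suc (pt r))) i (Suc r) cnt"
    and "auction_work l k lv (pt(r := Suc (pt r))) i < auction_work l k lv pt i"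
proof -
  have r: "r \<in> copies l" using I by (auto simp: auction_inv_def)
  show "auction_inv l k ow mt pr lv (pt(r := Suc (pt r))) i (Suc r) cnt"
    using I x unfolding auction_inv_def by (auto simp: less_Suc_eq)
  show "auction_work l k lv (pt(r := Suc (pt r))) i < auction_work l k lv pt i"
    by (rule auction_work_less[OF r]) (use x in auto)
qed

text \<open>With the arc list exhausted, all neighbours of \<open>r\<close> cost more than
  \<open>lv r\<close>, so raising the level keeps it a lower bound. At level \<open>k\<close> the
  vertex retires unmatched.\<close>

lemma auction_raise:
  assumes I: "auction_inv l k ow mt pr lv pt i (Suc r) cnt" and x: "\<not> pt r < en r"
  shows "auction_inv l k ow mt pr (lv(r := Suc (lv r))) (pt(r := st r)) i
      (if Suc (lv r) < k then Suc r else 0) cnt"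
    and "auction_work l k (lv(r := Suc (lv r))) (pt(r := st r)) i < auction_work l k lv pt i"
proof -
  have r: "r \<in> copies l" "mt r = 0" "lv r < k" "st r \<le> pt r" "pt r = en r"
    using I x by (auto simp: auction_inv_def)
  show "auction_inv l k ow mt pr (lv(r := Suc (lv r))) (pt(r := st r)) i
      (if Suc (lv r) < k then Suc r else 0) cnt"
    using I x r unfolding auction_inv_def by (auto simp: Suc_le_eq)
  obtain d where d: "k - lv r = Suc d" "k - Suc (lv r) = d"
    using r(3) by (metis Suc_diff_Suc)
  show "auction_work l k (lv(r := Suc (lv r))) (pt(r := st r)) i < auction_work l k lv pt i"
    by (rule auction_work_less[OF r(1)]) (use r d in auto)
qed

text \<open>The old \<open>ow e\<close> serves directly as the new \<open>act\<close>: it is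
  \<open>0\<close> if \<open>e\<close> was free and \<open>Suc d\<close> if bidder \<open>d\<close>
  is displaced, so both cases share one conclusion.\<close>

lemma auction_take:
  assumes I: "auction_inv l k ow mt pr lv pt i (Suc r) cnt" and x: "pt r < en r"
    and e: "e = el (pt r)" "pr e < Suc (lv r)"
    and mt': "mt' = (if ow e = 0 then mt(r := Suc e) else mt(r := Suc e, ow e - 1 := 0))"
    and cnt': "cnt' = (if ow e = 0 then Suc cnt else cnt)"
  shows "auction_inv l k (ow(e := Suc r)) mt' (pr(e := Suc (pr e))) lv (pt(r := Suc (pt r))) i (ow e) cnt'"
proof -
  have r: "r \<in> copies l" "r < i" "r < m" "mt r = 0" "lv r < k" "st r \<le> pt r"
    using I copies_less by (auto simp: auction_inv_def)
  have V: "matching l ow mt" using I by (simp add: auction_inv_def)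
  have edge: "(r, e) \<in> edges l" using edgeI r x e by auto
  have eR: "e \<in> R" using edgesD edge by blast
  \<comment> \<open>The level is a lower bound for the price, and the test excludes a larger
    price.\<close>
  have pe: "pr e = lv r" using I r x e unfolding auction_inv_def by (metis less_Suc_eq_le order_antisym)
  have adv: "\<forall>r'\<in>copies l. \<forall>y. st r' \<le> y \<longrightarrow> y < en r' \<longrightarrow> lv r' \<le> (pr(e := Suc (pr e))) (el y)"
    using I unfolding auction_inv_def by (auto simp: le_SucI)
  \<comment> \<open>The arc just used may be passed at once, since the bid lifts the price of
    \<open>e\<close> to \<open>Suc (lv r)\<close>.\<close>
  have pst: "\<forall>r'\<in>copies l. \<forall>y. st r' \<le> y \<longrightarrow> y < (pt(r := Suc (pt r))) r' \<longrightarrow>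
      lv r' < (pr(e := Suc (pr e))) (el y)"
  proof (intro ballI allI impI)
    fix r' y assume a: "r' \<in> copies l" "st r' \<le> y" "y < (pt(r := Suc (pt r))) r'"
    have "lv r' < pr (el y)" if "y < pt r'" using I a that by (auto simp: auction_inv_def)
    then show "lv r' < (pr(e := Suc (pr e))) (el y)"
      using a e pe by (cases "r' = r"; cases "y = pt r") (auto split: if_splits)
  qed
  have mm: "matching l (ow(e := Suc r)) mt' \<and> cnt' = card (matched mt')"
  proof (cases "ow e")
    case 0
    then show ?thesis using matching_take[OF V edge r(4) 0] I mt' cnt' by (auto simp: auction_inv_def)
  next
    case (Suc d)
    then show ?thesis using matching_displace[OF V edge r(4) Suc] I mt' cnt' by (auto simp: auction_inv_def)
  qed
  \<comment> \<open>Price \<open>pr e\<close> equals both \<open>lv r\<close> and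
    \<open>Suc (lv d)\<close>. Hence the displaced \<open>d\<close> sits one level below
    \<open>r\<close>, in particular below \<open>k\<close>, and may bid again.\<close>
  have own: "ow e = Suc d \<Longrightarrow> d < m \<and> mt d = Suc e \<and> d \<in> copies l \<and> lv r = Suc (lv d) \<and> d < i \<and> d \<noteq> r" for d
    using owner_D[OF V eR, of d] I pe r unfolding auction_inv_def by (metis not_le nat.distinct(1))
  have mt_other: "mt' r' = Suc e' \<Longrightarrow> r' \<noteq> r \<Longrightarrow> mt r' = Suc e' \<and> e' \<noteq> e" if "r' < m" for r' e'
    using mt' matched_D(2)[OF V that, of e'] own by (auto split: if_splits)
  have "\<forall>r'<m. \<forall>e'. mt' r' = Suc e' \<longrightarrow> (pr(e := Suc (pr e))) e' = Suc (lv r')"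
  proof (intro allI impI)
    fix r' e' assume a: "r' < m" "mt' r' = Suc e'"
    show "(pr(e := Suc (pr e))) e' = Suc (lv r')"
    proof (cases "r' = r")
      case True
      then have "e' = e" using a mt' own by (auto split: if_splits)
      then show ?thesis using True pe by simp
    next
      case False
      then show ?thesis using mt_other[OF a] I a by (auto simp: auction_inv_def)
    qed
  qed
  moreover have "\<forall>e'\<in>R. 0 < (pr(e := Suc (pr e))) e' \<longrightarrow> (ow(e := Suc r)) e' \<noteq> 0"
    using I by (auto simp: auction_inv_def)
  moreover have "\<forall>r'. ow e = Suc r' \<longrightarrow> r' \<in> copies l \<and> r' < i \<and> mt' r' = 0 \<and> lv r' < k"
    using own mt' r by auto
  moreover have "\<forall>r'\<in>copies l. r' < i \<longrightarrow> 0 < mt' r' \<or> ow e = Suc r' \<or> k \<le> lv r'"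
  proof (intro ballI impI)
    fix r' assume a: "r' \<in> copies l" "r' < i"
    show "0 < mt' r' \<or> ow e = Suc r' \<or> k \<le> lv r'"
      using I a mt' own by (cases "r' = r") (auto simp: auction_inv_def)
  qed
  moreover have "\<forall>r'<m. i \<le> r' \<longrightarrow> mt' r' = 0 \<and> lv r' = 0"
    using I mt' r by (auto simp: auction_inv_def)
  moreover have "\<forall>r'\<in>copies l. st r' \<le> (pt(r := Suc (pt r))) r' \<and> (pt(r := Suc (pt r))) r' \<le> en r' \<and> lv r' \<le> k"
    using I x r by (auto simp: auction_inv_def)
  moreover have "i \<le> m" using I by (simp add: auction_inv_def)
  ultimately show ?thesis
    unfolding auction_inv_def using mm adv pst by blast
qed

lemma auction_take_work:
  assumes I: "auction_inv l k ow mt pr lv pt i (Suc r) cnt" and x: "pt r < en r"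
  shows "auction_work l k lv (pt(r := Suc (pt r))) i < auction_work l k lv pt i"
proof -
  have r: "r \<in> copies l" using I by (auto simp: auction_inv_def)
  show ?thesis by (rule auction_work_less[OF r]) (use x in auto)
qed

text \<open>
  For every threshold \<open>t\<close>, the left vertices of level below \<open>t\<close> and the right vertices of price at
  least \<open>t\<close> cover all edges. A matched edge meets this cover twice only if its price is exactly \<open>t\<close>,
  and by the pigeonhole principle this happens at most \<open>k\<close> times for some \<open>t\<close>.
\<close>

lemma auction_deficiency:
  assumes I: "auction_inv l k ow mt pr lv pt m 0 cnt" and k: "0 < k" "m \<le> k * k"
  shows "max_matching_size (edges l) \<le> cnt + k"
proof -
  have V: "matching l ow mt" and cnt: "cnt = card (matched mt)" using I by (auto simp: auction_inv_def)
  define P where "P t = {r \<in> matched mt. pr (mt r - 1) = t}" for t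
  have finP: "finite (P t)" for t using finite_matched by (simp add: P_def)
  have "\<exists>t\<in>{1..k}. card (P t) \<le> k"
  proof (rule ccontr)
    assume "\<not> ?thesis"
    then have *: "k + 1 \<le> card (P t)" if "t \<in> {1..k}" for t using that by force
    \<comment> \<open>Otherwise the \<open>k\<close> disjoint price classes would contain at least k
      (k + 1) > k^2 >= m matched vertices.\<close>
    have "k * (k + 1) = (\<Sum>t\<in>{1..k}. k + 1)" by simp
    also have "\<dots> \<le> (\<Sum>t\<in>{1..k}. card (P t))" by (rule sum_mono) (rule *)
    also have "\<dots> = card (\<Union>t\<in>{1..k}. P t)"
      by (rule card_UN_disjoint[symmetric]) (use finP in \<open>auto simp: P_def\<close>)
    also have "\<dots> \<le> card (matched mt)"
      by (rule card_mono[OF finite_matched]) (auto simp: P_def)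
    also have "\<dots> \<le> m" by (rule card_matched_le)
    finally show False using k by simp
  qed
  then obtain t where t: "1 \<le> t" "t \<le> k" "card (P t) \<le> k" by auto
  define A where "A = {r \<in> copies l. lv r < t}"
  define B where "B = {e \<in> R. t \<le> pr e}"
  have B: "card B = card ((\<lambda>e. ow e - 1) ` B)" "(\<lambda>e. ow e - 1) ` B \<subseteq> matched mt"
    by (rule owner_image[OF V]; use I t in \<open>auto simp: B_def auction_inv_def\<close>)+
  \<comment> \<open>All vertices have been considered and none is bidding, so an unmatched copy has
    reached level \<open>k\<close>, which is at least \<open>t\<close>.\<close>
  have A: "A \<subseteq> matched mt"
  proof
    fix r assume r: "r \<in> A"
    then have "r \<in> copies l" "r < m" "\<not> k \<le> lv r" using copies_less t by (auto simp: A_def)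
    then show "r \<in> matched mt" using I by (auto simp: auction_inv_def matched_def)
  qed
  have fin: "finite A" "finite B" using finite_copies finite_R by (auto simp: A_def B_def)
  have int: "A \<inter> (\<lambda>e. ow e - 1) ` B \<subseteq> P t"
  proof
    fix r assume r: "r \<in> A \<inter> (\<lambda>e. ow e - 1) ` B"
    then obtain e where e: "e \<in> B" "r = ow e - 1" by auto
    then have "ow e = Suc r" "e \<in> R" using I t by (auto simp: B_def auction_inv_def)
    then have "mt r = Suc e" "r < m" using owner_D[OF V] by auto
    moreover from this have "pr e = Suc (lv r)" using I by (auto simp: auction_inv_def)
    moreover have "lv r < t" "t \<le> pr e" using r e by (auto simp: A_def B_def)
    ultimately show "r \<in> P t" by (auto simp: P_def matched_def)
  qed
  have "max_matching_size (edges l) \<le> card A + card B"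
  proof (rule max_matching_size_le_cover[OF fin])
    fix r e assume re: "(r, e) \<in> edges l"
    then obtain x where x: "r \<in> copies l" "e \<in> R" "st r \<le> x" "x < en r" "e = el x"
      using edgesD edges_iff by metis
    then have "lv r \<le> pr e" using I by (auto simp: auction_inv_def)
    then show "r \<in> A \<or> e \<in> B" using x by (auto simp: A_def B_def)
  qed
  also have "card A + card B = card (A \<union> (\<lambda>e. ow e - 1) ` B) + card (A \<inter> (\<lambda>e. ow e - 1) ` B)"
    unfolding B(1) by (rule card_Un_Int) (use fin in auto)
  also have "\<dots> \<le> card (matched mt) + card (P t)"
    by (intro add_mono card_mono finite_matched finP int) (use A B in auto)
  finally show ?thesis using t cnt by simp
qed

subsection \<open>Augmentation\<close>

text \<open>
  \<open>rk e > 0\<close> marks the visited right vertices, in the order of discovery; \<open>pa e\<close> is the left vertex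
  from which \<open>e\<close> was discovered. The queue \<open>Q\<close> holds the reached left vertices, those before
  \<open>h\<close> have been scanned. \<open>fd = Suc e\<close> if a free right vertex \<open>e\<close> has been reached.
\<close>

definition tree_edge :: "nat \<Rightarrow> (nat \<Rightarrow> nat) \<Rightarrow> (nat \<Rightarrow> nat) \<Rightarrow> (nat \<Rightarrow> nat) \<Rightarrow> nat \<Rightarrow> bool" where
  "tree_edge l mt rk pa e \<longleftrightarrow> (pa e, e) \<in> edges l \<and>
     (\<forall>e'. mt (pa e) = Suc e' \<longrightarrow> e' \<in> R \<and> 0 < rk e' \<and> rk e' < rk e)"

text \<open>The clauses on \<open>rk\<close> make the queue length a clock: while nothing has been
  found, all ranks are at most \<open>ta\<close>, so the next discovery, ranked
  \<open>Suc ta\<close>, comes strictly last. The queue holds the free copies and the owners of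
  visited elements, which gives the bound on \<open>ta\<close>. \<open>sp\<close> holds the current
  arcs.\<close>

definition search_inv where
  "search_inv l ow mt rk pa Q sp h ta fd \<longleftrightarrow>
     h \<le> ta \<and> ta \<le> m + card {e\<in>R. 0 < rk e} \<and>
     (\<forall>x<ta. Q x \<in> copies l \<and> (\<forall>e. mt (Q x) = Suc e \<longrightarrow> e \<in> R \<and> 0 < rk e)) \<and>
     (\<forall>r\<in>copies l. mt r = 0 \<longrightarrow> (\<exists>x<ta. Q x = r)) \<and>
     (\<forall>e\<in>R. 0 < rk e \<longrightarrow> tree_edge l mt rk pa e) \<and>
     (\<forall>e\<in>R. \<forall>r. 0 < rk e \<longrightarrow> ow e = Suc r \<longrightarrow> (\<exists>x<ta. Q x = r)) \<and>
     (fd = 0 \<longrightarrow> (\<forall>e\<in>R. rk e \<le> ta \<and> (0 < rk e \<longrightarrow> 0 < ow e))) \<and>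
     (\<forall>e. fd = Suc e \<longrightarrow> e \<in> R \<and> 0 < rk e \<and> rk e \<le> Suc ta \<and> ow e = 0) \<and>
     (\<forall>r\<in>copies l. st r \<le> sp r \<and> sp r \<le> en r) \<and>
     (\<forall>r\<in>copies l. \<forall>x. st r \<le> x \<longrightarrow> x < sp r \<longrightarrow> 0 < rk (el x)) \<and>
     (\<forall>x<h. sp (Q x) = en (Q x))"

definition search_work where
  "search_work l sp h = (\<Sum>r\<in>copies l. en r - sp r) + (2 * m - h)"

lemma search_work_less:
  assumes "r \<in> copies l" "sp r < en r"
  shows "search_work l (sp(r := Suc (sp r))) h < search_work l sp h"
  unfolding search_work_def
  by (rule add_strict_right_mono, rule sum_strict_mono_ex1) (use assms finite_copies in auto)

text \<open>Keeps the truncated difference \<open>2 * m - h\<close> of \<open>search_work\<close>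
  positive while the queue is nonempty, so that removing an entry really lowers it.\<close>

lemma search_tail_le: "search_inv l ow mt rk pa Q sp h ta fd \<Longrightarrow> ta \<le> 2 * m"
proof -
  assume I: "search_inv l ow mt rk pa Q sp h ta fd"
  have "card {e\<in>R. 0 < rk e} \<le> card R" by (rule card_mono) (auto simp: finite_R)
  then show ?thesis using I card_R by (auto simp: search_inv_def)
qed

lemma search_init:
  assumes "\<And>e. e \<in> R \<Longrightarrow> rk e = 0" "\<And>r. r < m \<Longrightarrow> sp r = st r" "ta \<le> m"
    "\<And>x. x < ta \<Longrightarrow> Q x \<in> copies l \<and> mt (Q x) = 0"
    "\<And>r. r \<in> copies l \<Longrightarrow> mt r = 0 \<Longrightarrow> \<exists>x<ta. Q x = r"
  shows "search_inv l ow mt rk pa Q sp 0 ta 0"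
    and "search_work l sp 0 \<le> (l + 2) * m"
proof -
  show "search_inv l ow mt rk pa Q sp 0 ta 0"
    unfolding search_inv_def using assms st_le_en copies_less by auto
  have "(\<Sum>r\<in>copies l. en r - sp r) = (\<Sum>r\<in>copies l. en r - st r)"
    by (rule sum.cong) (use assms copies_less in auto)
  then show "search_work l sp 0 \<le> (l + 2) * m"
    unfolding search_work_def using sum_degrees[of l] by (simp add: algebra_simps)
qed

lemma search_pop:
  assumes I: "search_inv l ow mt rk pa Q sp h ta 0" and h: "h < ta" and x: "\<not> sp (Q h) < en (Q h)"
  shows "search_inv l ow mt rk pa Q sp (Suc h) ta 0"
    and "search_work l sp (Suc h) < search_work l sp h"
proof -
  have "Q h \<in> copies l" using I h by (auto simp: search_inv_def)
  then have "sp (Q h) \<le> en (Q h)" using I by (auto simp: search_inv_def)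
  then have "sp (Q h) = en (Q h)" using x by simp
  then show "search_inv l ow mt rk pa Q sp (Suc h) ta 0"
    using I h unfolding search_inv_def by (auto simp: less_Suc_eq)
  show "search_work l sp (Suc h) < search_work l sp h"
    using search_tail_le[OF I] h by (simp add: search_work_def)
qed

lemma search_seen:
  assumes I: "search_inv l ow mt rk pa Q sp h ta 0" and h: "h < ta" and r: "r = Q h" "sp r < en r"
    and e: "0 < rk (el (sp r))"
  shows "search_inv l ow mt rk pa Q (sp(r := Suc (sp r))) h ta 0"
proof -
  have nh: "Q x \<noteq> r" if "x < h" for x using I that r by (auto simp: search_inv_def)
  then show ?thesis
    using I r e unfolding search_inv_def by (auto simp: less_Suc_eq)
qed

lemma card_insert_visited:
  fixes rk :: "nat \<Rightarrow> nat"
  assumes "e \<in> R" "rk e = 0" "0 < v"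
  shows "card {e'\<in>R. 0 < (rk(e := v)) e'} = Suc (card {e'\<in>R. 0 < rk e'})"
proof -
  have "{e'\<in>R. 0 < (rk(e := v)) e'} = insert e {e'\<in>R. 0 < rk e'}" using assms by auto
  moreover have "finite {e'\<in>R. 0 < rk e'}" using finite_R by simp
  moreover have "e \<notin> {e'\<in>R. 0 < rk e'}" using assms by simp
  ultimately show ?thesis by simp
qed

text \<open>The rank \<open>Suc ta\<close> exceeds all earlier ranks, in particular that of the
  element matched to \<open>r\<close>, so the new parent pointer leads to smaller ranks. If
  \<open>e\<close> has an owner, the owner enters the queue at position \<open>ta\<close>, and the
  longer queue restores the bound on the ranks.\<close>

lemma search_discover:
  assumes I: "search_inv l ow mt rk pa Q sp h ta 0" and V: "matching l ow mt"
    and h: "h < ta" and r: "r = Q h" "sp r < en r"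
    and e: "e = el (sp r)" "rk e = 0"
  shows "ow e = 0 \<Longrightarrow> search_inv l ow mt (rk(e := Suc ta)) (pa(e := r)) Q (sp(r := Suc (sp r))) h ta (Suc e)"
    and "ow e = Suc d \<Longrightarrow>
      search_inv l ow mt (rk(e := Suc ta)) (pa(e := r)) (Q(ta := d)) (sp(r := Suc (sp r))) h (Suc ta) 0"
proof -
  have rc: "r \<in> copies l" and spr: "st r \<le> sp r" using I h r by (auto simp: search_inv_def)
  have edge: "(r, e) \<in> edges l" using edgeI[OF rc spr r(2)] e by simp
  have eR: "e \<in> R" using edgesD edge by blast
  have nh: "Q x \<noteq> r" if "x < h" for x using I that r by (auto simp: search_inv_def)
  have le: "rk e' \<le> ta" if "e' \<in> R" for e' using I that by (auto simp: search_inv_def)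
  have card: "card {e'\<in>R. 0 < (rk(e := Suc ta)) e'} = Suc (card {e'\<in>R. 0 < rk e'})"
    by (rule card_insert_visited[OF eR, of rk "Suc ta", OF e(2)]) simp
  have mr: "e' \<in> R \<and> 0 < rk e' \<and> e' \<noteq> e" if "mt r = Suc e'" for e'
    using I h r that e unfolding search_inv_def by auto
  have tree: "tree_edge l mt (rk(e := Suc ta)) (pa(e := r)) e'"
    if "e' \<in> R" "0 < (rk(e := Suc ta)) e'" for e'
  proof (cases "e' = e")
    case True
    then show ?thesis using edge mr le by (auto simp: tree_edge_def less_Suc_eq_le)
  next
    case False
    \<comment> \<open>Older tree edges survive: they mention only elements of positive rank, and
      \<open>e\<close> had rank 0.\<close>
    then have "tree_edge l mt rk pa e'" using I that by (auto simp: search_inv_def)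
    then show ?thesis using False e by (auto simp: tree_edge_def)
  qed
  have sp: "\<forall>r'\<in>copies l. st r' \<le> (sp(r := Suc (sp r))) r' \<and> (sp(r := Suc (sp r))) r' \<le> en r'"
    using I r by (auto simp: search_inv_def)
  have sc: "\<forall>r'\<in>copies l. \<forall>x. st r' \<le> x \<longrightarrow> x < (sp(r := Suc (sp r))) r' \<longrightarrow> 0 < (rk(e := Suc ta)) (el x)"
    using I e by (auto simp: search_inv_def less_Suc_eq)
  have ht: "h \<le> ta" "ta \<le> m + card {e\<in>R. 0 < rk e}" using I by (auto simp: search_inv_def)
  have q: "Q x \<in> copies l \<and> (\<forall>e'. mt (Q x) = Suc e' \<longrightarrow> e' \<in> R \<and> 0 < rk e')" if "x < ta" for x
    using I that by (auto simp: search_inv_def)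
  have free: "\<exists>x<ta. Q x = r'" if "r' \<in> copies l" "mt r' = 0" for r'
    using I that by (auto simp: search_inv_def)
  have own: "\<exists>x<ta. Q x = r'" if "e' \<in> R" "0 < rk e'" "ow e' = Suc r'" for r' e'
    using I that by (auto simp: search_inv_def)
  have own': "0 < ow e'" if "e' \<in> R" "0 < rk e'" for e'
    using I that by (auto simp: search_inv_def)
  have scanned: "sp (Q x) = en (Q x)" if "x < h" for x using I that by (auto simp: search_inv_def)
  {
    assume o: "ow e = 0"
    show "search_inv l ow mt (rk(e := Suc ta)) (pa(e := r)) Q (sp(r := Suc (sp r))) h ta (Suc e)"
      unfolding search_inv_def card
    proof (intro conjI)
      show "\<forall>e'\<in>R. \<forall>r'. 0 < (rk(e := Suc ta)) e' \<longrightarrow> ow e' = Suc r' \<longrightarrow> (\<exists>x<ta. Q x = r')"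
        using o own by auto
    qed (use ht q free tree sp sc scanned nh eR o in auto)
  }
  {
    assume o: "ow e = Suc d"
    have d: "d \<in> copies l" "mt d = Suc e" using owner_D[OF V eR o] by auto
    show "search_inv l ow mt (rk(e := Suc ta)) (pa(e := r)) (Q(ta := d)) (sp(r := Suc (sp r))) h (Suc ta) 0"
      unfolding search_inv_def card
    proof (intro conjI)
      show "\<forall>x<Suc ta. (Q(ta := d)) x \<in> copies l \<and>
          (\<forall>e'. mt ((Q(ta := d)) x) = Suc e' \<longrightarrow> e' \<in> R \<and> 0 < (rk(e := Suc ta)) e')"
        using q d eR by (auto simp: less_Suc_eq)
      show "\<forall>r'\<in>copies l. mt r' = 0 \<longrightarrow> (\<exists>x<Suc ta. (Q(ta := d)) x = r')"
        using free by (metis fun_upd_other less_SucI order_less_irrefl)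
      show "\<forall>e'\<in>R. \<forall>r'. 0 < (rk(e := Suc ta)) e' \<longrightarrow> ow e' = Suc r' \<longrightarrow> (\<exists>x<Suc ta. (Q(ta := d)) x = r')"
      proof (intro ballI allI impI)
        fix e' r' assume a: "e' \<in> R" "0 < (rk(e := Suc ta)) e'" "ow e' = Suc r'"
        show "\<exists>x<Suc ta. (Q(ta := d)) x = r'"
        proof (cases "e' = e")
          case True
          then show ?thesis using a o by (intro exI[of _ ta]) auto
        next
          case False
          then obtain x where "x < ta" "Q x = r'" using own a by auto
          then show ?thesis by (intro exI[of _ x]) auto
        qed
      qed
      show "\<forall>x<h. (sp(r := Suc (sp r))) ((Q(ta := d)) x) = en ((Q(ta := d)) x)"
        using scanned nh h by auto
      show "0 = (0::nat) \<longrightarrow> (\<forall>e'\<in>R. (rk(e := Suc ta)) e' \<le> Suc ta \<and> (0 < (rk(e := Suc ta)) e' \<longrightarrow> 0 < ow e'))"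
        using le o own' by (auto simp: le_SucI)
    qed (use ht tree sp sc in auto)
  }
qed

text \<open>
  When the search is exhausted, the unreached left vertices and the reached right vertices
  form a cover of the size of the matching.
\<close>

lemma search_exhausted:
  assumes I: "search_inv l ow mt rk pa Q sp h ta 0" and h: "\<not> h < ta" and V: "matching l ow mt"
  shows "max_matching_size (edges l) = card (matched mt)"
proof (rule antisym)
  define A where "A = {r \<in> copies l. \<not> (\<exists>x<ta. Q x = r)}"
  define B where "B = {e \<in> R. 0 < rk e}"
  have fin: "finite A" "finite B" using finite_copies finite_R by (auto simp: A_def B_def)
  have owB: "0 < ow e" if "e \<in> B" for e using I that by (auto simp: B_def search_inv_def)
  have B: "card B = card ((\<lambda>e. ow e - 1) ` B)" "(\<lambda>e. ow e - 1) ` B \<subseteq> matched mt"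
    by (rule owner_image[OF V]; use owB in \<open>force simp: B_def\<close>)+
  have A: "A \<subseteq> matched mt"
    using I copies_less by (auto simp: A_def matched_def search_inv_def)
  \<comment> \<open>Owners of visited elements have been put into the queue, so they are not among
    the unreached vertices.\<close>
  have dis: "A \<inter> (\<lambda>e. ow e - 1) ` B = {}"
  proof (rule ccontr)
    assume "\<not> ?thesis"
    then obtain e where e: "e \<in> B" "ow e - 1 \<in> A" by auto
    then have "ow e = Suc (ow e - 1)" "e \<in> R" "0 < rk e" using owB by (auto simp: B_def)
    then have "\<exists>x<ta. Q x = ow e - 1" using I unfolding search_inv_def by blast
    then show False using e by (auto simp: A_def)
  qed
  have "max_matching_size (edges l) \<le> card A + card B"
  proof (rule max_matching_size_le_cover[OF fin])
    fix r e assume re: "(r, e) \<in> edges l"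
    then obtain x where x: "r \<in> copies l" "e \<in> R" "st r \<le> x" "x < en r" "e = el x"
      using edgesD edges_iff by metis
    show "r \<in> A \<or> e \<in> B"
    proof (cases "r \<in> A")
      case False
      \<comment> \<open>The queue is empty, so a reached vertex has been scanned to the end and all
        its neighbours are visited.\<close>
      then have "sp r = en r" using x I h by (auto simp: A_def search_inv_def)
      then have "0 < rk e" using I x by (auto simp: search_inv_def)
      then show ?thesis using x by (simp add: B_def)
    qed simp
  qed
  also have "\<dots> = card (A \<union> (\<lambda>e. ow e - 1) ` B)"
    unfolding B(1) by (rule card_Un_disjoint[symmetric]) (use fin dis in auto)
  also have "\<dots> \<le> card (matched mt)"
    by (rule card_mono[OF finite_matched]) (use A B in auto)
  finally show "max_matching_size (edges l) \<le> card (matched mt)" .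
qed (rule card_matched_le_max[OF V])

text \<open>While the path is flipped from its free end, the matching keeps its old size
  \<open>n\<close> and the hole \<open>e\<close> walks towards the root; the size grows only at the
  last edge, when a free left vertex is reached. Tree edges are claimed only up to the rank of
  \<open>e\<close>, because \<open>mt\<close> has already been changed further out.\<close>

definition augment_inv where
  "augment_inv l n ow mt rk pa fd \<longleftrightarrow>
     matching l ow mt \<and>
     (fd = 0 \<longrightarrow> card (matched mt) = Suc n) \<and>
     (\<forall>e. fd = Suc e \<longrightarrow> card (matched mt) = n \<and> e \<in> R \<and> 0 < rk e \<and> ow e = 0 \<and>
        (\<forall>e'\<in>R. 0 < rk e' \<longrightarrow> rk e' \<le> rk e \<longrightarrow> tree_edge l mt rk pa e'))"

lemma augment_init:
  assumes "search_inv l ow mt rk pa Q sp h ta (Suc e)" "matching l ow mt"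
  shows "augment_inv l (card (matched mt)) ow mt rk pa (Suc e)"
  using assms by (auto simp: augment_inv_def search_inv_def)

lemma augment_step:
  assumes I: "augment_inv l n ow mt rk pa (Suc e)"
    and "r = pa e"
    and ow': "ow' = (if mt r = 0 then ow(e := Suc r) else ow(e := Suc r, mt r - 1 := 0))"
  shows "augment_inv l n ow' (mt(r := Suc e)) rk pa (mt r)"
    and "mt r = 0 \<or> rk (mt r - 1) < rk e"
proof -
  have V: "matching l ow mt" and e: "card (matched mt) = n" "e \<in> R" "0 < rk e" "ow e = 0"
    and T: "\<And>e'. e' \<in> R \<Longrightarrow> 0 < rk e' \<Longrightarrow> rk e' \<le> rk e \<Longrightarrow> tree_edge l mt rk pa e'"
    using I by (auto simp: augment_inv_def)
  have te: "(r, e) \<in> edges l" "\<And>e'. mt r = Suc e' \<Longrightarrow> e' \<in> R \<and> 0 < rk e' \<and> rk e' < rk e"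
    using T[OF e(2,3) order_refl] assms(2) by (auto simp: tree_edge_def)
  show "mt r = 0 \<or> rk (mt r - 1) < rk e" using te(2) by (cases "mt r") auto
  show "augment_inv l n ow' (mt(r := Suc e)) rk pa (mt r)"
  proof (cases "mt r")
    case 0
    then show ?thesis
      using matching_take[OF V te(1) 0 e(4)] ow' e by (simp add: augment_inv_def)
  next
    case (Suc e1)
    have e1: "e1 \<in> R" "0 < rk e1" "rk e1 < rk e" using te(2)[OF Suc] by auto
    \<comment> \<open>A tree edge starting at \<open>r\<close> has rank above that of the mate
      \<open>e1\<close> of \<open>r\<close>. Edges of rank at most \<open>rk e1\<close> therefore do
      not start at \<open>r\<close> and are untouched by the update of \<open>mt r\<close>.\<close>
    have tr: "tree_edge l (mt(r := Suc e)) rk pa e'" if "e' \<in> R" "0 < rk e'" "rk e' \<le> rk e1" for e'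
    proof -
      have t: "tree_edge l mt rk pa e'" using T that e1 by simp
      then have "pa e' \<noteq> r" using Suc that by (auto simp: tree_edge_def)
      then show ?thesis using t by (simp add: tree_edge_def)
    qed
    have "ow' = ow(e := Suc r, e1 := 0)" using ow' Suc by simp
    then show ?thesis
      using matching_shift[OF V te(1) Suc e(4)] e e1 tr Suc by (simp add: augment_inv_def)
  qed
qed

end

section \<open>Total-correctness reasoning with step counts\<close>

definition runs :: "(nat \<Rightarrow> real) \<Rightarrow> com \<Rightarrow> state \<Rightarrow> nat \<Rightarrow> (state \<Rightarrow> bool) \<Rightarrow> bool" where
  "runs \<omega> c s T Q \<longleftrightarrow> (\<exists>t s'. exec \<omega> c s t s' \<and> t \<le> T \<and> Q s')"

primrec nat_writes :: "com \<Rightarrow> string set" where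
  "nat_writes SKIP = {}"
| "nat_writes (NAssign x i e) = {x}"
| "nat_writes (RAssign x i e) = {}"
| "nat_writes (Draw x i) = {}"
| "nat_writes (Seq c1 c2) = nat_writes c1 \<union> nat_writes c2"
| "nat_writes (Cond b c1 c2) = nat_writes c1 \<union> nat_writes c2"
| "nat_writes (While b c) = nat_writes c"

primrec real_writes :: "com \<Rightarrow> string set" where
  "real_writes SKIP = {}"
| "real_writes (NAssign x i e) = {}"
| "real_writes (RAssign x i e) = {x}"
| "real_writes (Draw x i) = {x}"
| "real_writes (Seq c1 c2) = real_writes c1 \<union> real_writes c2"
| "real_writes (Cond b c1 c2) = real_writes c1 \<union> real_writes c2"
| "real_writes (While b c) = real_writes c"

primrec draw_free :: "com \<Rightarrow> bool" where
  "draw_free SKIP \<longleftrightarrow> True"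
| "draw_free (NAssign x i e) \<longleftrightarrow> True"
| "draw_free (RAssign x i e) \<longleftrightarrow> True"
| "draw_free (Draw x i) \<longleftrightarrow> False"
| "draw_free (Seq c1 c2) \<longleftrightarrow> draw_free c1 \<and> draw_free c2"
| "draw_free (Cond b c1 c2) \<longleftrightarrow> draw_free c1 \<and> draw_free c2"
| "draw_free (While b c) \<longleftrightarrow> draw_free c"

primrec loop_free :: "com \<Rightarrow> bool" where
  "loop_free SKIP \<longleftrightarrow> True"
| "loop_free (NAssign x i e) \<longleftrightarrow> True"
| "loop_free (RAssign x i e) \<longleftrightarrow> True"
| "loop_free (Draw x i) \<longleftrightarrow> True"
| "loop_free (Seq c1 c2) \<longleftrightarrow> loop_free c1 \<and> loop_free c2"
| "loop_free (Cond b c1 c2) \<longleftrightarrow> loop_free c1 \<and> loop_free c2"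
| "loop_free (While b c) \<longleftrightarrow> False"

text \<open>\<open>effect\<close> and \<open>ccost\<close> are only meaningful for loop-free programs.\<close>

primrec effect :: "(nat \<Rightarrow> real) \<Rightarrow> com \<Rightarrow> state \<Rightarrow> state" where
  "effect \<omega> SKIP s = s"
| "effect \<omega> (NAssign x i e) s = s\<lparr>nmem := (nmem s)(x := (nmem s x)(nval i s := nval e s))\<rparr>"
| "effect \<omega> (RAssign x i e) s = s\<lparr>rmem := (rmem s)(x := (rmem s x)(nval i s := rval e s))\<rparr>"
| "effect \<omega> (Draw x i) s =
    s\<lparr>rmem := (rmem s)(x := (rmem s x)(nval i s := \<omega> (drawn s))), drawn := Suc (drawn s)\<rparr>"
| "effect \<omega> (Seq c1 c2) s = effect \<omega> c2 (effect \<omega> c1 s)"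
| "effect \<omega> (Cond b c1 c2) s = (if bval b s then effect \<omega> c1 s else effect \<omega> c2 s)"
| "effect \<omega> (While b c) s = s"

primrec ccost :: "com \<Rightarrow> nat" where
  "ccost SKIP = 1"
| "ccost (NAssign x i e) = 1 + ncost i + ncost e"
| "ccost (RAssign x i e) = 1 + ncost i + rcost e"
| "ccost (Draw x i) = 1 + ncost i"
| "ccost (Seq c1 c2) = 1 + ccost c1 + ccost c2"
| "ccost (Cond b c1 c2) = 1 + bcost b + max (ccost c1) (ccost c2)"
| "ccost (While b c) = 0"

text \<open>The frame condition: a name that the program does not assign keeps its whole array. Loop
  invariants need only mention what the body changes; the rest is recovered from the syntactic sets
  of written names.\<close>

definition agree :: "com \<Rightarrow> state \<Rightarrow> state \<Rightarrow> bool" where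
  "agree c s s' \<longleftrightarrow> (\<forall>x. x \<notin> nat_writes c \<longrightarrow> nmem s' x = nmem s x) \<and>
     (\<forall>x. x \<notin> real_writes c \<longrightarrow> rmem s' x = rmem s x) \<and> (draw_free c \<longrightarrow> drawn s' = drawn s)"

lemma agree_refl: "agree c s s" by (simp add: agree_def)
lemma agree_trans: "agree c s1 s2 \<Longrightarrow> agree c s2 s3 \<Longrightarrow> agree c s1 s3" by (simp add: agree_def)
lemma agree_While: "agree (While b c) = agree c" by (intro ext) (simp add: agree_def)
lemma agree_nmem: "agree c s s' \<Longrightarrow> x \<notin> nat_writes c \<Longrightarrow> nmem s' x = nmem s x" by (simp add: agree_def)
lemma agree_rmem: "agree c s s' \<Longrightarrow> x \<notin> real_writes c \<Longrightarrow> rmem s' x = rmem s x" by (simp add: agree_def)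
lemma agree_drawn: "agree c s s' \<Longrightarrow> draw_free c \<Longrightarrow> drawn s' = drawn s" by (simp add: agree_def)

lemma exec_agree: "exec \<omega> c s t s' \<Longrightarrow> agree c s s'"
proof (induction rule: exec.induct)
  case (Seq c1 s1 t1 s2 c2 t2 s3) then show ?case by (auto simp: agree_def)
next
  case (WhileTrue b s1 c t1 s2 t2 s3) then show ?case by (auto simp: agree_def)
qed (auto simp: agree_def)

lemma runs_conseq:
  assumes "runs \<omega> c s T Q" "T \<le> T'" "\<And>s'. Q s' \<Longrightarrow> agree c s s' \<Longrightarrow> Q' s'"
  shows "runs \<omega> c s T' Q'"
proof -
  obtain t s' where "exec \<omega> c s t s'" "t \<le> T" "Q s'" using assms(1) by (auto simp: runs_def)
  then show ?thesis using assms(2,3) exec_agree unfolding runs_def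
    by (intro exI[of _ t] exI[of _ s']) auto
qed

lemma runs_Seq:
  assumes "runs \<omega> c1 s T1 R" "\<And>s'. R s' \<Longrightarrow> agree c1 s s' \<Longrightarrow> runs \<omega> c2 s' T2 Q" "1 + T1 + T2 \<le> T"
  shows "runs \<omega> (Seq c1 c2) s T Q"
proof -
  obtain t1 s1 where 1: "exec \<omega> c1 s t1 s1" "t1 \<le> T1" "R s1" using assms(1) by (auto simp: runs_def)
  then obtain t2 s2 where 2: "exec \<omega> c2 s1 t2 s2" "t2 \<le> T2" "Q s2"
    using assms(2)[of s1] exec_agree by (auto simp: runs_def)
  show ?thesis unfolding runs_def
    using exec.Seq[OF 1(1) 2(1)] 1 2 assms(3)
    by (intro exI[of _ "1 + t1 + t2"] exI[of _ s2]) auto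
qed

lemma runs_Cond:
  assumes "bval b s \<Longrightarrow> runs \<omega> c1 s T1 Q" "\<not> bval b s \<Longrightarrow> runs \<omega> c2 s T1 Q" "1 + bcost b + T1 \<le> T"
  shows "runs \<omega> (Cond b c1 c2) s T Q"
proof (cases "bval b s")
  case True
  then obtain t s' where "exec \<omega> c1 s t s'" "t \<le> T1" "Q s'" using assms(1) by (auto simp: runs_def)
  then show ?thesis unfolding runs_def using exec.CondTrue[OF True] assms(3)
    by (intro exI[of _ "1 + bcost b + t"] exI[of _ s']) auto
next
  case False
  then obtain t s' where "exec \<omega> c2 s t s'" "t \<le> T1" "Q s'" using assms(2) by (auto simp: runs_def)
  then show ?thesis unfolding runs_def using exec.CondFalse[OF False] assms(3)
    by (intro exI[of _ "1 + bcost b + t"] exI[of _ s']) auto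
qed

lemma exec_effect: "loop_free c \<Longrightarrow> \<exists>t. exec \<omega> c s t (effect \<omega> c s) \<and> t \<le> ccost c"
proof (induction c arbitrary: s)
  case (Seq c1 c2)
  then obtain t1 t2 where "exec \<omega> c1 s t1 (effect \<omega> c1 s)" "t1 \<le> ccost c1"
    "exec \<omega> c2 (effect \<omega> c1 s) t2 (effect \<omega> (Seq c1 c2) s)" "t2 \<le> ccost c2" by force
  then show ?case using exec.Seq by (intro exI[of _ "1 + t1 + t2"]) auto
next
  case (Cond b c1 c2)
  obtain t1 t2 where "exec \<omega> c1 s t1 (effect \<omega> c1 s)" "t1 \<le> ccost c1"
    "exec \<omega> c2 s t2 (effect \<omega> c2 s)" "t2 \<le> ccost c2" using Cond by force
  then show ?case
    using exec.CondTrue[of b s \<omega> c1] exec.CondFalse[of b s \<omega> c2]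
    by (cases "bval b s") (force simp: max_def)+
qed (auto intro: exec.intros)

lemma runs_loop_free:
  assumes "loop_free c" "ccost c \<le> T" "Q (effect \<omega> c s)"
  shows "runs \<omega> c s T Q"
  using exec_effect[OF assms(1), of \<omega> s] assms(2,3) unfolding runs_def by (meson le_trans)

text \<open>The variant drops in every iteration, so at most \<open>N\<close> bodies and
  \<open>N + 1\<close> guards are evaluated, each body at the flat price \<open>K\<close>. All
  amortisation is thus put into the choice of the variant. Agreement with \<open>s0\<close> is
  carried along for the frame.\<close>

lemma runs_While:
  assumes I: "I s0"
    and step: "\<And>s. I s \<Longrightarrow> agree c s0 s \<Longrightarrow> bval b s \<Longrightarrow> runs \<omega> c s K (\<lambda>s'. I s' \<and> \<mu> s' < \<mu> s)"
    and N: "\<mu> s0 \<le> (N :: nat)" and exit: "\<And>s. I s \<Longrightarrow> agree c s0 s \<Longrightarrow> \<not> bval b s \<Longrightarrow> Q s"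
    and T: "(N + 1) * (1 + bcost b + K) \<le> T"
  shows "runs \<omega> (While b c) s0 T Q"
proof -
  have "I s \<Longrightarrow> agree c s0 s \<Longrightarrow> \<exists>t s'. exec \<omega> (While b c) s t s' \<and> t \<le> (\<mu> s + 1) * (1 + bcost b + K) \<and> Q s'" for s
  proof (induction "\<mu> s" arbitrary: s rule: less_induct)
    case less
    show ?case
    proof (cases "bval b s")
      case True
      from step[OF less.prems True] obtain t1 s1 where
        1: "exec \<omega> c s t1 s1" "t1 \<le> K" "I s1" "\<mu> s1 < \<mu> s" by (auto simp: runs_def)
      then have "agree c s0 s1" using agree_trans[OF less.prems(2) exec_agree] by blast
      from less.hyps[OF 1(4,3) this] obtain t2 s2 where
        2: "exec \<omega> (While b c) s1 t2 s2" "t2 \<le> (\<mu> s1 + 1) * (1 + bcost b + K)" "Q s2" by blast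
      have "t2 \<le> \<mu> s * (1 + bcost b + K)"
        using 2(2) mult_le_mono1[of "\<mu> s1 + 1" "\<mu> s" "1 + bcost b + K"] 1(4) by linarith
      then show ?thesis using exec.WhileTrue[OF True 1(1) 2(1)] 1(2) 2(3)
        by (intro exI[of _ "1 + bcost b + t1 + t2"] exI[of _ s2]) auto
    next
      case False
      then show ?thesis using exec.WhileFalse[OF False, of \<omega> c] exit[OF less.prems]
        by (intro exI[of _ "1 + bcost b"] exI[of _ s]) auto
    qed
  qed
  from this[OF I agree_refl] obtain t s' where
    *: "exec \<omega> (While b c) s0 t s'" "t \<le> (\<mu> s0 + 1) * (1 + bcost b + K)" "Q s'" by blast
  have "t \<le> T" using *(2) T mult_le_mono1[of "\<mu> s0 + 1" "N + 1" "1 + bcost b + K"] N by linarith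
  then show ?thesis using * by (auto simp: runs_def)
qed

text \<open>The innermost loops are handled by symbolic evaluation of \<open>effect\<close>. Their
  factors 100 and 200 are generous values of \<open>K\<close>.\<close>

lemma runs_While_loop_free:
  assumes "loop_free c" "I s0"
    and "\<And>s. I s \<Longrightarrow> agree c s0 s \<Longrightarrow> bval b s \<Longrightarrow> I (effect \<omega> c s) \<and> \<mu> (effect \<omega> c s) < \<mu> s"
    and "\<mu> s0 \<le> (N :: nat)" "\<And>s. I s \<Longrightarrow> agree c s0 s \<Longrightarrow> \<not> bval b s \<Longrightarrow> Q s"
    and "1 + bcost b + ccost c \<le> K"
  shows "runs \<omega> (While b c) s0 ((N + 1) * K) Q"
  by (rule runs_While[where I = I and \<mu> = \<mu> and K = "ccost c", OF assms(2) _ assms(4,5)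
        mult_le_mono2[OF assms(6)]])
    (use assms(1,3) in \<open>auto intro!: runs_loop_free\<close>)

section \<open>The program\<close>

abbreviation N where "N \<equiv> NConst"
abbreviation V where "V x \<equiv> NIdx x (NConst 0)"
abbreviation NSet where "NSet x \<equiv> NAssign x (NConst 0)"
abbreviation RV where "RV x \<equiv> RIdx x (NConst 0)"
abbreviation RSet where "RSet x \<equiv> RAssign x (NConst 0)"
abbreviation Inc where "Inc x \<equiv> NSet x (NAdd (V x) (N 1))"
notation Seq (infixr ";;" 60)

text \<open>
  \<open>person\<close>, \<open>elem\<close>, \<open>st\<close>, \<open>mate\<close>, \<open>lev\<close>, \<open>ptr\<close>, \<open>sp\<close> are indexed by records;
  \<open>own\<close>, \<open>price\<close>, \<open>rank\<close>, \<open>par\<close> by elements.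
\<close>

definition start_body :: com where "start_body =
  Cond (BConj (BNatLess (N 0) (V ''i''))
          (BNeg (BNatLess (NIdx ''person'' (NSub (V ''i'') (N 1))) (NIdx ''person'' (V ''i'')))))
    (NAssign ''st'' (V ''i'') (NIdx ''st'' (NSub (V ''i'') (N 1))))
    (NAssign ''st'' (V ''i'') (V ''i'')) ;;
  Inc ''i''"

text \<open>\<open>sq\<close> follows the square of \<open>k\<close> through (k + 1)^2 = k^2 + (k +
  k + 1), which needs additions only.\<close>

definition sqrt_body :: com where "sqrt_body =
  NSet ''sq'' (NAdd (V ''sq'') (NAdd (V ''k'') (NAdd (V ''k'') (N 1)))) ;; Inc ''k''"

text \<open>Element names are arbitrary naturals, so an array indexed by them cannot be cleared cell
  by cell in linear time. Only the cells of names that occur in some record are reset, and only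
  these are ever read.\<close>

definition reset_body :: com where "reset_body =
  NAssign ''own'' (NIdx ''elem'' (V ''i'')) (N 0) ;;
  NAssign ''price'' (NIdx ''elem'' (V ''i'')) (N 0) ;;
  NAssign ''mate'' (V ''i'') (N 0) ;;
  NAssign ''lev'' (V ''i'') (N 0) ;;
  NAssign ''ptr'' (V ''i'') (NIdx ''st'' (V ''i'')) ;;
  Inc ''i''"

text \<open>Copying \<open>own\<close> into \<open>act\<close> before overwriting it hands the turn
  to the displaced bidder. There is at most one active bidder at any time, so no stack of free
  vertices is needed.\<close>

definition auction_body :: com where "auction_body =
  Cond (BNatLess (N 0) (V ''act''))
    (NSet ''r'' (NSub (V ''act'') (N 1)) ;;
     Cond (BConj (BNatLess (NIdx ''ptr'' (V ''r'')) (V ''size''))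
             (BNeg (BNatLess (NIdx ''person'' (V ''r'')) (NIdx ''person'' (NIdx ''ptr'' (V ''r''))))))
       (NSet ''e'' (NIdx ''elem'' (NIdx ''ptr'' (V ''r''))) ;;
        NAssign ''ptr'' (V ''r'') (NAdd (NIdx ''ptr'' (V ''r'')) (N 1)) ;;
        Cond (BNatLess (NIdx ''price'' (V ''e'')) (NAdd (NIdx ''lev'' (V ''r'')) (N 1)))
          (NSet ''act'' (NIdx ''own'' (V ''e'')) ;;
           NAssign ''price'' (V ''e'') (NAdd (NIdx ''price'' (V ''e'')) (N 1)) ;;
           NAssign ''own'' (V ''e'') (NAdd (V ''r'') (N 1)) ;;
           NAssign ''mate'' (V ''r'') (NAdd (V ''e'') (N 1)) ;;
           Cond (BNatLess (N 0) (V ''act''))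
             (NAssign ''mate'' (NSub (V ''act'') (N 1)) (N 0))
             (Inc ''cnt''))
          SKIP)
       (NAssign ''lev'' (V ''r'') (NAdd (NIdx ''lev'' (V ''r'')) (N 1)) ;;
        NAssign ''ptr'' (V ''r'') (NIdx ''st'' (V ''r'')) ;;
        Cond (BNatLess (NIdx ''lev'' (V ''r'')) (V ''k'')) SKIP (NSet ''act'' (N 0))))
    (Cond (BNatLess (V ''i'') (NAdd (NIdx ''st'' (V ''i'')) (V ''l'')))
       (NSet ''act'' (NAdd (V ''i'') (N 1))) SKIP ;;
     Inc ''i'')"

definition prepare_body :: com where "prepare_body =
  NAssign ''rank'' (NIdx ''elem'' (V ''i'')) (N 0) ;;
  NAssign ''sp'' (V ''i'') (NIdx ''st'' (V ''i'')) ;;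
  Cond (BConj (BNatLess (V ''i'') (NAdd (NIdx ''st'' (V ''i'')) (V ''l'')))
          (BNeg (BNatLess (N 0) (NIdx ''mate'' (V ''i'')))))
    (NAssign ''queue'' (V ''tail'') (V ''i'') ;; Inc ''tail'') SKIP ;;
  Inc ''i''"

definition search_body :: com where "search_body =
  NSet ''r'' (NIdx ''queue'' (V ''head'')) ;;
  Cond (BConj (BNatLess (NIdx ''sp'' (V ''r'')) (V ''size''))
          (BNeg (BNatLess (NIdx ''person'' (V ''r'')) (NIdx ''person'' (NIdx ''sp'' (V ''r''))))))
    (NSet ''e'' (NIdx ''elem'' (NIdx ''sp'' (V ''r''))) ;;
     NAssign ''sp'' (V ''r'') (NAdd (NIdx ''sp'' (V ''r'')) (N 1)) ;;
     Cond (BNatLess (N 0) (NIdx ''rank'' (V ''e''))) SKIP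
       (NAssign ''par'' (V ''e'') (V ''r'') ;;
        NAssign ''rank'' (V ''e'') (NAdd (V ''tail'') (N 1)) ;;
        Cond (BNatLess (N 0) (NIdx ''own'' (V ''e'')))
          (NAssign ''queue'' (V ''tail'') (NSub (NIdx ''own'' (V ''e'')) (N 1)) ;; Inc ''tail'')
          (NSet ''found'' (NAdd (V ''e'') (N 1)))))
    (Inc ''head'')"

definition augment_body :: com where "augment_body =
  NSet ''e'' (NSub (V ''found'') (N 1)) ;;
  NSet ''r'' (NIdx ''par'' (V ''e'')) ;;
  NSet ''found'' (NIdx ''mate'' (V ''r'')) ;;
  NAssign ''mate'' (V ''r'') (NAdd (V ''e'') (N 1)) ;;
  NAssign ''own'' (V ''e'') (NAdd (V ''r'') (N 1)) ;;
  Cond (BNatLess (N 0) (V ''found'')) (NAssign ''own'' (NSub (V ''found'') (N 1)) (N 0)) SKIP"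

definition phase_body :: com where "phase_body =
  (NSet ''i'' (N 0) ;; NSet ''tail'' (N 0)) ;;
  While (BNatLess (V ''i'') (V ''size'')) prepare_body ;;
  (NSet ''head'' (N 0) ;; NSet ''found'' (N 0)) ;;
  While (BConj (BNatLess (V ''head'') (V ''tail'')) (BNeg (BNatLess (N 0) (V ''found'')))) search_body ;;
  Cond (BNatLess (N 0) (V ''found''))
    (Inc ''cnt'' ;; While (BNatLess (N 0) (V ''found'')) augment_body)
    (NSet ''go'' (N 0))"

text \<open>The sum in the guard of the auction loop is positive if a bidder is active or some
  position is still unconsidered; with truncated subtraction it expresses a disjunction as a single
  comparison.\<close>

definition matching_prog :: com where "matching_prog =
  NSet ''i'' (N 0) ;;
  While (BNatLess (V ''i'') (V ''size'')) reset_body ;;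
  (NSet ''i'' (N 0) ;; NSet ''act'' (N 0) ;; NSet ''cnt'' (N 0)) ;;
  While (BNatLess (N 0) (NAdd (V ''act'') (NSub (V ''size'') (V ''i'')))) auction_body ;;
  NSet ''go'' (N 1) ;;
  While (BNatLess (N 0) (V ''go'')) phase_body"

definition query_body :: com where "query_body =
  Inc ''l'' ;;
  matching_prog ;;
  RAssign ''q'' (V ''l'')
    (RSub (RNat (V ''cnt''))
      (RMul (RDiv (RMul (RNat (N 2)) (RNat (V ''l''))) (RV ''eps''))
        (RLn (RDiv (RNat (N 1)) (RMul (RNat (N 2)) (RV ''beta''))))))"

section \<open>Correctness and cost of the loops of the matching program\<close>

context records
begin

definition layout :: "nat \<Rightarrow> nat \<Rightarrow> state \<Rightarrow> bool" where
  "layout l k s \<longleftrightarrow> nmem s ''size'' 0 = m \<and> nmem s ''person'' = p \<and> nmem s ''elem'' = el \<and>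
     (\<forall>r<m. nmem s ''st'' r = st r) \<and> nmem s ''l'' 0 = l \<and> nmem s ''k'' 0 = k"

definition auction_state :: "nat \<Rightarrow> nat \<Rightarrow> state \<Rightarrow> bool" where
  "auction_state l k s \<longleftrightarrow> auction_inv l k (nmem s ''own'') (nmem s ''mate'') (nmem s ''price'') (nmem s ''lev'')
     (nmem s ''ptr'') (nmem s ''i'' 0) (nmem s ''act'' 0) (nmem s ''cnt'' 0)"

lemma auction_step:
  assumes I: "auction_state l k s" and E: "layout l k s"
    and b: "bval (BNatLess (N 0) (NAdd (V ''act'') (NSub (V ''size'') (V ''i'')))) s" and k: "0 < k"
  shows "auction_state l k (effect \<omega> auction_body s) \<and>
    auction_work l k (nmem (effect \<omega> auction_body s) ''lev'') (nmem (effect \<omega> auction_body s) ''ptr'')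
        (nmem (effect \<omega> auction_body s) ''i'' 0)
      < auction_work l k (nmem s ''lev'') (nmem s ''ptr'') (nmem s ''i'' 0)"
proof (cases "nmem s ''act'' 0")
  case 0
  have i: "nmem s ''i'' 0 < m" "nmem s ''st'' (nmem s ''i'' 0) = st (nmem s ''i'' 0)"
    using b E 0 by (auto simp: layout_def)
  show ?thesis
    using I E 0 k i auction_skip auction_inject auction_work_Suc
    unfolding auction_state_def
    by (simp add: auction_body_def layout_def)
next
  case (Suc r)
  have J: "auction_inv l k (nmem s ''own'') (nmem s ''mate'') (nmem s ''price'') (nmem s ''lev'')
     (nmem s ''ptr'') (nmem s ''i'' 0) (Suc r) (nmem s ''cnt'' 0)"
    using I Suc by (simp add: auction_state_def)
  have r: "r \<in> copies l" "r < m" "st r \<le> nmem s ''ptr'' r"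
    using J copies_less by (auto simp: auction_inv_def)
  have str: "nmem s ''st'' r = st r" using E r by (simp add: layout_def)
  note simps = auction_body_def auction_state_def Suc str
  have g: "(nmem s ''ptr'' r < nmem s ''size'' 0 \<and> \<not> nmem s ''person'' r < nmem s ''person'' (nmem s ''ptr'' r))
      \<longleftrightarrow> nmem s ''ptr'' r < en r"
    using scan_guard[OF r(3)] E by (simp add: layout_def)
  have kk: "nmem s ''k'' 0 = k" "nmem s ''elem'' = el" using E by (auto simp: layout_def)
  show ?thesis
  proof (cases "nmem s ''ptr'' r < en r")
    case True
    note x = True
    have g1: "nmem s ''ptr'' r < nmem s ''size'' 0" "\<not> nmem s ''person'' r < nmem s ''person'' (nmem s ''ptr'' r)"
      using g x by blast+
    show ?thesis
    proof (cases "nmem s ''lev'' r < nmem s ''price'' (el (nmem s ''ptr'' r))")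
      case True
      then show ?thesis using auction_advance[OF J x True] g1 x
        by (simp add: simps kk)
    next
      case False
      then have lt: "nmem s ''price'' (el (nmem s ''ptr'' r)) < Suc (nmem s ''lev'' r)" by simp
      show ?thesis
        using auction_take[OF J x refl lt refl refl] auction_take_work[OF J x] g1 x lt
        by (cases "nmem s ''own'' (el (nmem s ''ptr'' r)) = 0") (simp_all add: simps kk)
    qed
  next
    case False
    then have d: "\<not> nmem s ''ptr'' r < nmem s ''size'' 0 \<or> nmem s ''person'' r < nmem s ''person'' (nmem s ''ptr'' r)"
      using g by blast
    show ?thesis using d auction_raise[OF J False]
      by - (erule disjE; cases "Suc (nmem s ''lev'' r) < k"; simp add: simps kk)
  qed
qed


lemma layout_agree:
  assumes "layout l k s0" "agree c s0 s"
    and "nat_writes c \<inter> {''size'', ''person'', ''elem'', ''st'', ''l'', ''k''} = {}"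
  shows "layout l k s"
proof -
  have "nmem s x = nmem s0 x" if "x \<in> {''size'', ''person'', ''elem'', ''st'', ''l'', ''k''}" for x
    by (rule agree_nmem[OF assms(2)]) (use assms(3) that in blast)
  then show ?thesis using assms(1) by (simp add: layout_def)
qed

lemma start_loop:
  assumes "nmem s0 ''size'' 0 = m" "nmem s0 ''person'' = p" "nmem s0 ''i'' 0 = 0"
  shows "runs \<omega> (While (BNatLess (V ''i'') (V ''size'')) start_body) s0 ((m + 1) * 100)
    (\<lambda>s. \<forall>r<m. nmem s ''st'' r = st r)"
proof -
  let ?I = "\<lambda>s. nmem s ''i'' 0 \<le> m \<and> (\<forall>r<nmem s ''i'' 0. nmem s ''st'' r = st r)"
  let ?\<mu> = "\<lambda>s. m - nmem s ''i'' 0"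
  show ?thesis
  proof (rule runs_While_loop_free[where N = m and \<mu> = ?\<mu> and I = ?I])
    fix s assume I: "?I s" and ag: "agree start_body s0 s"
    have E: "nmem s ''size'' 0 = m" "nmem s ''person'' = p"
      using assms agree_nmem[OF ag] by (simp_all add: start_body_def)
    show "\<forall>r<m. nmem s ''st'' r = st r" if "\<not> bval (BNatLess (V ''i'') (V ''size'')) s"
      using that I E by simp
    assume "bval (BNatLess (V ''i'') (V ''size'')) s"
    then have i: "nmem s ''i'' 0 < m" using E by simp
    let ?s = "effect \<omega> start_body s"
    show "?I ?s \<and> ?\<mu> ?s < ?\<mu> s"
      using I E i st_0 st_step[of "nmem s ''i'' 0"]
      by (cases "nmem s ''i'' 0 = 0") (auto simp: start_body_def less_Suc_eq)
  qed (use assms in \<open>simp_all add: start_body_def\<close>)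
qed

lemma reset_loop:
  assumes "layout l k s0" "nmem s0 ''i'' 0 = 0"
  shows "runs \<omega> (While (BNatLess (V ''i'') (V ''size'')) reset_body) s0 ((m + 1) * 100)
    (\<lambda>s. layout l k s \<and> (\<forall>r<m. nmem s ''mate'' r = 0 \<and> nmem s ''lev'' r = 0 \<and> nmem s ''ptr'' r = st r) \<and>
       (\<forall>e\<in>R. nmem s ''own'' e = 0 \<and> nmem s ''price'' e = 0))" (is "runs _ _ _ _ ?Q")
proof -
  let ?I = "\<lambda>s. nmem s ''i'' 0 \<le> m \<and> (\<forall>r<nmem s ''i'' 0. nmem s ''mate'' r = 0 \<and> nmem s ''lev'' r = 0 \<and>
    nmem s ''ptr'' r = st r \<and> nmem s ''own'' (el r) = 0 \<and> nmem s ''price'' (el r) = 0)"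
  let ?\<mu> = "\<lambda>s. m - nmem s ''i'' 0"
  show ?thesis
  proof (rule runs_While_loop_free[where N = m and \<mu> = ?\<mu> and I = ?I])
    fix s assume I: "?I s" and ag: "agree reset_body s0 s"
    have E: "layout l k s" by (rule layout_agree[OF assms(1) ag]) (simp add: reset_body_def)
    {
      assume "bval (BNatLess (V ''i'') (V ''size'')) s"
      then have "nmem s ''i'' 0 < m" using E by (simp add: layout_def)
      then show "?I (effect \<omega> reset_body s) \<and> ?\<mu> (effect \<omega> reset_body s) < ?\<mu> s"
        using I E by (auto simp: reset_body_def less_Suc_eq layout_def)
    next
      assume "\<not> bval (BNatLess (V ''i'') (V ''size'')) s"
      then have "nmem s ''i'' 0 = m" using E I by (simp add: layout_def)
      then show "?Q s" using I E by (auto simp: R_def)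
    }
  qed (use assms in \<open>simp_all add: reset_body_def\<close>)
qed

lemma auction_loop:
  assumes E: "layout l k s0" and k: "0 < k" and z: "nmem s0 ''i'' 0 = 0" "nmem s0 ''act'' 0 = 0" "nmem s0 ''cnt'' 0 = 0"
    and r: "\<forall>r<m. nmem s0 ''mate'' r = 0 \<and> nmem s0 ''lev'' r = 0 \<and> nmem s0 ''ptr'' r = st r"
    and e: "\<forall>e\<in>R. nmem s0 ''own'' e = 0 \<and> nmem s0 ''price'' e = 0"
  shows "runs \<omega> (While (BNatLess (N 0) (NAdd (V ''act'') (NSub (V ''size'') (V ''i'')))) auction_body) s0
    (((k + 1) * (l + 1) * m + m + 1) * 200)
    (\<lambda>s. layout l k s \<and> auction_state l k s \<and> nmem s ''i'' 0 = m \<and> nmem s ''act'' 0 = 0)"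
    (is "runs _ (While ?b _) _ _ ?Q")
proof -
  let ?\<mu> = "\<lambda>s. auction_work l k (nmem s ''lev'') (nmem s ''ptr'') (nmem s ''i'' 0)"
  show ?thesis
  proof (rule runs_While_loop_free[where I = "auction_state l k" and N = "(k + 1) * (l + 1) * m + m" and \<mu> = ?\<mu>])
    fix s assume I: "auction_state l k s" and ag: "agree auction_body s0 s"
    have E': "layout l k s" by (rule layout_agree[OF E ag]) (simp add: auction_body_def)
    show "auction_state l k (effect \<omega> auction_body s) \<and> ?\<mu> (effect \<omega> auction_body s) < ?\<mu> s" if "bval ?b s"
      by (rule auction_step[OF I E' that k])
    show "?Q s" if "\<not> bval ?b s"
      using that I E' by (auto simp: auction_state_def auction_inv_def layout_def)
  next
    show "auction_state l k s0"
      unfolding auction_state_def z by (rule auction_init) (use r e in auto)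
    show "?\<mu> s0 \<le> (k + 1) * (l + 1) * m + m"
      unfolding z by (rule auction_init(2)) (use r e in auto)
  qed (simp_all add: auction_body_def)
qed

text \<open>At \<open>i = m\<close> this supplies what \<open>search_init\<close> asks for: every
  free copy is in the queue before the search starts.\<close>

definition prepare_inv where
  "prepare_inv l mt rk sp Q i ta \<longleftrightarrow> i \<le> m \<and> ta \<le> i \<and> (\<forall>r<i. rk (el r) = (0::nat) \<and> sp r = st r) \<and>
     (\<forall>x<ta. Q x \<in> copies l \<and> mt (Q x) = (0::nat)) \<and>
     (\<forall>r\<in>copies l. r < i \<longrightarrow> mt r = 0 \<longrightarrow> (\<exists>x<ta. Q x = r))"

lemma prepare_push:
  assumes "prepare_inv l mt rk sp Q i ta" "i < m" "i < st i + l" "mt i = 0"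
  shows "prepare_inv l mt (rk(el i := 0)) (sp(i := st i)) (Q(ta := i)) (Suc i) (Suc ta)"
  unfolding prepare_inv_def
proof (intro conjI)
  show "\<forall>r\<in>copies l. r < Suc i \<longrightarrow> mt r = 0 \<longrightarrow> (\<exists>x<Suc ta. (Q(ta := i)) x = r)"
  proof (intro ballI impI)
    fix r assume r: "r \<in> copies l" "r < Suc i" "mt r = 0"
    show "\<exists>x<Suc ta. (Q(ta := i)) x = r"
    proof (cases "r = i")
      case True
      then show ?thesis by (intro exI[of _ ta]) simp
    next
      case False
      then obtain x where "x < ta" "Q x = r" using r assms(1) by (auto simp: prepare_inv_def)
      then show ?thesis by (intro exI[of _ x]) simp
    qed
  qed
qed (use assms in \<open>auto simp: prepare_inv_def less_Suc_eq copies_def\<close>)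

lemma prepare_skip:
  assumes "prepare_inv l mt rk sp Q i ta" "i < m" "\<not> i < st i + l \<or> 0 < mt i"
  shows "prepare_inv l mt (rk(el i := 0)) (sp(i := st i)) Q (Suc i) ta"
  using assms by (auto simp: prepare_inv_def less_Suc_eq copies_def)

lemma prepare_loop:
  assumes E: "layout l k s0" and z: "nmem s0 ''i'' 0 = 0" "nmem s0 ''tail'' 0 = 0"
  shows "runs \<omega> (While (BNatLess (V ''i'') (V ''size'')) prepare_body) s0 ((m + 1) * 100)
    (\<lambda>s. prepare_inv l (nmem s ''mate'') (nmem s ''rank'') (nmem s ''sp'') (nmem s ''queue'') m (nmem s ''tail'' 0))"
proof -
  let ?P = "\<lambda>s i. prepare_inv l (nmem s ''mate'') (nmem s ''rank'') (nmem s ''sp'') (nmem s ''queue'') i (nmem s ''tail'' 0)"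
  let ?I = "\<lambda>s. ?P s (nmem s ''i'' 0)" and ?\<mu> = "\<lambda>s. m - nmem s ''i'' 0"
  show ?thesis
  proof (rule runs_While_loop_free[where N = m and \<mu> = ?\<mu> and I = ?I])
    fix s assume I: "?I s" and ag: "agree prepare_body s0 s"
    have E': "layout l k s" by (rule layout_agree[OF E ag]) (simp add: prepare_body_def)
    {
      assume "bval (BNatLess (V ''i'') (V ''size'')) s"
      then have i: "nmem s ''i'' 0 < m" using E' by (simp add: layout_def)
      then have st: "nmem s ''st'' (nmem s ''i'' 0) = st (nmem s ''i'' 0)" "nmem s ''elem'' = el" "nmem s ''l'' 0 = l"
        using E' by (auto simp: layout_def)
      show "?I (effect \<omega> prepare_body s) \<and> ?\<mu> (effect \<omega> prepare_body s) < ?\<mu> s"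
      proof (cases "nmem s ''i'' 0 < st (nmem s ''i'' 0) + l \<and> nmem s ''mate'' (nmem s ''i'' 0) = 0")
        case True
        then show ?thesis using prepare_push[OF I i] st i by (simp add: prepare_body_def)
      next
        case False
        then show ?thesis using prepare_skip[OF I i] st i by (auto simp: prepare_body_def)
      qed
    next
      assume "\<not> bval (BNatLess (V ''i'') (V ''size'')) s"
      then have "nmem s ''i'' 0 = m" using E' I by (simp add: layout_def prepare_inv_def)
      then show "?P s m" using I by simp
    }
  qed (use assms in \<open>simp_all add: prepare_body_def prepare_inv_def\<close>)
qed

definition search_state :: "nat \<Rightarrow> state \<Rightarrow> bool" where
  "search_state l s \<longleftrightarrow> matching l (nmem s ''own'') (nmem s ''mate'') \<and>
     search_inv l (nmem s ''own'') (nmem s ''mate'') (nmem s ''rank'') (nmem s ''par'') (nmem s ''queue'')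
       (nmem s ''sp'') (nmem s ''head'' 0) (nmem s ''tail'' 0) (nmem s ''found'' 0)"

lemma search_step:
  assumes I: "search_state l s" and E: "layout l k s"
    and b: "bval (BConj (BNatLess (V ''head'') (V ''tail'')) (BNeg (BNatLess (N 0) (V ''found'')))) s"
  shows "search_state l (effect \<omega> search_body s) \<and>
    search_work l (nmem (effect \<omega> search_body s) ''sp'') (nmem (effect \<omega> search_body s) ''head'' 0)
      < search_work l (nmem s ''sp'') (nmem s ''head'' 0)"
proof -
  define r where "r = nmem s ''queue'' (nmem s ''head'' 0)"
  have h: "nmem s ''head'' 0 < nmem s ''tail'' 0" and f: "nmem s ''found'' 0 = 0" using b by auto
  have V: "matching l (nmem s ''own'') (nmem s ''mate'')"
    and J: "search_inv l (nmem s ''own'') (nmem s ''mate'') (nmem s ''rank'') (nmem s ''par'') (nmem s ''queue'')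
       (nmem s ''sp'') (nmem s ''head'' 0) (nmem s ''tail'' 0) 0"
    using I f by (auto simp: search_state_def)
  have r: "r \<in> copies l" using J h by (auto simp: search_inv_def r_def)
  then have sp: "st r \<le> nmem s ''sp'' r" using J by (auto simp: search_inv_def)
  have g: "(nmem s ''sp'' r < nmem s ''size'' 0 \<and> \<not> nmem s ''person'' r < nmem s ''person'' (nmem s ''sp'' r))
      \<longleftrightarrow> nmem s ''sp'' r < en r"
    using scan_guard[OF sp] E by (simp add: layout_def)
  have el: "nmem s ''elem'' = el" using E by (auto simp: layout_def)
  note simps = search_body_def search_state_def r_def[symmetric] V f el
  show ?thesis
  proof (cases "nmem s ''sp'' r < en r")
    case True
    have g1: "nmem s ''sp'' r < nmem s ''size'' 0" "\<not> nmem s ''person'' r < nmem s ''person'' (nmem s ''sp'' r)"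
      using g True by blast+
    note w = search_work_less[where sp = "nmem s ''sp''" and h = "nmem s ''head'' 0", OF r True]
    show ?thesis
    proof (cases "0 < nmem s ''rank'' (el (nmem s ''sp'' r))")
      case seen: True
      then show ?thesis using search_seen[OF J h r_def True seen] w g1
        by (simp add: simps)
    next
      case False
      then have rk: "nmem s ''rank'' (el (nmem s ''sp'' r)) = 0" by simp
      show ?thesis
      proof (cases "nmem s ''own'' (el (nmem s ''sp'' r))")
        case 0
        then show ?thesis using search_discover(1)[OF J V h r_def True refl rk 0] w g1 rk
          by (simp add: simps)
      next
        case (Suc d)
        then show ?thesis using search_discover(2)[OF J V h r_def True refl rk Suc] w g1 rk
          by (simp add: simps)
      qed
    qed
  next
    case False
    then have d: "\<not> nmem s ''sp'' r < nmem s ''size'' 0 \<or> nmem s ''person'' r < nmem s ''person'' (nmem s ''sp'' r)"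
      using g by blast
    show ?thesis using d search_pop[OF J h False[unfolded r_def]]
      by - (erule disjE; simp add: simps)
  qed
qed

lemma search_loop:
  assumes E: "layout l k s0" and I0: "search_state l s0"
    and w: "search_work l (nmem s0 ''sp'') (nmem s0 ''head'' 0) \<le> (l + 2) * m"
  shows "runs \<omega> (While (BConj (BNatLess (V ''head'') (V ''tail'')) (BNeg (BNatLess (N 0) (V ''found'')))) search_body)
    s0 (((l + 2) * m + 1) * 200)
    (\<lambda>s. search_state l s \<and> (nmem s ''head'' 0 < nmem s ''tail'' 0 \<longrightarrow> 0 < nmem s ''found'' 0))"
    (is "runs _ (While ?b _) _ _ _")
proof -
  let ?\<mu> = "\<lambda>s. search_work l (nmem s ''sp'') (nmem s ''head'' 0)"
  show ?thesis
  proof (rule runs_While_loop_free[where I = "search_state l" and N = "(l + 2) * m" and \<mu> = ?\<mu>])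
    fix s assume I: "search_state l s" and ag: "agree search_body s0 s" and b: "bval ?b s"
    have E': "layout l k s" by (rule layout_agree[OF E ag]) (simp add: search_body_def)
    show "search_state l (effect \<omega> search_body s) \<and> ?\<mu> (effect \<omega> search_body s) < ?\<mu> s"
      by (rule search_step[OF I E' b])
  qed (use I0 w in \<open>auto simp: search_body_def\<close>)
qed

definition augment_state :: "nat \<Rightarrow> nat \<Rightarrow> state \<Rightarrow> bool" where
  "augment_state l n s \<longleftrightarrow>
     augment_inv l n (nmem s ''own'') (nmem s ''mate'') (nmem s ''rank'') (nmem s ''par'') (nmem s ''found'' 0)"

text \<open>The variant is the rank of the current hole, which drops along the parent pointers.
  Ranks are at most \<open>Suc ta\<close>, hence at most \<open>2 * m + 1\<close>, and this bounds
  the length of the path.\<close>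

lemma augment_loop:
  assumes I0: "augment_state l n s0" and rk: "nmem s0 ''rank'' (nmem s0 ''found'' 0 - 1) \<le> 2 * m + 1"
  shows "runs \<omega> (While (BNatLess (N 0) (V ''found'')) augment_body) s0 ((2 * m + 1 + 1) * 100)
    (\<lambda>s. matching l (nmem s ''own'') (nmem s ''mate'') \<and> card (matched (nmem s ''mate'')) = Suc n)"
proof -
  let ?\<mu> = "\<lambda>s. if nmem s ''found'' 0 = 0 then 0 else nmem s ''rank'' (nmem s ''found'' 0 - 1)"
  show ?thesis
  proof (rule runs_While_loop_free[where I = "augment_state l n" and N = "2 * m + 1" and \<mu> = ?\<mu>])
    fix s assume I: "augment_state l n s"
    {
      assume "bval (BNatLess (N 0) (V ''found'')) s"
      then obtain e where f: "nmem s ''found'' 0 = Suc e" by (auto simp: gr0_conv_Suc)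
      have J: "augment_inv l n (nmem s ''own'') (nmem s ''mate'') (nmem s ''rank'') (nmem s ''par'') (Suc e)"
        using I f by (simp add: augment_state_def)
      have pos: "0 < nmem s ''rank'' e" using J by (simp add: augment_inv_def)
      let ?s = "effect \<omega> augment_body s"
      have "augment_state l n ?s"
        using augment_step(1)[OF J refl refl] f
        by (cases "nmem s ''mate'' (nmem s ''par'' e)") (simp_all add: augment_state_def augment_body_def)
      moreover have "?\<mu> ?s < ?\<mu> s"
        using augment_step(2)[OF J refl] f pos by (auto simp: augment_body_def)
      ultimately show "augment_state l n ?s \<and> ?\<mu> ?s < ?\<mu> s" by blast
    next
      assume "\<not> bval (BNatLess (N 0) (V ''found'')) s"
      then show "matching l (nmem s ''own'') (nmem s ''mate'') \<and> card (matched (nmem s ''mate'')) = Suc n"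
        using I by (simp add: augment_state_def augment_inv_def)
    }
  qed (use assms in \<open>simp_all add: augment_body_def\<close>)
qed

end

definition index_prog :: com where "index_prog =
  NSet ''i'' (N 0) ;;
  While (BNatLess (V ''i'') (V ''size'')) start_body ;;
  (NSet ''k'' (N 1) ;; NSet ''sq'' (N 1)) ;;
  While (BNatLess (V ''sq'') (V ''size'')) sqrt_body"

definition query_prog :: com where "query_prog =
  index_prog ;;
  NSet ''l'' (N 0) ;;
  While (BNatLess (V ''l'') (V ''l_max'')) query_body"

section \<open>From a single augmenting phase to the table of all queries\<close>

context records
begin

definition phase_state :: "nat \<Rightarrow> nat \<Rightarrow> state \<Rightarrow> bool" where
  "phase_state l k s \<longleftrightarrow> layout l k s \<and> matching l (nmem s ''own'') (nmem s ''mate'') \<and>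
     nmem s ''cnt'' 0 = card (matched (nmem s ''mate''))"

text \<open>A phase either gains one edge or ends the phase loop with a certificate of optimality,
  at a cost linear in the bound on the number of edges.\<close>

lemma phase_runs:
  assumes P: "phase_state l k s0"
  shows "runs \<omega> phase_body s0 (2000 * ((l + 2) * (m + 1)))
    (\<lambda>s. phase_state l k s \<and>
      (nmem s ''go'' 0 = nmem s0 ''go'' 0 \<and> nmem s ''cnt'' 0 = Suc (nmem s0 ''cnt'' 0) \<or>
       nmem s ''go'' 0 = 0 \<and> nmem s ''cnt'' 0 = nmem s0 ''cnt'' 0 \<and>
         max_matching_size (edges l) = nmem s0 ''cnt'' 0))"
    (is "runs _ _ _ _ ?Q")
proof -
  let ?c1 = "NSet ''i'' (N 0) ;; NSet ''tail'' (N 0)" and ?c2 = "NSet ''head'' (N 0) ;; NSet ''found'' (N 0)"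
  let ?W1 = "While (BNatLess (V ''i'') (V ''size'')) prepare_body"
  let ?W2 = "While (BConj (BNatLess (V ''head'') (V ''tail'')) (BNeg (BNatLess (N 0) (V ''found'')))) search_body"
  let ?W3 = "While (BNatLess (N 0) (V ''found'')) augment_body"
  let ?C = "Cond (BNatLess (N 0) (V ''found'')) (Inc ''cnt'' ;; ?W3) (NSet ''go'' (N 0))"
  let ?n = "nmem s0 ''cnt'' 0" and ?go = "nmem s0 ''go'' 0"
  let ?same = "\<lambda>s. phase_state l k s \<and> nmem s ''go'' 0 = ?go \<and> nmem s ''cnt'' 0 = ?n"
  \<comment> \<open>Budgets of the remaining program suffixes, built from the end: each adds the
    cost of one more segment and of the sequencing.\<close>
  define T4 where "T4 = (2 * m + 1 + 1) * 100 + 50"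
  define T3 where "T3 = ((l + 2) * m + 1) * 200 + T4 + 1"
  define T2 where "T2 = 11 + T3"
  define T1 where "T1 = (m + 1) * 100 + T2 + 1"
  have T: "1 + 10 + T1 \<le> 2000 * ((l + 2) * (m + 1))"
    by (simp add: T1_def T2_def T3_def T4_def algebra_simps)
  have seg1: "runs \<omega> ?c1 s0 10
      (\<lambda>s. ?same s \<and> nmem s ''i'' 0 = 0 \<and> nmem s ''tail'' 0 = 0)"
    by (rule runs_loop_free) (use P in \<open>simp_all add: phase_state_def layout_def\<close>)
  show ?thesis
    unfolding phase_body_def
  proof (rule runs_Seq[OF seg1 _ T])
    fix s1 assume s1: "?same s1 \<and> nmem s1 ''i'' 0 = 0 \<and> nmem s1 ''tail'' 0 = 0"
    then have L1: "layout l k s1" by (simp add: phase_state_def)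
    show "runs \<omega> (?W1 ;; ?c2 ;; ?W2 ;; ?C) s1 T1 ?Q"
    proof (rule runs_Seq[OF prepare_loop[OF L1]])
      fix s2 assume prep: "prepare_inv l (nmem s2 ''mate'') (nmem s2 ''rank'') (nmem s2 ''sp'') (nmem s2 ''queue'')
          m (nmem s2 ''tail'' 0)"
        and "agree ?W1 s1 s2"
      then have ag: "agree prepare_body s1 s2" by (simp add: agree_While)
      have s2: "?same s2"
        using layout_agree[OF L1 ag] s1 agree_nmem[OF ag] by (simp add: prepare_body_def phase_state_def)
      have seg2: "runs \<omega> ?c2 s2 10
          (\<lambda>s. ?same s \<and> search_state l s \<and>
            search_work l (nmem s ''sp'') (nmem s ''head'' 0) \<le> (l + 2) * m)"
      proof (rule runs_loop_free)
        let ?s = "effect \<omega> ?c2 s2"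
        have pr: "\<And>e. e \<in> R \<Longrightarrow> nmem s2 ''rank'' e = 0" "\<And>r. r < m \<Longrightarrow> nmem s2 ''sp'' r = st r"
          "nmem s2 ''tail'' 0 \<le> m"
          "\<And>x. x < nmem s2 ''tail'' 0 \<Longrightarrow> nmem s2 ''queue'' x \<in> copies l \<and> nmem s2 ''mate'' (nmem s2 ''queue'' x) = 0"
          "\<And>r. r \<in> copies l \<Longrightarrow> nmem s2 ''mate'' r = 0 \<Longrightarrow> \<exists>x<nmem s2 ''tail'' 0. nmem s2 ''queue'' x = r"
          using prep copies_less by (auto simp: prepare_inv_def R_def)
        have upd: "nmem ?s x = (if x = ''head'' \<or> x = ''found'' then (nmem s2 x)(0 := 0) else nmem s2 x)" for x
          by simp
        have "?same ?s" using s2 unfolding phase_state_def layout_def upd by simp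
        moreover have "search_state l ?s"
        proof -
          have "search_inv l (nmem s2 ''own'') (nmem s2 ''mate'') (nmem s2 ''rank'') (nmem s2 ''par'')
              (nmem s2 ''queue'') (nmem s2 ''sp'') 0 (nmem s2 ''tail'' 0) 0"
            by (rule search_init(1)) (fact pr)+
          moreover have "matching l (nmem s2 ''own'') (nmem s2 ''mate'')" using s2 by (simp only: phase_state_def)
          ultimately show ?thesis by (simp add: search_state_def)
        qed
        moreover have "search_work l (nmem ?s ''sp'') (nmem ?s ''head'' 0) \<le> (l + 2) * m"
        proof -
          have "search_work l (nmem s2 ''sp'') 0 \<le> (l + 2) * m"
            by (rule search_init(2)) (fact pr)+
          then show ?thesis by simp
        qed
        ultimately show "?same ?s \<and> search_state l ?s \<and> search_work l (nmem ?s ''sp'') (nmem ?s ''head'' 0) \<le> (l + 2) * m"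
          by blast
      qed simp_all
      show "runs \<omega> (?c2 ;; ?W2 ;; ?C) s2 T2 ?Q"
      proof (rule runs_Seq[OF seg2])
        fix s3 assume s3: "?same s3 \<and> search_state l s3 \<and>
            search_work l (nmem s3 ''sp'') (nmem s3 ''head'' 0) \<le> (l + 2) * m"
        then have L3: "layout l k s3" by (simp add: phase_state_def)
        show "runs \<omega> (?W2 ;; ?C) s3 T3 ?Q"
        proof (rule runs_Seq[OF search_loop[OF L3]])
          fix s4 assume S: "search_state l s4 \<and> (nmem s4 ''head'' 0 < nmem s4 ''tail'' 0 \<longrightarrow> 0 < nmem s4 ''found'' 0)"
            and "agree ?W2 s3 s4"
          then have ag: "agree search_body s3 s4" by (simp add: agree_While)
          have s4: "?same s4"
            using layout_agree[OF L3 ag] s3 agree_nmem[OF ag] by (simp add: search_body_def phase_state_def)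
          have V: "matching l (nmem s4 ''own'') (nmem s4 ''mate'')"
            and J: "search_inv l (nmem s4 ''own'') (nmem s4 ''mate'') (nmem s4 ''rank'') (nmem s4 ''par'')
              (nmem s4 ''queue'') (nmem s4 ''sp'') (nmem s4 ''head'' 0) (nmem s4 ''tail'' 0) (nmem s4 ''found'' 0)"
            using S by (auto simp: search_state_def)
          show "runs \<omega> (?C) s4 T4 ?Q"
          proof (rule runs_Cond)
            assume "bval (BNatLess (N 0) (V ''found'')) s4"
            then obtain e where f: "nmem s4 ''found'' 0 = Suc e" by (auto simp: gr0_conv_Suc)
            have A: "augment_inv l ?n (nmem s4 ''own'') (nmem s4 ''mate'') (nmem s4 ''rank'') (nmem s4 ''par'') (Suc e)"
            proof -
              have n: "?n = card (matched (nmem s4 ''mate''))" using s4 unfolding phase_state_def by metis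
              show ?thesis unfolding n by (rule augment_init[OF J[unfolded f] V])
            qed
            have rk: "nmem s4 ''rank'' e \<le> 2 * m + 1"
              using J f search_tail_le[OF J] by (auto simp: search_inv_def)
            have seg3: "runs \<omega> (Inc ''cnt'') s4 10 (\<lambda>s. layout l k s \<and> nmem s ''go'' 0 = ?go \<and>
                nmem s ''cnt'' 0 = Suc ?n \<and> augment_state l ?n s \<and>
                nmem s ''rank'' (nmem s ''found'' 0 - 1) \<le> 2 * m + 1)"
              by (rule runs_loop_free)
                (use s4 A rk f in \<open>simp_all add: phase_state_def layout_def augment_state_def\<close>)
            show "runs \<omega> (Inc ''cnt'' ;; ?W3) s4
                ((2 * m + 1 + 1) * 100 + 20) ?Q"
            proof (rule runs_Seq[OF seg3])
              fix s5 assume s5: "layout l k s5 \<and> nmem s5 ''go'' 0 = ?go \<and>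
                nmem s5 ''cnt'' 0 = Suc ?n \<and> augment_state l ?n s5 \<and>
                nmem s5 ''rank'' (nmem s5 ''found'' 0 - 1) \<le> 2 * m + 1"
              show "runs \<omega> ?W3 s5 ((2 * m + 1 + 1) * 100) ?Q"
              proof (rule runs_conseq[OF augment_loop order_refl])
                fix s6 assume s6: "matching l (nmem s6 ''own'') (nmem s6 ''mate'') \<and> card (matched (nmem s6 ''mate'')) = Suc ?n"
                  and "agree ?W3 s5 s6"
                then have ag: "agree augment_body s5 s6" by (simp add: agree_While)
                have "layout l k s6" by (rule layout_agree[OF _ ag]) (use s5 in \<open>simp_all add: augment_body_def\<close>)
                then show "?Q s6"
                  using s5 s6 agree_nmem[OF ag] by (simp add: augment_body_def phase_state_def)
              qed (use s5 in auto)
            qed simp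
          next
            assume "\<not> bval (BNatLess (N 0) (V ''found'')) s4"
            then have f: "nmem s4 ''found'' 0 = 0" by simp
            have "max_matching_size (edges l) = ?n"
              using search_exhausted[OF J[unfolded f] _ V] S f s4 by (simp add: phase_state_def)
            then show "runs \<omega> (NSet ''go'' (N 0)) s4 ((2 * m + 1 + 1) * 100 + 20) ?Q"
              by (intro runs_loop_free) (use s4 in \<open>simp_all add: phase_state_def layout_def\<close>)
          qed (simp add: T4_def)
        qed (use s3 in \<open>auto simp: T3_def\<close>)
      qed (simp add: T2_def)
    qed (use s1 in \<open>auto simp: T1_def\<close>)
  qed
qed

text \<open>By \<open>d\<close> at most \<open>k\<close> phases can succeed, and one more fails;
  adding \<open>go\<close> to the missing size makes the variant drop in the failing phase too. The
  truncated difference drops in a successful phase because the counter never exceeds the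
  maximum.\<close>

lemma phases_loop:
  assumes P: "phase_state l k s0" and go: "nmem s0 ''go'' 0 = 1"
    and d: "max_matching_size (edges l) \<le> nmem s0 ''cnt'' 0 + k"
  shows "runs \<omega> (While (BNatLess (N 0) (V ''go'')) phase_body) s0
    ((k + 2) * (2004 * ((l + 2) * (m + 1)))) (\<lambda>s. nmem s ''cnt'' 0 = max_matching_size (edges l))"
proof -
  let ?M = "max_matching_size (edges l)" and ?B = "(l + 2) * (m + 1)"
  let ?I = "\<lambda>s. phase_state l k s \<and> (nmem s ''go'' 0 = 1 \<or> nmem s ''go'' 0 = 0 \<and> nmem s ''cnt'' 0 = ?M)"
  show ?thesis
  proof (rule runs_While[where N = "k + 1" and K = "2000 * ?B" and I = ?I and
        \<mu> = "\<lambda>s. ?M - nmem s ''cnt'' 0 + nmem s ''go'' 0"])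
    fix s assume I: "?I s" and b: "bval (BNatLess (N 0) (V ''go'')) s"
    then have go: "nmem s ''go'' 0 = 1" by auto
    show "runs \<omega> phase_body s (2000 * ?B)
        (\<lambda>s'. ?I s' \<and> ?M - nmem s' ''cnt'' 0 + nmem s' ''go'' 0 < ?M - nmem s ''cnt'' 0 + nmem s ''go'' 0)"
    proof (rule runs_conseq[OF phase_runs order_refl])
      show "phase_state l k s" using I by simp
      fix s' assume s': "phase_state l k s' \<and>
        (nmem s' ''go'' 0 = nmem s ''go'' 0 \<and> nmem s' ''cnt'' 0 = Suc (nmem s ''cnt'' 0) \<or>
         nmem s' ''go'' 0 = 0 \<and> nmem s' ''cnt'' 0 = nmem s ''cnt'' 0 \<and> ?M = nmem s ''cnt'' 0)"
      then have "nmem s' ''cnt'' 0 \<le> ?M"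
        using card_matched_le_max[of l "nmem s' ''own''" "nmem s' ''mate''"] by (simp add: phase_state_def)
      then show "?I s' \<and> ?M - nmem s' ''cnt'' 0 + nmem s' ''go'' 0 < ?M - nmem s ''cnt'' 0 + nmem s ''go'' 0"
        using s' go by auto
    qed
  next
    have "1 + bcost (BNatLess (N 0) (V ''go'')) + 2000 * ?B \<le> 2004 * ?B + 4 * 1" by simp
    also have "1 + bcost (BNatLess (N 0) (V ''go'')) + 2000 * ?B = 5 + 2000 * ?B" by simp
    finally show "(k + 1 + 1) * (1 + bcost (BNatLess (N 0) (V ''go'')) + 2000 * ?B) \<le> (k + 2) * (2004 * ?B)"
      by (intro mult_mono) (simp_all add: algebra_simps)
  qed (use P go d in auto)
qed

text \<open>The two halves are balanced: \<open>k\<close> price levels cost about \<open>k\<close>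
  passes over the edges, and by \<open>auction_deficiency\<close> they leave at most
  \<open>k\<close> augmentations of one pass each.\<close>

lemma matching_prog_runs:
  assumes E: "layout l k s0" and k: "0 < k" "m \<le> k * k"
  shows "runs \<omega> matching_prog s0 (10000 * ((k + 1) * ((l + 2) * (m + 1))))
    (\<lambda>s. nmem s ''cnt'' 0 = max_matching_size (edges l))"
    (is "runs _ _ _ _ ?Q")
proof -
  define T4 where "T4 = (k + 2) * (2004 * ((l + 2) * (m + 1)))"
  define T3 where "T3 = 11 + T4"
  define T2 where "T2 = ((k + 1) * (l + 1) * m + m + 1) * 200 + T3 + 1"
  define T1 where "T1 = (m + 1) * 100 + T2 + 16"
  have T: "1 + 10 + T1 \<le> 10000 * ((k + 1) * ((l + 2) * (m + 1)))"
    by (simp add: T1_def T2_def T3_def T4_def algebra_simps)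
  have seg1: "runs \<omega> (NSet ''i'' (N 0)) s0 10 (\<lambda>s. layout l k s \<and> nmem s ''i'' 0 = 0)"
    by (rule runs_loop_free) (use E in \<open>simp_all add: layout_def\<close>)
  let ?W3 = "While (BNatLess (N 0) (V ''go'')) phase_body"
  let ?W2 = "While (BNatLess (N 0) (NAdd (V ''act'') (NSub (V ''size'') (V ''i'')))) auction_body"
  let ?W1 = "While (BNatLess (V ''i'') (V ''size'')) reset_body"
  let ?c2 = "NSet ''i'' (N 0) ;; NSet ''act'' (N 0) ;; NSet ''cnt'' (N 0)"
  let ?clean = "\<lambda>s. layout l k s \<and> (\<forall>r<m. nmem s ''mate'' r = 0 \<and> nmem s ''lev'' r = 0 \<and> nmem s ''ptr'' r = st r) \<and>
       (\<forall>e\<in>R. nmem s ''own'' e = 0 \<and> nmem s ''price'' e = 0)"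
  show ?thesis
    unfolding matching_prog_def
  proof (rule runs_Seq[OF seg1 _ T])
    fix s1 assume s1: "layout l k s1 \<and> nmem s1 ''i'' 0 = 0"
    show "runs \<omega> (?W1 ;; ?c2 ;; ?W2 ;; NSet ''go'' (N 1) ;; ?W3) s1 T1 ?Q"
    proof (rule runs_Seq[OF reset_loop])
      fix s2 assume s2: "?clean s2"
      have seg2: "runs \<omega> ?c2 s2 14 (\<lambda>s. ?clean s \<and> nmem s ''i'' 0 = 0 \<and> nmem s ''act'' 0 = 0 \<and> nmem s ''cnt'' 0 = 0)"
        by (rule runs_loop_free) (use s2 in \<open>simp_all add: layout_def\<close>)
      show "runs \<omega> (?c2 ;; ?W2 ;; NSet ''go'' (N 1) ;; ?W3) s2 (T2 + 15) ?Q"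
      proof (rule runs_Seq[OF seg2])
        fix s3 assume s3: "?clean s3 \<and> nmem s3 ''i'' 0 = 0 \<and> nmem s3 ''act'' 0 = 0 \<and> nmem s3 ''cnt'' 0 = 0"
        show "runs \<omega> (?W2 ;; NSet ''go'' (N 1) ;; ?W3) s3 T2 ?Q"
        proof (rule runs_Seq[OF auction_loop])
          fix s4 assume s4: "layout l k s4 \<and> auction_state l k s4 \<and> nmem s4 ''i'' 0 = m \<and> nmem s4 ''act'' 0 = 0"
          then have A: "auction_inv l k (nmem s4 ''own'') (nmem s4 ''mate'') (nmem s4 ''price'') (nmem s4 ''lev'')
             (nmem s4 ''ptr'') m 0 (nmem s4 ''cnt'' 0)"
            unfolding auction_state_def by (elim conjE) (simp only:)
          have seg3: "runs \<omega> (NSet ''go'' (N 1)) s4 10 (\<lambda>s. phase_state l k s \<and> nmem s ''go'' 0 = 1 \<and>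
              max_matching_size (edges l) \<le> nmem s ''cnt'' 0 + k)"
            by (rule runs_loop_free)
              (use s4 A auction_deficiency[OF A k] in \<open>simp_all add: layout_def phase_state_def auction_inv_def\<close>)
          show "runs \<omega> (NSet ''go'' (N 1) ;; ?W3) s4 T3 ?Q"
            by (rule runs_Seq[OF seg3 phases_loop]) (auto simp: T3_def T4_def)
        qed (use s3 k in \<open>auto simp: T2_def\<close>)
      qed simp
    qed (use s1 in \<open>auto simp: T1_def\<close>)
  qed
qed

lemma query_loop:
  assumes E: "layout 0 k s0" and k: "0 < k" "m \<le> k * k"
    and r: "nmem s0 ''l_max'' 0 = n" "rmem s0 ''eps'' 0 = \<epsilon>" "rmem s0 ''beta'' 0 = \<beta>"
  shows "runs \<omega> (While (BNatLess (V ''l'') (V ''l_max'')) query_body) s0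
    ((n + 1) * (10100 * ((k + 1) * ((n + 2) * (m + 1)))))
    (\<lambda>s. \<forall>l\<in>{1..n}. rmem s ''q'' l =
       real (max_matching_size (edges l)) - 2 * real l / \<epsilon> * ln (1 / (2 * \<beta>)))"
proof -
  let ?q = "\<lambda>l. real (max_matching_size (edges l)) - 2 * real l / \<epsilon> * ln (1 / (2 * \<beta>))"
  let ?X = "(k + 1) * ((n + 2) * (m + 1))"
  let ?I = "\<lambda>s. layout (nmem s ''l'' 0) k s \<and> nmem s ''l'' 0 \<le> n \<and> (\<forall>l\<in>{1..nmem s ''l'' 0}. rmem s ''q'' l = ?q l)"
  let ?Q = "\<lambda>s s'. ?I s' \<and> n - nmem s' ''l'' 0 < n - nmem s ''l'' 0"
  let ?asg = "RAssign ''q'' (V ''l'') (RSub (RNat (V ''cnt'')) (RMul (RDiv (RMul (RNat (N 2)) (RNat (V ''l''))) (RV ''eps'')) (RLn (RDiv (RNat (N 1)) (RMul (RNat (N 2)) (RV ''beta''))))))"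
  show ?thesis
  proof (rule runs_While[where N = n and K = "10090 * ?X" and I = ?I and \<mu> = "\<lambda>s. n - nmem s ''l'' 0"])
    fix s assume I: "?I s" and ag: "agree query_body s0 s"
    have c: "nmem s ''l_max'' 0 = n" "rmem s ''eps'' 0 = \<epsilon>" "rmem s ''beta'' 0 = \<beta>"
      using agree_nmem[OF ag] agree_rmem[OF ag] r
      by (simp_all add: query_body_def matching_prog_def reset_body_def auction_body_def phase_body_def
          prepare_body_def search_body_def augment_body_def)
    show "\<forall>l\<in>{1..n}. rmem s ''q'' l = ?q l" if "\<not> bval (BNatLess (V ''l'') (V ''l_max'')) s"
      using that I c by auto
    assume b: "bval (BNatLess (V ''l'') (V ''l_max'')) s"
    define l where "l = nmem s ''l'' 0"
    have l: "l < n" using b c by (simp add: l_def)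
    \<comment> \<open>Every cap is charged like the largest one.\<close>
    have Xl: "(k + 1) * ((Suc l + 2) * (m + 1)) \<le> ?X" using l by (intro mult_mono) auto
    have seg1: "runs \<omega> (Inc ''l'') s 10 (\<lambda>s'. layout (Suc l) k s' \<and> rmem s' = rmem s)"
      by (rule runs_loop_free) (use I in \<open>simp_all add: layout_def l_def\<close>)
    have X1: "1 \<le> ?X" by simp
    show "runs \<omega> query_body s (10090 * ?X) (?Q s)"
      unfolding query_body_def
    proof (rule runs_Seq[OF seg1])
      fix s1 assume s1: "layout (Suc l) k s1 \<and> rmem s1 = rmem s"
      show "runs \<omega> (matching_prog ;; ?asg) s1 (10000 * ?X + 50) (?Q s)"
      proof (rule runs_Seq[OF matching_prog_runs[OF conjunct1[OF s1] k]])
        fix s2 assume s2: "nmem s2 ''cnt'' 0 = max_matching_size (edges (Suc l))" and ag2: "agree matching_prog s1 s2"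
        note defs = matching_prog_def reset_body_def auction_body_def phase_body_def
            prepare_body_def search_body_def augment_body_def
        have L2: "layout (Suc l) k s2"
          by (rule layout_agree[OF conjunct1[OF s1] ag2]) (simp add: defs)
        have r2: "rmem s2 x = rmem s x" for x
          using agree_rmem[OF ag2, of x] s1 by (simp add: defs)
        show "runs \<omega> ?asg s2 40 (?Q s)"
        proof (rule runs_loop_free)
          have lq: "\<forall>j\<in>{1..l}. rmem s ''q'' j = ?q j" using I by (simp add: l_def)
          have l2: "nmem s2 ''l'' 0 = Suc l" using L2 by (simp add: layout_def)
          let ?s = "effect \<omega> ?asg s2"
          have nm: "nmem ?s = nmem s2" by simp
          then have "layout (Suc l) k ?s" using L2 by (simp add: layout_def)
          moreover have "\<forall>j\<in>{1..Suc l}. rmem ?s ''q'' j = ?q j"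
            using lq s2 l2 by (auto simp: r2 c le_Suc_eq)
          ultimately show "?I ?s \<and> n - nmem ?s ''l'' 0 < n - nmem s ''l'' 0"
            using nm l2 l by (simp add: l_def)
        qed simp_all
      next
        show "1 + 10000 * ((k + 1) * ((Suc l + 2) * (m + 1))) + 40 \<le> 10000 * ?X + 50"
          using Xl by linarith
      qed
    next
      show "1 + 10 + (10000 * ?X + 50) \<le> 10090 * ?X" using X1 by linarith
    qed
  next
    have "1 \<le> ?X" by simp
    then have "1 + bcost (BNatLess (V ''l'') (V ''l_max'')) + 10090 * ?X \<le> 10100 * ?X"
      by (simp only: bcost.simps ncost.simps)
    then show "(n + 1) * (1 + bcost (BNatLess (V ''l'') (V ''l_max'')) + 10090 * ?X) \<le> (n + 1) * (10100 * ?X)"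
      by (intro mult_le_mono2)
  qed (use E in \<open>auto simp: layout_def\<close>)
qed

text \<open>The last clause bounds \<open>k\<close> by about the square root of \<open>m\<close>.
  Starting at 1 keeps \<open>k\<close> positive even for empty input, as the auction
  requires.\<close>

lemma sqrt_loop:
  assumes "nmem s0 ''size'' 0 = m" "nmem s0 ''k'' 0 = 1" "nmem s0 ''sq'' 0 = 1"
  shows "runs \<omega> (While (BNatLess (V ''sq'') (V ''size'')) sqrt_body) s0 ((m + 1) * 100)
    (\<lambda>s. 0 < nmem s ''k'' 0 \<and> m \<le> nmem s ''k'' 0 * nmem s ''k'' 0 \<and> (nmem s ''k'' 0 - 1) * (nmem s ''k'' 0 - 1) \<le> m)"
    (is "runs _ _ _ _ ?Q")
proof -
  let ?I = "\<lambda>s. 0 < nmem s ''k'' 0 \<and> nmem s ''sq'' 0 = nmem s ''k'' 0 * nmem s ''k'' 0 \<and>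
    (nmem s ''k'' 0 - 1) * (nmem s ''k'' 0 - 1) \<le> m"
  let ?\<mu> = "\<lambda>s. m - nmem s ''sq'' 0"
  show ?thesis
  proof (rule runs_While_loop_free[where N = m and \<mu> = ?\<mu> and I = ?I])
    fix s assume I: "?I s" and ag: "agree sqrt_body s0 s"
    have E: "nmem s ''size'' 0 = m" using assms agree_nmem[OF ag] by (simp add: sqrt_body_def)
    show "?I (effect \<omega> sqrt_body s) \<and> ?\<mu> (effect \<omega> sqrt_body s) < ?\<mu> s"
      if "bval (BNatLess (V ''sq'') (V ''size'')) s"
      using that I E by (auto simp: sqrt_body_def)
    show "?Q s" if "\<not> bval (BNatLess (V ''sq'') (V ''size'')) s"
      using that I E by auto
  qed (use assms in \<open>simp_all add: sqrt_body_def\<close>)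
qed

text \<open>\<open>\<kappa>\<close> bounds the number of auction levels.\<close>

lemma query_prog_runs:
  assumes s0: "nmem s0 ''size'' 0 = m" "nmem s0 ''person'' = p" "nmem s0 ''elem'' = el"
    and r: "nmem s0 ''l_max'' 0 = n" "rmem s0 ''eps'' 0 = \<epsilon>" "rmem s0 ''beta'' 0 = \<beta>"
    and \<kappa>: "\<And>k. (k - 1) * (k - 1) \<le> m \<Longrightarrow> k \<le> \<kappa>"
  shows "runs \<omega> query_prog s0 (10500 * ((n + 1) * ((\<kappa> + 1) * ((n + 2) * (m + 1)))))
    (\<lambda>s. \<forall>l\<in>{1..n}. rmem s ''q'' l =
       real (max_matching_size (edges l)) - 2 * real l / \<epsilon> * ln (1 / (2 * \<beta>)))"
    (is "runs _ _ _ _ ?Q")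
proof -
  let ?W1 = "While (BNatLess (V ''i'') (V ''size'')) start_body"
  let ?W2 = "While (BNatLess (V ''sq'') (V ''size'')) sqrt_body"
  let ?W3 = "While (BNatLess (V ''l'') (V ''l_max'')) query_body"
  let ?in = "\<lambda>s::state. nmem s ''size'' 0 = m \<and> nmem s ''person'' = p \<and> nmem s ''elem'' = el \<and>
    nmem s ''l_max'' 0 = n \<and> rmem s ''eps'' 0 = \<epsilon> \<and> rmem s ''beta'' 0 = \<beta>"
  have idx: "runs \<omega> index_prog s0 ((m + 1) * 200 + 50) (\<lambda>s. (\<forall>r<m. nmem s ''st'' r = st r) \<and>
      0 < nmem s ''k'' 0 \<and> m \<le> nmem s ''k'' 0 * nmem s ''k'' 0 \<and> (nmem s ''k'' 0 - 1) * (nmem s ''k'' 0 - 1) \<le> m)"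
    (is "runs _ _ _ _ ?Q1")
    unfolding index_prog_def
  proof (rule runs_Seq[where R = "\<lambda>s. ?in s \<and> nmem s ''i'' 0 = 0"])
    show "runs \<omega> (NSet ''i'' (N 0)) s0 10 (\<lambda>s. ?in s \<and> nmem s ''i'' 0 = 0)"
      by (rule runs_loop_free) (use s0 r in simp_all)
    fix s1 assume s1: "?in s1 \<and> nmem s1 ''i'' 0 = 0"
    show "runs \<omega> (?W1 ;; (NSet ''k'' (N 1) ;; NSet ''sq'' (N 1)) ;; ?W2) s1 ((m + 1) * 200 + 30) ?Q1"
    proof (rule runs_Seq[OF start_loop])
      fix s2 assume s2: "\<forall>r<m. nmem s2 ''st'' r = st r" and ag: "agree ?W1 s1 s2"
      show "runs \<omega> ((NSet ''k'' (N 1) ;; NSet ''sq'' (N 1)) ;; ?W2) s2 ((m + 1) * 100 + 20) ?Q1"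
      proof (rule runs_Seq[where R = "\<lambda>s. (\<forall>r<m. nmem s ''st'' r = st r) \<and> nmem s ''size'' 0 = m \<and>
            nmem s ''k'' 0 = 1 \<and> nmem s ''sq'' 0 = 1"])
        show "runs \<omega> (NSet ''k'' (N 1) ;; NSet ''sq'' (N 1)) s2 10 (\<lambda>s. (\<forall>r<m. nmem s ''st'' r = st r) \<and> nmem s ''size'' 0 = m \<and>
            nmem s ''k'' 0 = 1 \<and> nmem s ''sq'' 0 = 1)"
          by (rule runs_loop_free) (use s1 s2 agree_nmem[OF ag] in \<open>simp_all add: start_body_def\<close>)
        fix s3 :: state assume s3: "(\<forall>r<m. nmem s3 ''st'' r = st r) \<and> nmem s3 ''size'' 0 = m \<and>
            nmem s3 ''k'' 0 = 1 \<and> nmem s3 ''sq'' 0 = 1"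
        show "runs \<omega> ?W2 s3 ((m + 1) * 100) ?Q1"
        proof (rule runs_conseq[OF sqrt_loop order_refl])
          fix s4 assume "0 < nmem s4 ''k'' 0 \<and> m \<le> nmem s4 ''k'' 0 * nmem s4 ''k'' 0 \<and>
              (nmem s4 ''k'' 0 - 1) * (nmem s4 ''k'' 0 - 1) \<le> m" and ag: "agree ?W2 s3 s4"
          then show "?Q1 s4" using s3 agree_nmem[OF ag] by (simp add: sqrt_body_def)
        qed (use s3 in auto)
      qed simp
    qed (use s1 in auto)
  qed simp
  let ?X = "(\<kappa> + 1) * ((n + 2) * (m + 1))"
  show ?thesis
    unfolding query_prog_def
  proof (rule runs_Seq[OF idx])
    fix s1 assume q1: "?Q1 s1" and ag: "agree index_prog s0 s1"
    have i1: "?in s1"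
      using s0 r agree_nmem[OF ag] agree_rmem[OF ag] by (simp add: index_prog_def start_body_def sqrt_body_def)
    define k where "k = nmem s1 ''k'' 0"
    have k: "0 < k" "m \<le> k * k" "k \<le> \<kappa>" using q1 \<kappa>[of k] by (auto simp: k_def)
    show "runs \<omega> (NSet ''l'' (N 0) ;; ?W3) s1 ((n + 1) * (10100 * ?X) + 20) ?Q"
    proof (rule runs_Seq[where R = "\<lambda>s. ?in s \<and> layout 0 k s"])
      show "runs \<omega> (NSet ''l'' (N 0)) s1 10 (\<lambda>s. ?in s \<and> layout 0 k s)"
        by (rule runs_loop_free) (use i1 q1 in \<open>simp_all add: layout_def k_def\<close>)
      fix s2 assume s2: "?in s2 \<and> layout 0 k s2"
      have "(k + 1) * ((n + 2) * (m + 1)) \<le> ?X" using k by (intro mult_mono) auto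
      then have le: "(n + 1) * (10100 * ((k + 1) * ((n + 2) * (m + 1)))) \<le> (n + 1) * (10100 * ?X)"
        by (intro mult_le_mono2)
      show "runs \<omega> ?W3 s2 ((n + 1) * (10100 * ?X)) ?Q"
        by (rule runs_conseq[OF query_loop[where k = k and n = n] le]) (use s2 k in auto)
    qed simp
  next
    have "m + 1 \<le> (n + 1) * ?X"
      by (metis (no_types, lifting) Suc_eq_plus1 Suc_leI add_2_eq_Suc' le_trans mult_le_mono
          nat_mult_1 zero_less_Suc le_refl mult.assoc One_nat_def)
    moreover have "1 + ((m + 1) * 200 + 50) + (10100 * Y + 20) \<le> 10500 * Y" if "m + 1 \<le> Y" for Y :: nat
      using that by simp
    ultimately show "1 + ((m + 1) * 200 + 50) + ((n + 1) * (10100 * ?X) + 20) \<le> 10500 * ((n + 1) * ?X)"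
      by (simp only: mult.left_commute[of "n + 1" 10100])
  qed
qed

end

section \<open>The program that draws the cap and the noise\<close>

abbreviation RN where "RN n \<equiv> RNat (N n)"

abbreviation shifted_query :: "string \<Rightarrow> rexp" where
  "shifted_query x \<equiv> RSub (RIdx ''q'' (V x)) (RMul (RV ''t'') (RNat (V x)))"

abbreviation score_exp :: rexp where
  "score_exp \<equiv> RDiv (RSub (shifted_query ''i'') (shifted_query ''j'')) (RAdd (RNat (V ''i'')) (RNat (V ''j'')))"

definition min_body :: com where "min_body =
  Inc ''j'' ;; RSet ''v'' score_exp ;; Cond (BRealLess (RV ''v'') (RV ''s'')) (RSet ''s'' (RV ''v'')) SKIP"

text \<open>The running minimum starts from the candidate \<open>j = 1\<close>, so it is a minimum
  over a nonempty set throughout.\<close>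

definition weight_body :: com where "weight_body =
  (Inc ''i'' ;; NSet ''j'' (N 1) ;; RSet ''s'' score_exp) ;;
  While (BNatLess (V ''j'') (V ''l_max'')) min_body ;;
  (RAssign ''w'' (V ''i'') (RExp (RDiv (RMul (RDiv (RV ''eps'') (RN 2)) (RV ''s'')) (RN 2))) ;;
   RSet ''total'' (RAdd (RV ''total'') (RIdx ''w'' (V ''i''))))"

definition select_body :: com where "select_body =
  Inc ''i'' ;; RSet ''acc'' (RAdd (RV ''acc'') (RIdx ''w'' (V ''i'')))"

definition noise_prog :: com where "noise_prog =
  NSet ''l_hat'' (V ''i'') ;;
  RSet ''scale'' (RDiv (RMul (RN 2) (RNat (V ''l_hat''))) (RV ''eps'')) ;;
  Draw ''u'' (N 0) ;;
  Cond (BRealLess (RV ''u'') (RDiv (RN 1) (RN 2)))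
    (RSet ''x'' (RMul (RV ''scale'') (RLn (RMul (RN 2) (RV ''u'')))))
    (RSet ''x'' (RSub (RN 0) (RMul (RV ''scale'') (RLn (RMul (RN 2) (RSub (RN 1) (RV ''u''))))))) ;;
  RSet ''nu_hat'' (RAdd (RIdx ''q'' (V ''l_hat'')) (RV ''x''))"

definition sample_prog :: com where "sample_prog =
  (RSet ''t'' (RMul (RDiv (RN 2) (RDiv (RV ''eps'') (RN 2))) (RLn (RDiv (RNat (V ''l_max'')) (RV ''beta'')))) ;;
   NSet ''i'' (N 0) ;; RSet ''total'' (RN 0)) ;;
  While (BNatLess (V ''i'') (V ''l_max'')) weight_body ;;
  (Draw ''u'' (N 0) ;; RSet ''thr'' (RMul (RV ''u'') (RV ''total'')) ;; NSet ''i'' (N 1) ;;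
   RSet ''acc'' (RIdx ''w'' (N 1))) ;;
  While (BConj (BNatLess (V ''i'') (V ''l_max'')) (BRealLess (RV ''acc'') (RV ''thr''))) select_body ;;
  noise_prog"

text \<open>Inverts the cumulative sums of \<open>w\<close>. The disjunct \<open>n \<le> i\<close>
  makes the least index exist for every \<open>x\<close> and mirrors the exit of the program loop at
  the last cap.\<close>

definition selection :: "(nat \<Rightarrow> real) \<Rightarrow> nat \<Rightarrow> real \<Rightarrow> nat" where
  "selection w n x = (LEAST i. 1 \<le> i \<and> (n \<le> i \<or> x \<le> sum w {1..i}))"

text \<open>The inverse distribution function of \<open>Lap b\<close>. The form
  \<open>0 - b * ...\<close> copies the program expression, as the language has no unary
  minus.\<close>

definition laplace_quantile :: "real \<Rightarrow> real \<Rightarrow> real" where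
  "laplace_quantile b u = (if u < 1 / 2 then b * ln (2 * u) else 0 - b * ln (2 * (1 - u)))"

lemma min_loop:
  fixes f :: "nat \<Rightarrow> real"
  assumes s0: "nmem s0 ''l_max'' 0 = n" "nmem s0 ''j'' 0 = 1" "1 \<le> n" "rmem s0 ''s'' 0 = f 1"
    and f: "\<And>j. j \<in> {1..n} \<Longrightarrow> f j = ((rmem s0 ''q'' (nmem s0 ''i'' 0) - rmem s0 ''t'' 0 * real (nmem s0 ''i'' 0)) -
      (rmem s0 ''q'' j - rmem s0 ''t'' 0 * real j)) / (real (nmem s0 ''i'' 0) + real j)"
  shows "runs \<omega> (While (BNatLess (V ''j'') (V ''l_max'')) min_body) s0 ((n + 1) * 100)
    (\<lambda>s. rmem s ''s'' 0 = (MIN j\<in>{1..n}. f j))"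
proof -
  let ?I = "\<lambda>s. 1 \<le> nmem s ''j'' 0 \<and> nmem s ''j'' 0 \<le> n \<and> rmem s ''s'' 0 = (MIN j\<in>{1..nmem s ''j'' 0}. f j)"
  let ?\<mu> = "\<lambda>s. n - nmem s ''j'' 0"
  show ?thesis
  proof (rule runs_While_loop_free[where N = n and \<mu> = ?\<mu> and I = ?I])
    fix s assume I: "?I s" and ag: "agree min_body s0 s"
    have E: "nmem s ''l_max'' 0 = n" "nmem s ''i'' = nmem s0 ''i''" "rmem s ''q'' = rmem s0 ''q''" "rmem s ''t'' = rmem s0 ''t''"
      using s0 agree_nmem[OF ag] agree_rmem[OF ag] by (simp_all add: min_body_def)
    define j where "j = nmem s ''j'' 0"
    {
      assume "bval (BNatLess (V ''j'') (V ''l_max'')) s"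
      then have j: "j < n" "1 \<le> j" using E I by (simp_all add: j_def)
      have M: "(MIN j\<in>{1..Suc j}. f j) = min (f (Suc j)) (MIN j\<in>{1..j}. f j)"
        using j(2) by (simp add: atLeastAtMostSuc_conv)
      let ?s = "effect \<omega> min_body s"
      have eff: "nmem ?s ''j'' 0 = Suc j" "rmem ?s ''s'' 0 = min (f (Suc j)) (rmem s ''s'' 0)"
        using f[of "Suc j"] j by (simp_all add: min_body_def E j_def min_def)
      show "?I ?s \<and> ?\<mu> ?s < ?\<mu> s"
        unfolding eff M using I j by (simp add: j_def)
    next
      assume "\<not> bval (BNatLess (V ''j'') (V ''l_max'')) s"
      then have "nmem s ''j'' 0 = n" using I E by simp
      then show "rmem s ''s'' 0 = (MIN j\<in>{1..n}. f j)" using I by simp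
    }
  qed (use s0 in \<open>simp_all add: min_body_def\<close>)
qed

lemma weight_loop:
  fixes q w :: "nat \<Rightarrow> real"
  assumes s0: "nmem s0 ''l_max'' 0 = n" "nmem s0 ''i'' 0 = 0" "1 \<le> n" "rmem s0 ''total'' 0 = 0"
    "rmem s0 ''t'' 0 = t" "rmem s0 ''eps'' 0 = \<epsilon>" "\<forall>l\<in>{1..n}. rmem s0 ''q'' l = q l"
    and w: "\<And>i. w i = exp (\<epsilon> / 2 * (MIN j\<in>{1..n}. ((q i - t * real i) - (q j - t * real j)) / (real i + real j)) / 2)"
  shows "runs \<omega> (While (BNatLess (V ''i'') (V ''l_max'')) weight_body) s0 ((n + 1) * ((n + 1) * 300))
    (\<lambda>s. (\<forall>i\<in>{1..n}. rmem s ''w'' i = w i) \<and> rmem s ''total'' 0 = sum w {1..n})"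
proof (rule runs_While[where N = n and \<mu> = "\<lambda>s. n - nmem s ''i'' 0" and K = "(n + 1) * 100 + 100" and
      I = "\<lambda>s. nmem s ''i'' 0 \<le> n \<and> (\<forall>i\<in>{1..nmem s ''i'' 0}. rmem s ''w'' i = w i) \<and>
        rmem s ''total'' 0 = sum w {1..nmem s ''i'' 0}"])
  let ?I = "\<lambda>s. nmem s ''i'' 0 \<le> n \<and> (\<forall>i\<in>{1..nmem s ''i'' 0}. rmem s ''w'' i = w i) \<and>
        rmem s ''total'' 0 = sum w {1..nmem s ''i'' 0}"
  fix s assume I: "?I s" and ag: "agree weight_body s0 s"
  have E: "nmem s ''l_max'' 0 = n" "rmem s ''q'' = rmem s0 ''q''" "rmem s ''t'' 0 = t" "rmem s ''eps'' 0 = \<epsilon>"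
    using s0 agree_nmem[OF ag] agree_rmem[OF ag] by (simp_all add: weight_body_def min_body_def)
  show "(\<forall>i\<in>{1..n}. rmem s ''w'' i = w i) \<and> rmem s ''total'' 0 = sum w {1..n}"
    if "\<not> bval (BNatLess (V ''i'') (V ''l_max'')) s"
  proof -
    have "nmem s ''i'' 0 = n" using that I E by simp
    then show ?thesis using I by simp
  qed
  assume b: "bval (BNatLess (V ''i'') (V ''l_max'')) s"
  define i where "i = nmem s ''i'' 0"
  have i: "i < n" using b E by (simp add: i_def)
  let ?f = "\<lambda>j. ((q (Suc i) - t * real (Suc i)) - (q j - t * real j)) / (real (Suc i) + real j)"
  have qi: "rmem s0 ''q'' j = q j" if "1 \<le> j" "j \<le> n" for j using s0 that by simp
  let ?P = "\<lambda>s'::state. nmem s' ''l_max'' 0 = n \<and> nmem s' ''i'' 0 = Suc i \<and> rmem s' ''eps'' 0 = \<epsilon> \<and>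
    (\<forall>i'\<in>{1..i}. rmem s' ''w'' i' = w i') \<and> rmem s' ''total'' 0 = sum w {1..i}"
  have seg1: "runs \<omega> (Inc ''i'' ;; NSet ''j'' (N 1) ;; RSet ''s'' score_exp) s 50
      (\<lambda>s'. ?P s' \<and> nmem s' ''j'' 0 = 1 \<and> rmem s' ''q'' = rmem s0 ''q'' \<and> rmem s' ''t'' 0 = t \<and> rmem s' ''s'' 0 = ?f 1)"
    by (rule runs_loop_free) (use E I i qi in \<open>simp_all add: i_def\<close>)
  show "runs \<omega> weight_body s ((n + 1) * 100 + 100) (\<lambda>s'. ?I s' \<and> n - nmem s' ''i'' 0 < n - nmem s ''i'' 0)"
    unfolding weight_body_def
  proof (rule runs_Seq[OF seg1])
    fix s1 assume s1: "?P s1 \<and> nmem s1 ''j'' 0 = 1 \<and> rmem s1 ''q'' = rmem s0 ''q'' \<and> rmem s1 ''t'' 0 = t \<and>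
      rmem s1 ''s'' 0 = ?f 1"
    show "runs \<omega> (While (BNatLess (V ''j'') (V ''l_max'')) min_body ;;
      RAssign ''w'' (V ''i'') (RExp (RDiv (RMul (RDiv (RV ''eps'') (RN 2)) (RV ''s'')) (RN 2))) ;;
      RSet ''total'' (RAdd (RV ''total'') (RIdx ''w'' (V ''i'')))) s1 ((n + 1) * 100 + 45)
      (\<lambda>s'. ?I s' \<and> n - nmem s' ''i'' 0 < n - nmem s ''i'' 0)"
    proof (rule runs_Seq[OF min_loop[where f = ?f and n = n]])
      fix s2 assume s2: "rmem s2 ''s'' 0 = (MIN j\<in>{1..n}. ?f j)"
        and "agree (While (BNatLess (V ''j'') (V ''l_max'')) min_body) s1 s2"
      then have ag: "agree min_body s1 s2" by (simp add: agree_While)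
      have P2: "?P s2" using s1 agree_nmem[OF ag] agree_rmem[OF ag] by (simp add: min_body_def)
      have ws: "exp (\<epsilon> / 2 * rmem s2 ''s'' 0 / 2) = w (Suc i)" unfolding w s2 by simp
      show "runs \<omega> (RAssign ''w'' (V ''i'') (RExp (RDiv (RMul (RDiv (RV ''eps'') (RN 2)) (RV ''s'')) (RN 2))) ;;
        RSet ''total'' (RAdd (RV ''total'') (RIdx ''w'' (V ''i'')))) s2 40
        (\<lambda>s'. ?I s' \<and> n - nmem s' ''i'' 0 < n - nmem s ''i'' 0)"
        by (rule runs_loop_free) (use P2 ws i in \<open>auto simp: le_Suc_eq i_def[symmetric]\<close>)
    qed (use s1 qi i s0 in auto)
  qed simp
next
  have "1 + bcost (BNatLess (V ''i'') (V ''l_max'')) + ((n + 1) * 100 + 100) \<le> (n + 1) * 300" by simp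
  then show "(n + 1) * (1 + bcost (BNatLess (V ''i'') (V ''l_max'')) + ((n + 1) * 100 + 100)) \<le> (n + 1) * ((n + 1) * 300)"
    by (rule mult_le_mono2)
qed (use s0 in auto)

lemma select_loop:
  fixes w :: "nat \<Rightarrow> real"
  assumes s0: "nmem s0 ''l_max'' 0 = n" "nmem s0 ''i'' 0 = 1" "1 \<le> n" "rmem s0 ''acc'' 0 = w 1"
    "rmem s0 ''thr'' 0 = x" "\<forall>i\<in>{1..n}. rmem s0 ''w'' i = w i"
  shows "runs \<omega> (While (BConj (BNatLess (V ''i'') (V ''l_max'')) (BRealLess (RV ''acc'') (RV ''thr''))) select_body) s0
    ((n + 1) * 100) (\<lambda>s. nmem s ''i'' 0 = selection w n x \<and> 1 \<le> nmem s ''i'' 0 \<and> nmem s ''i'' 0 \<le> n)"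
    (is "runs _ (While ?b _) _ _ ?Q")
proof -
  let ?I = "\<lambda>s. 1 \<le> nmem s ''i'' 0 \<and> nmem s ''i'' 0 \<le> n \<and> rmem s ''acc'' 0 = sum w {1..nmem s ''i'' 0} \<and>
    (\<forall>i. 1 \<le> i \<longrightarrow> i < nmem s ''i'' 0 \<longrightarrow> sum w {1..i} < x)"
  let ?\<mu> = "\<lambda>s. n - nmem s ''i'' 0"
  show ?thesis
  proof (rule runs_While_loop_free[where N = n and \<mu> = ?\<mu> and I = ?I])
    fix s assume I: "?I s" and ag: "agree select_body s0 s"
    have E: "nmem s ''l_max'' 0 = n" "rmem s ''thr'' 0 = x" "\<forall>i\<in>{1..n}. rmem s ''w'' i = w i"
      using s0 agree_nmem[OF ag] agree_rmem[OF ag] by (simp_all add: select_body_def)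
    show "?I (effect \<omega> select_body s) \<and> ?\<mu> (effect \<omega> select_body s) < ?\<mu> s" if "bval ?b s"
      using that I E by (auto simp: select_body_def less_Suc_eq)
    show "?Q s" if "\<not> bval ?b s"
    proof -
      have "n \<le> nmem s ''i'' 0 \<or> x \<le> sum w {1..nmem s ''i'' 0}" using that I E by auto
      then have "selection w n x = nmem s ''i'' 0"
        unfolding selection_def using I
        by (intro Least_equality) (auto simp: not_less[symmetric])
      then show ?thesis using I by simp
    qed
  qed (use s0 in \<open>simp_all add: select_body_def\<close>)
qed

text \<open>Draw 0 decides the cap and draw 1 the noise, so the output is an explicit function of
  two independent uniform variables. The law of this function is computed separately in
  \<open>sampler_law\<close>.\<close>

lemma sample_prog_runs:
  fixes q w :: "nat \<Rightarrow> real"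
  assumes s0: "nmem s0 ''l_max'' 0 = n" "1 \<le> n" "rmem s0 ''eps'' 0 = \<epsilon>" "rmem s0 ''beta'' 0 = \<beta>"
    "\<forall>l\<in>{1..n}. rmem s0 ''q'' l = q l" "drawn s0 = 0"
    and t: "t = 2 / (\<epsilon> / 2) * ln (real n / \<beta>)"
    and w: "\<And>i. w i = exp (\<epsilon> / 2 * (MIN j\<in>{1..n}. ((q i - t * real i) - (q j - t * real j)) / (real i + real j)) / 2)"
    and i: "i = selection w n (\<omega> 0 * sum w {1..n})"
  shows "runs \<omega> sample_prog s0 ((n + 1) * ((n + 1) * 1000))
    (\<lambda>s. (nmem s ''l_hat'' 0, rmem s ''nu_hat'' 0) = (i, q i + laplace_quantile (2 * real i / \<epsilon>) (\<omega> 1)))"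
    (is "runs _ _ _ _ ?Q")
proof -
  let ?P = "\<lambda>s::state. nmem s ''l_max'' 0 = n \<and> rmem s ''eps'' 0 = \<epsilon> \<and> (\<forall>l\<in>{1..n}. rmem s ''q'' l = q l)"
  let ?W1 = "While (BNatLess (V ''i'') (V ''l_max'')) weight_body"
  let ?W2 = "While (BConj (BNatLess (V ''i'') (V ''l_max'')) (BRealLess (RV ''acc'') (RV ''thr''))) select_body"
  let ?c2 = "Draw ''u'' (N 0) ;; RSet ''thr'' (RMul (RV ''u'') (RV ''total'')) ;; NSet ''i'' (N 1) ;;
   RSet ''acc'' (RIdx ''w'' (N 1))"
  have seg1: "runs \<omega> (RSet ''t'' (RMul (RDiv (RN 2) (RDiv (RV ''eps'') (RN 2))) (RLn (RDiv (RNat (V ''l_max'')) (RV ''beta'')))) ;;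
      NSet ''i'' (N 0) ;; RSet ''total'' (RN 0)) s0 50
      (\<lambda>s. ?P s \<and> drawn s = 0 \<and> rmem s ''t'' 0 = t \<and> nmem s ''i'' 0 = 0 \<and> rmem s ''total'' 0 = 0)"
    by (rule runs_loop_free) (use s0 t in simp_all)
  show ?thesis
    unfolding sample_prog_def
  proof (rule runs_Seq[OF seg1])
    fix s1 assume s1: "?P s1 \<and> drawn s1 = 0 \<and> rmem s1 ''t'' 0 = t \<and> nmem s1 ''i'' 0 = 0 \<and> rmem s1 ''total'' 0 = 0"
    show "runs \<omega> (?W1 ;; ?c2 ;; ?W2 ;; noise_prog) s1 ((n + 1) * ((n + 1) * 300) + (n + 1) * 100 + 200) ?Q"
    proof (rule runs_Seq[OF weight_loop[where q = q and w = w and t = t and n = n and \<epsilon> = \<epsilon>]])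
      fix s2 assume s2: "(\<forall>i\<in>{1..n}. rmem s2 ''w'' i = w i) \<and> rmem s2 ''total'' 0 = sum w {1..n}"
        and "agree ?W1 s1 s2"
      then have ag: "agree weight_body s1 s2" by (simp add: agree_While)
      have P2: "?P s2 \<and> drawn s2 = 0"
        using s1 agree_nmem[OF ag] agree_rmem[OF ag] agree_drawn[OF ag] by (simp add: weight_body_def min_body_def)
      let ?x = "\<omega> 0 * sum w {1..n}"
      have seg2: "runs \<omega> ?c2 s2 50 (\<lambda>s. ?P s \<and> drawn s = 1 \<and> nmem s ''i'' 0 = 1 \<and> rmem s ''acc'' 0 = w 1 \<and>
          rmem s ''thr'' 0 = ?x \<and> (\<forall>i\<in>{1..n}. rmem s ''w'' i = w i))"
        by (rule runs_loop_free) (use s2 P2 s0(2) in simp_all)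
      show "runs \<omega> (?c2 ;; ?W2 ;; noise_prog) s2 ((n + 1) * 100 + 190) ?Q"
      proof (rule runs_Seq[OF seg2])
        fix s3 assume s3: "?P s3 \<and> drawn s3 = 1 \<and> nmem s3 ''i'' 0 = 1 \<and> rmem s3 ''acc'' 0 = w 1 \<and>
          rmem s3 ''thr'' 0 = ?x \<and> (\<forall>i\<in>{1..n}. rmem s3 ''w'' i = w i)"
        show "runs \<omega> (?W2 ;; noise_prog) s3 ((n + 1) * 100 + 120) ?Q"
        proof (rule runs_Seq[OF select_loop[where w = w and n = n and x = ?x]])
          fix s4 assume s4: "nmem s4 ''i'' 0 = selection w n ?x \<and> 1 \<le> nmem s4 ''i'' 0 \<and> nmem s4 ''i'' 0 \<le> n"
            and "agree ?W2 s3 s4"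
          then have ag: "agree select_body s3 s4" by (simp add: agree_While)
          have P4: "?P s4 \<and> drawn s4 = 1"
            using s3 agree_nmem[OF ag] agree_rmem[OF ag] agree_drawn[OF ag] by (simp add: select_body_def)
          have ii: "nmem s4 ''i'' 0 = i" "i \<in> {1..n}" using s4 i by auto
          have qi: "rmem s4 ''q'' i = q i" using P4 ii by blast
          show "runs \<omega> noise_prog s4 110 ?Q"
            by (rule runs_loop_free)
              (use P4 ii qi in \<open>simp_all add: noise_prog_def laplace_quantile_def\<close>)
        qed (use s3 s0 in auto)
      qed simp
    qed (use s1 s0 w in auto)
  qed (simp add: algebra_simps)
qed

section \<open>The Laplace distribution\<close>

lemma space_Lap [simp]: "space (Lap b) = UNIV" by (simp add: Lap_def)
lemma sets_Lap [simp, measurable_cong]: "sets (Lap b) = sets borel" by (simp add: Lap_def)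

lemma emeasure_Lap:
  "A \<in> sets borel \<Longrightarrow>
    emeasure (Lap b) A = (\<integral>\<^sup>+x. ennreal (1 / (2 * b) * exp (- \<bar>x\<bar> / b)) * indicator A x \<partial>lborel)"
  unfolding Lap_def by (rule emeasure_density) auto

lemma emeasure_Lap_singleton: "emeasure (Lap b) {x} = 0"
proof -
  have "AE y in lborel. ennreal (1 / (2 * b) * exp (- \<bar>y\<bar> / b)) * indicator {x} y = 0"
    using AE_lborel_singleton[of x] by eventually_elim auto
  then show ?thesis by (subst emeasure_Lap) (simp_all add: nn_integral_0_iff_AE)
qed

lemma emeasure_Lap_atLeast:
  assumes b: "0 < b" and a: "0 \<le> a"
  shows "emeasure (Lap b) {a..} = ennreal (exp (- a / b) / 2)"
proof -
  have "emeasure (Lap b) {a..} = (\<integral>\<^sup>+x. ennreal (1 / (2 * b) * exp (- \<bar>x\<bar> / b)) * indicator {a..} x \<partial>lborel)"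
    by (rule emeasure_Lap) simp
  also have "\<dots> = (\<integral>\<^sup>+x. ennreal (1 / (2 * b) * exp (- x / b)) * indicator {a..} x \<partial>lborel)"
    by (rule nn_integral_cong) (use a in \<open>auto split: split_indicator\<close>)
  also have "\<dots> = ennreal (0 - (- exp (- a / b) / 2))"
  proof (rule nn_integral_FTC_atLeast)
    show "((\<lambda>x. - exp (- x / b) / 2) has_real_derivative 1 / (2 * b) * exp (- x / b)) (at x)" for x
      by (rule derivative_eq_intros refl | use b in simp)+
    show "((\<lambda>x. - exp (- x / b) / 2) \<longlongrightarrow> 0) at_top"
      using b by real_asymp
  qed (use b in auto)
  finally show ?thesis by simp
qed

text \<open>By symmetry only the upper tail has to be integrated.\<close>

lemma emeasure_Lap_uminus:
  assumes "A \<in> sets borel"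
  shows "emeasure (Lap b) (uminus ` A) = emeasure (Lap b) A"
proof -
  have *: "uminus ` A = {x. - x \<in> A}" by force
  have m: "{x. - x \<in> A} \<in> sets borel"
  proof -
    have "(\<lambda>x::real. - x) \<in> borel_measurable borel" by measurable
    from measurable_sets[OF this assms] show ?thesis by (simp add: vimage_def)
  qed
  have "emeasure (Lap b) (uminus ` A) =
      (\<integral>\<^sup>+x. ennreal (1 / (2 * b) * exp (- \<bar>x\<bar> / b)) * indicator {x. - x \<in> A} x \<partial>lborel)"
    unfolding * by (rule emeasure_Lap[OF m])
  also have "\<dots> = (\<integral>\<^sup>+x. ennreal (1 / (2 * b) * exp (- \<bar>x\<bar> / b)) * indicator A x \<partial>lborel)"
    using m assms by (subst nn_integral_real_affine[where c = "-1" and t = 0]) (auto simp: indicator_def)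
  finally show ?thesis using emeasure_Lap[OF assms] by simp
qed

lemma emeasure_Lap_atMost:
  assumes "0 < b" "0 \<le> a"
  shows "emeasure (Lap b) {..-a} = ennreal (exp (- a / b) / 2)"
proof -
  have "uminus ` {a..} = {..-a}" by (force simp: image_iff)
  then show ?thesis using emeasure_Lap_uminus[of "{a..}" b] emeasure_Lap_atLeast[OF assms] by simp
qed

lemma emeasure_Lap_greaterThan:
  assumes "0 < b" "0 \<le> a"
  shows "emeasure (Lap b) {a<..} = ennreal (exp (- a / b) / 2)"
proof -
  have "emeasure (Lap b) {a..} = emeasure (Lap b) ({a<..} \<union> {a})"
    by (rule arg_cong[where f = "emeasure (Lap b)"]) auto
  also have "\<dots> = emeasure (Lap b) {a<..}"
    by (rule emeasure_Un_null_set) (auto simp: null_sets_def emeasure_Lap_singleton)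
  finally show ?thesis using emeasure_Lap_atLeast[OF assms] by simp
qed

lemma prob_space_Lap: "0 < b \<Longrightarrow> prob_space (Lap b)"
proof (rule prob_spaceI)
  assume b: "0 < b"
  \<comment> \<open>The total mass is the sum of the two tails at 0, each of mass 1/2.\<close>
  have "emeasure (Lap b) (space (Lap b)) = emeasure (Lap b) ({..-0} \<union> {0<..})"
    by (rule arg_cong[where f = "emeasure (Lap b)"]) auto
  also have "\<dots> = emeasure (Lap b) {..-0} + emeasure (Lap b) {0<..}"
    by (rule plus_emeasure[symmetric]) auto
  also have "\<dots> = ennreal (1 / 2) + ennreal (1 / 2)"
    using emeasure_Lap_atMost[OF b, of 0] emeasure_Lap_greaterThan[OF b, of 0] by simp
  also have "\<dots> = ennreal (1 / 2 + 1 / 2)" by (rule ennreal_plus[symmetric]) auto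
  finally show "emeasure (Lap b) (space (Lap b)) = 1" by simp
qed

text \<open>The kernel in the bind of \<open>DPDistinctCount\<close> is formed for every natural
  \<open>l\<close>, including 0. There division by zero makes the density vanish, and
  \<open>Lap 0\<close> is the zero measure: still a subprobability.\<close>

lemma subprob_space_Lap: "0 \<le> b \<Longrightarrow> subprob_space (Lap b)"
proof (cases "b = 0")
  case True
  then have "emeasure (Lap b) (space (Lap b)) = 0" by (subst emeasure_Lap) (auto simp: emeasure_Lap)
  then show ?thesis by (intro subprob_spaceI) auto
next
  case False
  assume "0 \<le> b"
  with False show ?thesis by (intro prob_space_imp_subprob_space prob_space_Lap) simp
qed

definition laplace_cdf :: "real \<Rightarrow> real \<Rightarrow> real" where
  "laplace_cdf b x = (if x < 0 then exp (x / b) / 2 else 1 - exp (- x / b) / 2)"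

lemma laplace_cdf_range: "0 < b \<Longrightarrow> 0 < laplace_cdf b x \<and> laplace_cdf b x < 1"
proof -
  assume b: "0 < b"
  have "exp (x / b) < 1" if "x < 0" using that b by (simp add: divide_neg_pos)
  moreover have "exp (- x / b) \<le> 1" if "0 \<le> x" using that b by simp
  moreover have "0 < exp (x / b)" "0 < exp (- x / b)" by simp_all
  ultimately have "x < 0 \<Longrightarrow> 0 < exp (x / b) / 2 \<and> exp (x / b) / 2 < 1"
    "\<not> x < 0 \<Longrightarrow> 0 < 1 - exp (- x / b) / 2 \<and> 1 - exp (- x / b) / 2 < 1" by linarith+
  then show ?thesis unfolding laplace_cdf_def by presburger
qed

lemma cdf_Lap:
  assumes b: "0 < b"
  shows "cdf (Lap b) x = laplace_cdf b x"
proof (cases "x < 0")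
  case True
  then show ?thesis using emeasure_Lap_atMost[OF b, of "- x"]
    by (simp add: cdf_def measure_def laplace_cdf_def)
next
  case False
  interpret prob_space "Lap b" by (rule prob_space_Lap[OF b])
  have "prob {..x} = 1 - prob (space (Lap b) - {..x})" by (subst prob_compl) auto
  also have "space (Lap b) - {..x} = {x<..}" by auto
  finally show ?thesis using False emeasure_Lap_greaterThan[OF b, of x]
    by (simp add: cdf_def measure_def laplace_cdf_def)
qed

text \<open>The Galois connection behind inverse-transform sampling. The two case distinctions, on
  \<open>u\<close> and on \<open>x\<close>, need not match; in the mixed cases both sides are
  decided by the sign of the quantile and the side of 1/2.\<close>

lemma laplace_quantile_le_iff:
  assumes b: "0 < b" and u: "0 < u" "u < 1"
  shows "laplace_quantile b u \<le> x \<longleftrightarrow> u \<le> laplace_cdf b x"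
proof -
  have lo: "b * ln (2 * u) \<le> y \<longleftrightarrow> u \<le> exp (y / b) / 2" for y
    using ln_le_cancel_iff[of "2 * u" "exp (y / b)"] u b by (auto simp: field_simps)
  have hi: "0 - b * ln (2 * (1 - u)) \<le> y \<longleftrightarrow> u \<le> 1 - exp (- y / b) / 2" for y
    using ln_le_cancel_iff[of "exp (- y / b)" "2 * (1 - u)"] u b by (auto simp: field_simps)
  have e0: "exp (x / b) < 1" if "x < 0" using that b by (simp add: divide_neg_pos)
  have e1: "exp (- x / b) \<le> 1" if "0 \<le> x" using that b by simp
  show ?thesis
  proof (cases "u < 1 / 2")
    case True
    then have "b * ln (2 * u) < 0" using b u by (simp add: mult_pos_neg)
    moreover have "u \<le> 1 - exp (- x / b) / 2" if "0 \<le> x" using e1[OF that] True by linarith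
    ultimately show ?thesis using lo[of x] True
      by (cases "x < 0") (simp_all add: laplace_quantile_def laplace_cdf_def)
  next
    case False
    then have "0 \<le> - (b * ln (2 * (1 - u)))" using b u by (simp add: mult_le_0_iff)
    moreover have "\<not> u \<le> exp (x / b) / 2" if "x < 0" using e0[OF that] False by linarith
    ultimately show ?thesis using hi[of x] False
      by (cases "x < 0") (simp_all add: laplace_quantile_def laplace_cdf_def)
  qed
qed

section \<open>Inverse-transform sampling\<close>

definition unif :: "real measure" where "unif = restrict_space lborel {0<..<1}"

lemma space_unif: "space unif = {0<..<1}" by (simp add: unif_def space_restrict_space)
lemma sets_unif: "sets unif = sets (restrict_space borel {0<..<1})"
  unfolding unif_def by (rule sets_restrict_space_cong) simp

lemma prob_space_unif: "prob_space unif"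
  unfolding unif_def
  by (rule prob_spaceI) (simp add: space_restrict_space emeasure_restrict_space)

lemma measurable_unif: "f \<in> measurable borel M \<Longrightarrow> f \<in> measurable unif M"
  unfolding measurable_cong_sets[OF sets_unif refl] by (rule measurable_restrict_space1)

lemma emeasure_unif: "A \<in> sets borel \<Longrightarrow> emeasure unif (A \<inter> {0<..<1}) = emeasure lborel (A \<inter> {0<..<1})"
  unfolding unif_def by (rule emeasure_restrict_space) auto

lemma emeasure_unif_interval:
  assumes "0 \<le> a" "a \<le> b" "b \<le> 1"
  shows "emeasure unif ({a<..b} \<inter> {0<..<1}) = ennreal (b - a)"
proof -
  have "emeasure unif ({a<..b} \<inter> {0<..<1}) = emeasure lborel ({a<..b} \<inter> {0<..<1})"
    by (rule emeasure_unif) simp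
  also have "\<dots> = ennreal (b - a)"
  \<comment> \<open>The point 1 lies outside the open unit interval, which changes the shape of the
    intersection but not its length.\<close>
  proof (cases "b = 1")
    case True
    then have "{a<..b} \<inter> {0<..<1} = {a<..<b}" using assms by auto
    then show ?thesis using assms by simp
  next
    case False
    then have "{a<..b} \<inter> {0<..<1} = {a<..b}" using assms by auto
    then show ?thesis using assms by simp
  qed
  finally show ?thesis .
qed

lemma measurable_laplace_quantile [measurable]: "laplace_quantile b \<in> borel_measurable borel"
  unfolding laplace_quantile_def by measurable

lemma distr_laplace_quantile:
  assumes b: "0 < b"
  shows "distr unif borel (laplace_quantile b) = Lap b"
proof (rule cdf_unique)
  interpret unif: prob_space unif by (rule prob_space_unif)
  have m: "laplace_quantile b \<in> measurable unif borel" by (rule measurable_unif) simp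
  interpret D: prob_space "distr unif borel (laplace_quantile b)" by (rule unif.prob_space_distr[OF m])
  interpret L: prob_space "Lap b" by (rule prob_space_Lap[OF b])
  show "real_distribution (distr unif borel (laplace_quantile b))" by unfold_locales simp_all
  show "real_distribution (Lap b)" by unfold_locales simp_all
  show "cdf (distr unif borel (laplace_quantile b)) = cdf (Lap b)"
  proof
    fix x
    have r: "0 < laplace_cdf b x" "laplace_cdf b x < 1" using laplace_cdf_range[OF b] by auto
    have "emeasure (distr unif borel (laplace_quantile b)) {..x} =
        emeasure unif (laplace_quantile b -` {..x} \<inter> space unif)"
      by (rule emeasure_distr[OF m]) simp
    also have "laplace_quantile b -` {..x} \<inter> space unif = {0<..laplace_cdf b x} \<inter> {0<..<1}"
      using laplace_quantile_le_iff[OF b] by (auto simp: space_unif)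
    also have "emeasure unif \<dots> = ennreal (laplace_cdf b x - 0)"
      by (rule emeasure_unif_interval) (use r in auto)
    finally have "cdf (distr unif borel (laplace_quantile b)) x = laplace_cdf b x"
      using r by (simp add: cdf_def measure_def)
    then show "cdf (distr unif borel (laplace_quantile b)) x = cdf (Lap b) x"
      by (simp only: cdf_Lap[OF b])
  qed
qed

lemma selection_eq_iff:
  fixes w :: "nat \<Rightarrow> real"
  assumes w: "\<And>i. 0 < w i" and u: "0 < u" "u < 1" and i: "1 \<le> i" "i \<le> n"
  shows "selection w n (u * sum w {1..n}) = i \<longleftrightarrow>
    sum w {1..i - 1} < u * sum w {1..n} \<and> u * sum w {1..n} \<le> sum w {1..i}"
proof -
  let ?S = "sum w {1..n}"
  have mono: "sum w {1..a} \<le> sum w {1..b}" if "a \<le> b" for a b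
    by (rule sum_mono2) (use w that less_imp_le in auto)
  have "0 < ?S" by (rule sum_pos) (use w i in auto)
  then have uS: "0 < u * ?S" "u * ?S \<le> ?S" using u by auto
  let ?P = "\<lambda>i. 1 \<le> i \<and> (n \<le> i \<or> u * ?S \<le> sum w {1..i})"
  have P: "?P n" using i by simp
  \<comment> \<open>Since \<open>u < 1\<close>, the threshold does not exceed the total weight, so
    the cut-off at \<open>n\<close> never changes the result.\<close>
  have Peq: "?P j \<longleftrightarrow> 1 \<le> j \<and> u * ?S \<le> sum w {1..j}" for j
    using uS mono[of n j] by auto
  show ?thesis
  proof
    assume s: "selection w n (u * ?S) = i"
    have "?P i" using LeastI[of ?P, OF P] s by (simp add: selection_def)
    moreover have "sum w {1..i - 1} < u * ?S"
    proof (cases "i = 1")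
      case True
      then show ?thesis using uS by simp
    next
      case False
      then have "\<not> ?P (i - 1)" using not_less_Least[of "i - 1" ?P] s i by (simp add: selection_def)
      then show ?thesis using False i Peq[of "i - 1"] by auto
    qed
    ultimately show "sum w {1..i - 1} < u * ?S \<and> u * ?S \<le> sum w {1..i}" using Peq by blast
  next
    assume s: "sum w {1..i - 1} < u * ?S \<and> u * ?S \<le> sum w {1..i}"
    show "selection w n (u * ?S) = i"
      unfolding selection_def
    proof (rule Least_equality)
      show "?P i" using s i by simp
      fix j assume "?P j"
      then have j: "1 \<le> j" "u * ?S \<le> sum w {1..j}" using Peq by auto
      show "i \<le> j"
      proof (rule ccontr)
        assume "\<not> i \<le> j"
        then have "sum w {1..j} \<le> sum w {1..i - 1}" by (intro mono) simp
        then show False using s j by simp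
      qed
    qed
  qed
qed

lemma selection_range: "1 \<le> n \<Longrightarrow> selection w n x \<in> {1..n}"
  using LeastI[of "\<lambda>i. 1 \<le> i \<and> (n \<le> i \<or> x \<le> sum w {1..i})" n]
    Least_le[of "\<lambda>i. 1 \<le> i \<and> (n \<le> i \<or> x \<le> sum w {1..i})" n]
  by (auto simp: selection_def)

lemma measurable_selection [measurable]:
  "(\<lambda>u. selection w n (u * c)) \<in> measurable borel (count_space UNIV)"
  unfolding selection_def by measurable

text \<open>Index \<open>i\<close> is chosen exactly on a half-open interval between consecutive
  normalised partial sums, whose length is its normalised weight.\<close>

lemma emeasure_selection:
  fixes w :: "nat \<Rightarrow> real"
  assumes w: "\<And>i. 0 < w i" and i: "1 \<le> i" "i \<le> n"
  shows "emeasure unif {u \<in> space unif. selection w n (u * sum w {1..n}) = i} = ennreal (w i / sum w {1..n})"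
proof -
  let ?S = "sum w {1..n}"
  have S: "0 < ?S" by (rule sum_pos) (use w i in auto)
  have mono: "sum w {1..a} \<le> sum w {1..b}" if "a \<le> b" for a b
    by (rule sum_mono2) (use w that less_imp_le in auto)
  let ?a = "sum w {1..i - 1} / ?S" and ?b = "sum w {1..i} / ?S"
  have "{u \<in> space unif. selection w n (u * ?S) = i} = {?a<..?b} \<inter> {0<..<1}"
  proof (rule set_eqI)
    fix u
    have "selection w n (u * ?S) = i \<longleftrightarrow> ?a < u \<and> u \<le> ?b" if "0 < u" "u < 1"
      using selection_eq_iff[of w u i n, OF w that i] unfolding pos_divide_less_eq[OF S] pos_le_divide_eq[OF S] .
    then show "u \<in> {u \<in> space unif. selection w n (u * ?S) = i} \<longleftrightarrow> u \<in> {?a<..?b} \<inter> {0<..<1}"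
      unfolding space_unif Int_iff mem_Collect_eq greaterThanLessThan_iff greaterThanAtMost_iff by blast
  qed
  moreover have "emeasure unif ({?a<..?b} \<inter> {0<..<1}) = ennreal (?b - ?a)"
  proof (rule emeasure_unif_interval)
    show "0 \<le> ?a" using S w by (intro divide_nonneg_pos sum_nonneg) (auto intro: less_imp_le)
    show "?a \<le> ?b" using S mono[of "i - 1" i] by (simp add: divide_right_mono)
    show "?b \<le> 1" using S mono[of i n] i by simp
  qed
  moreover have "?b - ?a = w i / ?S"
  proof -
    have "{1..i} = insert i {1..i - 1}" using i by auto
    then have "sum w {1..i} = w i + sum w {1..i - 1}" using i by simp
    then show ?thesis by (simp add: diff_divide_distrib[symmetric])
  qed
  ultimately show ?thesis by simp
qed

lemma coins_unif: "coins = PiM UNIV (\<lambda>_. unif)"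
  by (simp add: coins_def unif_def)

lemma measurable_coins: "f \<in> measurable borel M \<Longrightarrow> (\<lambda>\<omega>. f (\<omega> i)) \<in> measurable coins M"
  unfolding coins_unif
  by (rule measurable_compose[where f = "\<lambda>\<omega>. \<omega> i" and N = unif])
    (auto intro: measurable_component_singleton measurable_unif)

text \<open>Shows that the first two draws act as independent uniform variables:
  \<open>PiM_iter\<close> splits off coin 0, and coin 1 is the head of the remaining
  sequence.\<close>

lemma nn_integral_coins:
  assumes k: "(\<lambda>(u, v). k u v) \<in> borel_measurable (borel \<Otimes>\<^sub>M borel)"
  shows "(\<integral>\<^sup>+\<omega>. k (\<omega> 0) (\<omega> 1) \<partial>coins) = (\<integral>\<^sup>+u. \<integral>\<^sup>+v. k u v \<partial>unif \<partial>unif)"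
proof -
  interpret U: prob_space unif by (rule prob_space_unif)
  interpret sequence_space unif by unfold_locales
  have id: "(\<lambda>x. x) \<in> measurable unif borel" by (rule measurable_unif) simp
  have c: "(\<lambda>\<omega>. \<omega> i) \<in> measurable S borel" for i
    using measurable_coins[of "\<lambda>x. x" borel i] by (simp add: coins_unif)
  have k': "(\<lambda>x. k (f x) (g x)) \<in> borel_measurable M"
    if "f \<in> borel_measurable M" "g \<in> borel_measurable M" for f g and M :: "'z measure"
    using measurable_compose[OF measurable_Pair[OF that] k] by simp
  have cn: "(\<lambda>(s, \<omega>). case_nat s \<omega>) \<in> measurable (unif \<Otimes>\<^sub>M S) S"
    by measurable
  have "(\<integral>\<^sup>+\<omega>. k (\<omega> 0) (\<omega> 1) \<partial>S) = (\<integral>\<^sup>+\<omega>. k (\<omega> 0) (\<omega> 1) \<partial>distr (unif \<Otimes>\<^sub>M S) S (\<lambda>(s, \<omega>). case_nat s \<omega>))"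
    by (simp add: PiM_iter)
  also have "\<dots> = (\<integral>\<^sup>+x. k (fst x) (snd x 0) \<partial>(unif \<Otimes>\<^sub>M S))"
    using k'[OF c[of 0] c[of 1]] by (subst nn_integral_distr[OF cn]) (simp_all add: case_prod_unfold)
  also have "\<dots> = (\<integral>\<^sup>+u. \<integral>\<^sup>+\<omega>. k u (\<omega> 0) \<partial>S \<partial>unif)"
  proof -
    have "(\<lambda>x. k (fst x) (snd x 0)) \<in> borel_measurable (unif \<Otimes>\<^sub>M S)"
      by (rule k') (rule measurable_compose[OF measurable_fst id], rule measurable_compose[OF measurable_snd c])
    from nn_integral_fst[OF this] show ?thesis by simp
  qed
  also have "\<dots> = (\<integral>\<^sup>+u. \<integral>\<^sup>+v. k u v \<partial>unif \<partial>unif)"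
  proof (rule nn_integral_cong)
    fix u
    have "(\<integral>\<^sup>+v. k u v \<partial>unif) = (\<integral>\<^sup>+v. k u v \<partial>distr S unif (\<lambda>\<omega>. \<omega> 0))"
      using PiM_component[of 0] by simp
    also have "\<dots> = (\<integral>\<^sup>+\<omega>. k u (\<omega> 0) \<partial>S)"
      by (rule nn_integral_distr) (use k'[OF measurable_const id, of u] in auto)
    finally show "(\<integral>\<^sup>+\<omega>. k u (\<omega> 0) \<partial>S) = (\<integral>\<^sup>+v. k u v \<partial>unif)" by simp
  qed
  finally show ?thesis by (simp add: coins_unif)
qed

section \<open>Law of the sampler\<close>

lemma pmf_embed_weights:
  fixes w :: "nat \<Rightarrow> real"
  assumes w: "\<And>i. 0 < w i" and n: "1 \<le> n"
  shows "pmf (embed_pmf (\<lambda>i. if i \<in> {1..n} then w i / sum w {1..n} else 0)) i =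
    (if i \<in> {1..n} then w i / sum w {1..n} else 0)"
proof (rule pmf_embed_pmf)
  have S: "0 < sum w {1..n}" by (rule sum_pos) (use w n in auto)
  show nn: "0 \<le> (if i \<in> {1..n} then w i / sum w {1..n} else 0)" for i
    using S w[of i] by simp
  have "(\<integral>\<^sup>+i. ennreal (if i \<in> {1..n} then w i / sum w {1..n} else 0) \<partial>count_space UNIV) =
      (\<Sum>i\<in>{1..n}. ennreal (w i / sum w {1..n}))"
    by (subst nn_integral_count_space'[of "{1..n}"]) auto
  also have "\<dots> = ennreal (\<Sum>i\<in>{1..n}. w i / sum w {1..n})"
    by (rule sum_ennreal) (intro divide_nonneg_pos less_imp_le[OF w] S)
  also have "(\<Sum>i\<in>{1..n}. w i / sum w {1..n}) = 1"
    using S by (simp add: sum_divide_distrib[symmetric])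
  finally show "(\<integral>\<^sup>+i. ennreal (if i \<in> {1..n} then w i / sum w {1..n} else 0) \<partial>count_space UNIV) = 1" by simp
qed

definition gem_weight ::
  "(nat \<Rightarrow> 'd \<Rightarrow> real) \<Rightarrow> (nat \<Rightarrow> real) \<Rightarrow> nat \<Rightarrow> real \<Rightarrow> real \<Rightarrow> 'd \<Rightarrow> nat \<Rightarrow> real" where
  "gem_weight q \<Delta> m \<epsilon> \<beta> D i = exp (\<epsilon> * gem_score q \<Delta> m \<epsilon> \<beta> D i / 2)"

lemma gem_weight_pos: "0 < gem_weight q \<Delta> m \<epsilon> \<beta> D i" by (simp add: gem_weight_def)

lemma pmf_GEM:
  assumes "1 \<le> m"
  shows "pmf (GEM D q \<Delta> m \<epsilon> \<beta>) i =
    (if i \<in> {1..m} then gem_weight q \<Delta> m \<epsilon> \<beta> D i / sum (gem_weight q \<Delta> m \<epsilon> \<beta> D) {1..m} else 0)"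
  using pmf_embed_weights[of "gem_weight q \<Delta> m \<epsilon> \<beta> D", OF gem_weight_pos assms]
  unfolding GEM_def gem_weight_def .

lemma set_pmf_GEM: "1 \<le> m \<Longrightarrow> set_pmf (GEM D q \<Delta> m \<epsilon> \<beta>) \<subseteq> {1..m}"
  by (auto simp: set_pmf_eq pmf_GEM split: if_splits)

lemma GEM_eq_distr_selection:
  fixes q :: "nat \<Rightarrow> 'd \<Rightarrow> real" and \<Delta> :: "nat \<Rightarrow> real" and \<epsilon> \<beta> :: real and D :: 'd
  assumes n: "1 \<le> n"
  defines "w \<equiv> gem_weight q \<Delta> n \<epsilon> \<beta> D"
  shows "measure_pmf (GEM D q \<Delta> n \<epsilon> \<beta>) = distr unif (count_space UNIV) (\<lambda>u. selection w n (u * sum w {1..n}))"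
    (is "_ = distr _ _ ?sel")
proof (rule measure_eqI_countable[where A = UNIV])
  have m: "?sel \<in> measurable unif (count_space UNIV)" by (rule measurable_unif) measurable
  fix i :: nat
  have "emeasure (distr unif (count_space UNIV) ?sel) {i} = emeasure unif {u \<in> space unif. ?sel u = i}"
    by (subst emeasure_distr[OF m]) (auto intro!: arg_cong[where f = "emeasure unif"])
  also have "\<dots> = ennreal (pmf (GEM D q \<Delta> n \<epsilon> \<beta>) i)"
  proof (cases "i \<in> {1..n}")
    case True
    have "0 < w i" for i by (simp add: w_def gem_weight_pos)
    from emeasure_selection[of w, OF this] True show ?thesis
      by (simp add: pmf_GEM[OF n] w_def)
  next
    case False
    then have empty: "{u \<in> space unif. ?sel u = i} = {}" using selection_range[OF n] by blast
    show ?thesis unfolding empty using False by (simp only: pmf_GEM[OF n] if_False) simp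
  qed
  finally show "emeasure (measure_pmf (GEM D q \<Delta> n \<epsilon> \<beta>)) {i} = emeasure (distr unif (count_space UNIV) ?sel) {i}"
    by (simp add: emeasure_pmf_single)
qed simp_all

abbreviation noisy :: "real \<Rightarrow> (nat \<Rightarrow> real) \<Rightarrow> nat \<Rightarrow> (nat \<times> real) measure" where
  "noisy \<epsilon> q l \<equiv> distr (Lap (2 * real l / \<epsilon>)) output_space (\<lambda>x. (l, q l + x))"

lemma noisy_subprob:
  assumes "0 < \<epsilon>"
  shows "noisy \<epsilon> q \<in> measurable (measure_pmf P) (subprob_algebra output_space)"
proof -
  have "noisy \<epsilon> q l \<in> space (subprob_algebra output_space)" for l
  proof -
    have "(\<lambda>x. (l, q l + x)) \<in> measurable (Lap (2 * real l / \<epsilon>)) output_space" by measurable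
    moreover have "subprob_space (Lap (2 * real l / \<epsilon>))" using assms by (intro subprob_space_Lap) simp
    ultimately have "subprob_space (noisy \<epsilon> q l)"
      by (intro subprob_space.subprob_space_distr) (auto simp: space_pair_measure)
    then show ?thesis by (simp add: space_subprob_algebra)
  qed
  then show ?thesis by simp
qed

lemma emeasure_noisy:
  assumes "A \<in> sets output_space"
  shows "emeasure (noisy \<epsilon> q l) A = emeasure (Lap (2 * real l / \<epsilon>)) {x. (l, q l + x) \<in> A}"
proof -
  have "(\<lambda>x. (l, q l + x)) \<in> measurable (Lap (2 * real l / \<epsilon>)) output_space" by measurable
  from emeasure_distr[OF this assms] show ?thesis by (simp add: vimage_def)
qed

lemma sets_DPDistinctCount: "sets (DPDistinctCount lmax \<epsilon> \<beta> D) = sets output_space"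
  unfolding DPDistinctCount_def by (rule sets_bind) auto

lemma emeasure_DPDistinctCount:
  assumes "0 < \<epsilon>" "A \<in> sets output_space"
  shows "emeasure (DPDistinctCount lmax \<epsilon> \<beta> D) A =
    (\<integral>\<^sup>+l. emeasure (noisy \<epsilon> (\<lambda>l. dc_query \<epsilon> \<beta> l D) l) A \<partial>measure_pmf (GEM D (dc_query \<epsilon> \<beta>) real lmax (\<epsilon> / 2) \<beta>))"
  unfolding DPDistinctCount_def
  by (rule emeasure_bind[OF _ noisy_subprob[OF assms(1)] assms(2)]) simp

text \<open>After the integral over the coins is split, the inner one is the noise for a fixed cap
  and the outer one the law of the selection, which is how the bind in
  \<open>DPDistinctCount\<close> is integrated.\<close>

lemma sampler_law:
  fixes D :: "'a dataset" and \<epsilon> \<beta> :: real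
  assumes \<epsilon>: "0 < \<epsilon>" and n: "1 \<le> n"
  defines "w \<equiv> gem_weight (dc_query \<epsilon> \<beta>) real n (\<epsilon> / 2) \<beta> D"
  defines "out \<equiv> \<lambda>\<omega>. let i = selection w n (\<omega> 0 * sum w {1..n}) in
    (i, dc_query \<epsilon> \<beta> i D + laplace_quantile (2 * real i / \<epsilon>) (\<omega> 1))"
  shows "out \<in> measurable coins output_space" "distr coins output_space out = DPDistinctCount n \<epsilon> \<beta> D"
proof -
  let ?sel = "\<lambda>u. selection w n (u * sum w {1..n})"
  let ?q = "\<lambda>l. dc_query \<epsilon> \<beta> l D"
  let ?f = "\<lambda>i v. (i, ?q i + laplace_quantile (2 * real i / \<epsilon>) v)"
  have fm: "?f i \<in> measurable borel output_space" for i by measurable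
  have sm: "?sel \<in> measurable borel (count_space UNIV)" by measurable
  have out: "out = (\<lambda>\<omega>. ?f (?sel (\<omega> 0)) (\<omega> 1))" by (simp add: out_def Let_def)
  show om: "out \<in> measurable coins output_space"
    unfolding out
    by (rule measurable_compose_countable[where g = "\<lambda>\<omega>. ?sel (\<omega> 0)"])
      (rule measurable_coins[OF fm], rule measurable_coins[OF sm])
  show "distr coins output_space out = DPDistinctCount n \<epsilon> \<beta> D"
  proof (rule measure_eqI)
    show "sets (distr coins output_space out) = sets (DPDistinctCount n \<epsilon> \<beta> D)"
      by (simp add: sets_DPDistinctCount)
    fix A assume "A \<in> sets (distr coins output_space out)"
    then have A: "A \<in> sets output_space" by simp
    have jm: "(\<lambda>(u, v). ?f (?sel u) v) \<in> measurable (borel \<Otimes>\<^sub>M borel) output_space"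
      unfolding case_prod_unfold
      by (rule measurable_compose_countable[where g = "\<lambda>x. ?sel (fst x)"])
        (rule measurable_compose[OF measurable_snd fm], rule measurable_compose[OF measurable_fst sm])
    have km: "(\<lambda>(u, v). indicator A (?f (?sel u) v) :: ennreal) \<in> borel_measurable (borel \<Otimes>\<^sub>M borel)"
      using measurable_compose[OF jm borel_measurable_indicator[OF A]] by (simp add: case_prod_unfold)
    \<comment> \<open>Inversion of the Laplace distribution needs a positive scale; the selected
      index is always in this range.\<close>
    have inner: "(\<integral>\<^sup>+v. indicator A (?f i v) \<partial>unif) = emeasure (noisy \<epsilon> ?q i) A" if "i \<in> {1..n}" for i
    proof -
      let ?b = "2 * real i / \<epsilon>"
      have b: "0 < ?b" using that \<epsilon> by simp
      have "(\<integral>\<^sup>+v. indicator A (?f i v) \<partial>unif) =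
          (\<integral>\<^sup>+x. indicator A (i, ?q i + x) \<partial>distr unif borel (laplace_quantile ?b))"
      proof (rule nn_integral_distr[symmetric])
        have "(\<lambda>x. (i, ?q i + x)) \<in> measurable borel output_space" by measurable
        from measurable_compose[OF this borel_measurable_indicator[OF A]]
        show "(\<lambda>x. indicator A (i, ?q i + x) :: ennreal) \<in> borel_measurable (distr unif borel (laplace_quantile ?b))"
          by simp
      qed (rule measurable_unif, simp)
      also have "\<dots> = (\<integral>\<^sup>+x. indicator {x. (i, ?q i + x) \<in> A} x \<partial>Lap ?b)"
        unfolding distr_laplace_quantile[OF b] by (rule nn_integral_cong) (simp add: indicator_def)
      also have "\<dots> = emeasure (Lap ?b) {x. (i, ?q i + x) \<in> A}"
      proof (rule nn_integral_indicator)
        have "(\<lambda>x. (i, ?q i + x)) \<in> measurable borel output_space" by measurable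
        from measurable_sets[OF this A] show "{x. (i, ?q i + x) \<in> A} \<in> sets (Lap ?b)" by (simp add: vimage_def)
      qed
      finally show ?thesis by (simp only: emeasure_noisy[OF A, where \<epsilon> = \<epsilon> and q = ?q and l = i])
    qed
    have "emeasure (distr coins output_space out) A = (\<integral>\<^sup>+\<omega>. indicator A (out \<omega>) \<partial>coins)"
      using om A by (subst nn_integral_indicator[symmetric], simp, subst nn_integral_distr) auto
    also have "\<dots> = (\<integral>\<^sup>+u. \<integral>\<^sup>+v. indicator A (?f (?sel u) v) \<partial>unif \<partial>unif)"
      unfolding out using nn_integral_coins[OF km] by simp
    also have "\<dots> = (\<integral>\<^sup>+u. emeasure (noisy \<epsilon> ?q (?sel u)) A \<partial>unif)"
      by (rule nn_integral_cong) (rule inner, rule selection_range[OF n])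
    also have "\<dots> = (\<integral>\<^sup>+l. emeasure (noisy \<epsilon> ?q l) A \<partial>distr unif (count_space UNIV) ?sel)"
      by (rule nn_integral_distr[symmetric]) (rule measurable_unif[OF sm], simp)
    also have "\<dots> = emeasure (DPDistinctCount n \<epsilon> \<beta> D) A"
      by (simp only: emeasure_DPDistinctCount[OF \<epsilon> A] GEM_eq_distr_selection[OF n] w_def)
    finally show "emeasure (distr coins output_space out) A = emeasure (DPDistinctCount n \<epsilon> \<beta> D) A" .
  qed
qed

section \<open>Capped distinct counts\<close>

text \<open>Lists replace functions on indices so that adding or removing a person is list surgery,
  without renumbering the others.\<close>

definition capped :: "nat \<Rightarrow> 'a dataset \<Rightarrow> 'a set list \<Rightarrow> bool" where
  "capped l D vs \<longleftrightarrow> list_all2 (\<lambda>v u. v \<subseteq> fset u \<and> card v \<le> l) vs D"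

lemma capped_subset: "capped l D vs \<Longrightarrow> \<Union>(set vs) \<subseteq> (\<Union>u\<in>set D. fset u)"
  unfolding capped_def by (induction rule: list_all2_induct) auto

lemma DC_eq: "DC D = card (\<Union>u\<in>set D. fset u)"
proof -
  have "(\<Union>i<length D. fset (D ! i)) = (\<Union>u\<in>set D. fset u)"
    unfolding set_conv_nth by auto
  then show ?thesis by (simp add: DC_def)
qed

lemma capped_le_DC: "capped l D vs \<Longrightarrow> card (\<Union>(set vs)) \<le> DC D"
  unfolding DC_eq by (rule card_mono[OF _ capped_subset]) auto

lemma DC_bounded_capped: "DC_bounded D l = Max {card (\<Union>(set vs)) | vs. capped l D vs}"
proof -
  have "{card (\<Union>i<length D. v i) | v. \<forall>i<length D. v i \<subseteq> fset (D ! i) \<and> card (v i) \<le> l} =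
      {card (\<Union>(set vs)) | vs. capped l D vs}" (is "?A = ?B")
  proof
    show "?A \<subseteq> ?B"
    proof
      fix n assume "n \<in> ?A"
      then obtain v where v: "n = card (\<Union>i<length D. v i)"
        "\<forall>i<length D. v i \<subseteq> fset (D ! i) \<and> card (v i) \<le> l" by auto
      have "capped l D (map v [0..<length D])" using v by (simp add: capped_def list_all2_conv_all_nth)
      moreover have "\<Union>(set (map v [0..<length D])) = (\<Union>i<length D. v i)" by auto
      ultimately show "n \<in> ?B" unfolding v(1) by (intro CollectI exI[of _ "map v [0..<length D]"]) simp
    qed
    show "?B \<subseteq> ?A"
    proof
      fix n assume "n \<in> ?B"
      then obtain vs where vs: "n = card (\<Union>(set vs))" "capped l D vs" by auto
      then have "length vs = length D" by (auto simp: capped_def dest: list_all2_lengthD)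
      then have "\<Union>(set vs) = (\<Union>i<length D. vs ! i)" by (force simp: set_conv_nth)
      then show "n \<in> ?A" using vs
        by (intro CollectI exI[of _ "\<lambda>i. vs ! i"]) (auto simp: capped_def list_all2_conv_all_nth)
    qed
  qed
  then show ?thesis by (simp add: DC_bounded_def)
qed

lemma finite_capped_counts: "finite {card (\<Union>(set vs)) | vs. capped l D vs}"
  by (rule finite_subset[of _ "{..DC D}"]) (auto dest: capped_le_DC)

lemma capped_empty: "capped l D (replicate (length D) {})"
  by (auto simp: capped_def list_all2_conv_all_nth)

lemma DC_bounded_ge: "capped l D vs \<Longrightarrow> card (\<Union>(set vs)) \<le> DC_bounded D l"
  unfolding DC_bounded_capped using finite_capped_counts by (intro Max_ge) auto

lemma DC_bounded_attained:
  obtains vs where "capped l D vs" "card (\<Union>(set vs)) = DC_bounded D l"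
proof -
  have "DC_bounded D l \<in> {card (\<Union>(set vs)) | vs. capped l D vs}"
    unfolding DC_bounded_capped using finite_capped_counts capped_empty[of l D] by (intro Max_in) auto
  then show ?thesis using that by auto
qed

lemma DC_bounded_le_DC: "DC_bounded D l \<le> DC D"
  using DC_bounded_attained capped_le_DC by metis

text \<open>A selection without the person is extended by the empty set; conversely, dropping the
  person's set loses at most \<open>l\<close> elements.\<close>

lemma DC_bounded_add_person:
  "DC_bounded (xs @ ys) l \<le> DC_bounded (xs @ u # ys) l"
  "DC_bounded (xs @ u # ys) l \<le> DC_bounded (xs @ ys) l + l"
proof -
  obtain vs where vs: "capped l (xs @ ys) vs" "card (\<Union>(set vs)) = DC_bounded (xs @ ys) l"
    using DC_bounded_attained by blast
  then obtain vx vy where v: "vs = vx @ vy" "capped l xs vx" "capped l ys vy"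
    unfolding capped_def by (auto simp: list_all2_append2)
  then have "capped l (xs @ u # ys) (vx @ {} # vy)"
    unfolding capped_def by (auto intro!: list_all2_appendI)
  from DC_bounded_ge[OF this] show "DC_bounded (xs @ ys) l \<le> DC_bounded (xs @ u # ys) l"
    using vs v by simp
next
  obtain vs where vs: "capped l (xs @ u # ys) vs" "card (\<Union>(set vs)) = DC_bounded (xs @ u # ys) l"
    using DC_bounded_attained by blast
  then obtain vx v vy where v: "vs = vx @ v # vy" "capped l xs vx" "capped l ys vy" "card v \<le> l"
    unfolding capped_def by (auto simp: list_all2_append2 list_all2_Cons2)
  have "capped l (xs @ ys) (vx @ vy)" using v unfolding capped_def by (auto intro!: list_all2_appendI)
  from DC_bounded_ge[OF this] have "card (\<Union>(set (vx @ vy))) \<le> DC_bounded (xs @ ys) l" .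
  moreover have "\<Union>(set vs) = \<Union>(set (vx @ vy)) \<union> v" using v by auto
  then have "card (\<Union>(set vs)) \<le> card (\<Union>(set (vx @ vy))) + card v" by (metis card_Un_le)
  ultimately show "DC_bounded (xs @ u # ys) l \<le> DC_bounded (xs @ ys) l + l" using vs v by linarith
qed

lemma DC_bounded_neighboring:
  assumes "neighboring D D'"
  shows "\<bar>real (DC_bounded D l) - real (DC_bounded D' l)\<bar> \<le> real l"
proof -
  obtain xs u ys where c: "(D = xs @ u # ys \<and> D' = xs @ ys) \<or> (D' = xs @ u # ys \<and> D = xs @ ys)"
    using assms by (auto simp: neighboring_def)
  then show ?thesis using DC_bounded_add_person[where xs = xs and ys = ys and u = u and l = l] by auto
qed

text \<open>In a matching the elements credited to a person sit on distinct copies, so there are at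
  most \<open>l\<close> of them. Conversely each element of an optimal union picks one contributor,
  who numbers the selected elements injectively by copies.\<close>

lemma max_matching_size_eq_DC_bounded: "max_matching_size (contribution_graph D l) = DC_bounded D l"
proof (rule antisym)
  let ?G = "contribution_graph D l"
  obtain F where F: "bipartite_matching ?G F" "card F = max_matching_size ?G"
    using max_matching_size_attained[OF finite_contribution_graph] by blast
  have FG: "F \<subseteq> ?G" and inj: "inj_on fst F" "inj_on snd F" using F by (auto simp: bipartite_matching_def)
  have finF: "finite F" using FG finite_contribution_graph finite_subset by blast
  define vs where "vs = map (\<lambda>i. snd ` {x \<in> F. fst (fst x) = i}) [0..<length D]"
  have cap: "card (snd ` {x \<in> F. fst (fst x) = i}) \<le> l" for i
  proof -
    have "card (snd ` {x \<in> F. fst (fst x) = i}) \<le> card {x \<in> F. fst (fst x) = i}"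
      by (rule card_image_le) (use finF in simp)
    also have "\<dots> \<le> card {1..l}"
    proof (rule card_inj_on_le[where f = "\<lambda>x. snd (fst x)"])
      show "inj_on (\<lambda>x. snd (fst x)) {x \<in> F. fst (fst x) = i}"
      proof (rule inj_onI)
        fix x y assume xy: "x \<in> {x \<in> F. fst (fst x) = i}" "y \<in> {x \<in> F. fst (fst x) = i}" "snd (fst x) = snd (fst y)"
        then have "fst x = fst y" by (auto intro: prod_eqI)
        then show "x = y" using inj(1) xy by (auto dest: inj_onD)
      qed
      show "(\<lambda>x. snd (fst x)) ` {x \<in> F. fst (fst x) = i} \<subseteq> {1..l}"
        using FG by (auto simp: contribution_graph_def)
    qed simp
    finally show ?thesis by simp
  qed
  have "snd ` {x \<in> F. fst (fst x) = i} \<subseteq> fset (D ! i)" for i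
    using FG by (auto simp: contribution_graph_def)
  then have "capped l D vs" using cap by (simp add: capped_def vs_def list_all2_conv_all_nth)
  from DC_bounded_ge[OF this] have "card (\<Union>(set vs)) \<le> DC_bounded D l" .
  moreover have "\<Union>(set vs) = snd ` F"
    using FG by (force simp: vs_def contribution_graph_def)
  ultimately show "max_matching_size ?G \<le> DC_bounded D l" using F card_image[OF inj(2)] by simp
next
  let ?G = "contribution_graph D l"
  obtain vs where vs: "capped l D vs" "card (\<Union>(set vs)) = DC_bounded D l"
    using DC_bounded_attained by blast
  then have len: "length vs = length D" and v: "\<And>i. i < length D \<Longrightarrow> vs ! i \<subseteq> fset (D ! i) \<and> card (vs ! i) \<le> l"
    by (auto simp: capped_def list_all2_conv_all_nth)
  let ?U = "\<Union>(set vs)"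
  have "\<exists>i<length D. e \<in> vs ! i" if "e \<in> ?U" for e using that len by (auto simp: in_set_conv_nth)
  then obtain c where c: "\<And>e. e \<in> ?U \<Longrightarrow> c e < length D \<and> e \<in> vs ! c e" by metis
  have "\<exists>h. inj_on h (vs ! i) \<and> h ` (vs ! i) \<subseteq> {1..min l (fcard (D ! i))}" if "i < length D" for i
  proof -
    have fin: "finite (vs ! i)" by (rule finite_subset[OF conjunct1[OF v[OF that]] finite_fset])
    have "card (vs ! i) \<le> fcard (D ! i)" unfolding fcard.rep_eq by (rule card_mono[OF finite_fset conjunct1[OF v[OF that]]])
    then have "card (vs ! i) \<le> card {1..min l (fcard (D ! i))}" using v[OF that] by simp
    then show ?thesis using card_le_inj[OF fin finite_atLeastAtMost] by blast
  qed
  then obtain h where h: "\<And>i. i < length D \<Longrightarrow> inj_on (h i) (vs ! i) \<and> h i ` (vs ! i) \<subseteq> {1..min l (fcard (D ! i))}"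
    by metis
  define F where "F = (\<lambda>e. ((c e, h (c e) e), e)) ` ?U"
  have "F \<subseteq> ?G"
  proof
    fix x assume "x \<in> F"
    then obtain e where e: "x = ((c e, h (c e) e), e)" "e \<in> ?U" by (auto simp: F_def)
    then show "x \<in> ?G" using c[OF e(2)] h[of "c e"] v[of "c e"] unfolding contribution_graph_def by blast
  qed
  moreover have "inj_on fst F"
  proof (rule inj_onI)
    fix x y assume "x \<in> F" "y \<in> F" "fst x = fst y"
    then obtain e e' where e: "x = ((c e, h (c e) e), e)" "e \<in> ?U" "y = ((c e', h (c e') e'), e')" "e' \<in> ?U"
      unfolding F_def by blast
    moreover from this \<open>fst x = fst y\<close> have "(c e, h (c e) e) = (c e', h (c e') e')"
      by (simp only: fst_conv)
    then have "c e = c e'" "h (c e) e = h (c e') e'" by blast+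
    ultimately have "e = e'" using h[of "c e"] c[of e] c[of e'] by (auto dest: inj_onD)
    then show "x = y" using e by simp
  qed
  moreover have "inj_on snd F" by (auto simp: F_def inj_on_def)
  ultimately have "bipartite_matching ?G F" by (simp add: bipartite_matching_def)
  from matching_le_max_matching_size[OF finite_contribution_graph this]
  have "card F \<le> max_matching_size ?G" .
  moreover have "card F = card ?U" unfolding F_def by (rule card_image) (auto simp: inj_on_def)
  ultimately show "DC_bounded D l \<le> max_matching_size ?G" using vs by simp
qed

lemma dc_query_eq: "dc_query \<epsilon> \<beta> l D = real (DC_bounded D l) - 2 * real l / \<epsilon> * ln (1 / (2 * \<beta>))"
  by (simp add: dc_query_def max_matching_size_eq_DC_bounded)

section \<open>The generalized exponential mechanism\<close>

lemma Min_image_le_add: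
  fixes f g :: "'i \<Rightarrow> real"
  assumes "finite A" "A \<noteq> {}" "\<And>j. j \<in> A \<Longrightarrow> f j \<le> g j + c"
  shows "Min (f ` A) \<le> Min (g ` A) + c"
proof -
  have "Min (g ` A) \<in> g ` A" using assms by (intro Min_in) auto
  then obtain j where j: "j \<in> A" "Min (g ` A) = g j" by auto
  have "Min (f ` A) \<le> f j" using assms j by (intro Min_le) auto
  then show ?thesis using assms(3)[OF j(1)] j by simp
qed

text \<open>Passing to the other dataset moves the numerator by at most
  \<open>\<Delta> i + \<Delta> j\<close>, which is exactly the denominator. This normalisation makes
  queries of different sensitivity comparable.\<close>

lemma gem_score_le:
  assumes \<Delta>: "\<And>i. i \<in> {1..m} \<Longrightarrow> 0 < \<Delta> i" and i: "i \<in> {1..m}"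
    and q: "\<And>j. j \<in> {1..m} \<Longrightarrow> \<bar>q j D - q j D'\<bar> \<le> \<Delta> j"
  shows "gem_score q \<Delta> m \<epsilon> \<beta> D i \<le> gem_score q \<Delta> m \<epsilon> \<beta> D' i + 1"
  unfolding gem_score_def Let_def
proof (rule Min_image_le_add)
  fix j assume j: "j \<in> {1..m}"
  let ?t = "2 / \<epsilon> * ln (real m / \<beta>)"
  have pos: "0 < \<Delta> i + \<Delta> j" using \<Delta>[OF i] \<Delta>[OF j] by simp
  have "(q i D - ?t * \<Delta> i) - (q j D - ?t * \<Delta> j) \<le> ((q i D' - ?t * \<Delta> i) - (q j D' - ?t * \<Delta> j)) + (\<Delta> i + \<Delta> j)"
    using q[OF i] q[OF j] by linarith
  then have "((q i D - ?t * \<Delta> i) - (q j D - ?t * \<Delta> j)) / (\<Delta> i + \<Delta> j) \<le>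
      (((q i D' - ?t * \<Delta> i) - (q j D' - ?t * \<Delta> j)) + (\<Delta> i + \<Delta> j)) / (\<Delta> i + \<Delta> j)"
    using pos by (intro divide_right_mono) auto
  also have "\<dots> = ((q i D' - ?t * \<Delta> i) - (q j D' - ?t * \<Delta> j)) / (\<Delta> i + \<Delta> j) + 1"
    using pos by (simp add: add_divide_distrib)
  finally show "((q i D - ?t * \<Delta> i) - (q j D - ?t * \<Delta> j)) / (\<Delta> i + \<Delta> j) \<le>
      ((q i D' - ?t * \<Delta> i) - (q j D' - ?t * \<Delta> j)) / (\<Delta> i + \<Delta> j) + 1" .
qed (use i in auto)

lemma gem_weight_le:
  assumes "0 \<le> \<epsilon>" "\<And>i. i \<in> {1..m} \<Longrightarrow> 0 < \<Delta> i" "i \<in> {1..m}"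
    and "\<And>j. j \<in> {1..m} \<Longrightarrow> \<bar>q j D - q j D'\<bar> \<le> \<Delta> j"
  shows "gem_weight q \<Delta> m \<epsilon> \<beta> D i \<le> exp (\<epsilon> / 2) * gem_weight q \<Delta> m \<epsilon> \<beta> D' i"
proof -
  have "\<epsilon> * gem_score q \<Delta> m \<epsilon> \<beta> D i \<le> \<epsilon> * (gem_score q \<Delta> m \<epsilon> \<beta> D' i + 1)"
    using gem_score_le[where q = q and \<Delta> = \<Delta>, OF assms(2-4)] assms(1) by (intro mult_left_mono)
  then show ?thesis by (simp add: gem_weight_def exp_add[symmetric] algebra_simps)
qed

text \<open>The weight and the normalising sum each change by a factor of at most
  \<open>exp (\<epsilon> / 2)\<close>, in opposite directions.\<close>

lemma pmf_GEM_le: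
  assumes \<epsilon>: "0 \<le> \<epsilon>" and m: "1 \<le> m" and \<Delta>: "\<And>i. i \<in> {1..m} \<Longrightarrow> 0 < \<Delta> i"
    and q: "\<And>j. j \<in> {1..m} \<Longrightarrow> \<bar>q j D - q j D'\<bar> \<le> \<Delta> j"
  shows "pmf (GEM D q \<Delta> m \<epsilon> \<beta>) i \<le> exp \<epsilon> * pmf (GEM D' q \<Delta> m \<epsilon> \<beta>) i"
proof (cases "i \<in> {1..m}")
  case True
  let ?w = "gem_weight q \<Delta> m \<epsilon> \<beta> D" and ?w' = "gem_weight q \<Delta> m \<epsilon> \<beta> D'"
  have S: "0 < sum ?w {1..m}" "0 < sum ?w' {1..m}"
    using m by (auto intro!: sum_pos simp: gem_weight_pos)
  have "sum ?w' {1..m} \<le> (\<Sum>j\<in>{1..m}. exp (\<epsilon> / 2) * ?w j)"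
    by (rule sum_mono, rule gem_weight_le[OF \<epsilon> \<Delta>]) (use q in \<open>auto simp: abs_minus_commute\<close>)
  then have S': "sum ?w' {1..m} \<le> exp (\<epsilon> / 2) * sum ?w {1..m}" by (simp add: sum_distrib_left)
  have w: "?w i \<le> exp (\<epsilon> / 2) * ?w' i" by (rule gem_weight_le[where q = q and \<Delta> = \<Delta>, OF \<epsilon> \<Delta> True q])
  have "?w i * sum ?w' {1..m} \<le> (exp (\<epsilon> / 2) * ?w' i) * (exp (\<epsilon> / 2) * sum ?w {1..m})"
    by (rule mult_mono[OF w S']) (use S in \<open>simp_all add: less_imp_le gem_weight_pos\<close>)
  also have "\<dots> = (exp (\<epsilon> / 2) * exp (\<epsilon> / 2)) * (?w' i * sum ?w {1..m})" by (simp add: algebra_simps)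
  also have "exp (\<epsilon> / 2) * exp (\<epsilon> / 2) = exp \<epsilon>" by (simp add: exp_add[symmetric])
  finally have "?w i * sum ?w' {1..m} \<le> exp \<epsilon> * (?w' i * sum ?w {1..m})" .
  then have "?w i / sum ?w {1..m} \<le> exp \<epsilon> * (?w' i / sum ?w' {1..m})"
    using S by (simp add: field_simps)
  then show ?thesis by (simp only: pmf_GEM[OF m] True if_True)
next
  case False
  then show ?thesis by (simp only: pmf_GEM[OF m] if_False)
qed

text \<open>A maximiser of the shifted query \<open>q i D - t * \<Delta> i\<close> has only
  nonnegative comparisons, and the one with itself is 0.\<close>

lemma gem_score_attains_0:
  assumes m: "1 \<le> m" and \<Delta>: "\<And>i. i \<in> {1..m} \<Longrightarrow> 0 < \<Delta> i"
  obtains i where "i \<in> {1..m}" "gem_score q \<Delta> m \<epsilon> \<beta> D i = 0"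
proof -
  let ?t = "2 / \<epsilon> * ln (real m / \<beta>)"
  let ?g = "\<lambda>i. q i D - ?t * \<Delta> i"
  have "Max (?g ` {1..m}) \<in> ?g ` {1..m}" using m by (intro Max_in) auto
  then obtain i where i: "i \<in> {1..m}" "Max (?g ` {1..m}) = ?g i" by (metis (mono_tags, lifting) imageE)
  have ge: "?g j \<le> ?g i" if "j \<in> {1..m}" for j
    unfolding i(2)[symmetric] using that by (intro Max_ge) auto
  have "gem_score q \<Delta> m \<epsilon> \<beta> D i = 0"
    unfolding gem_score_def Let_def
  proof (rule Min_eqI)
    show "0 \<in> (\<lambda>j. (?g i - ?g j) / (\<Delta> i + \<Delta> j)) ` {1..m}" using i by (intro image_eqI[of _ _ i]) auto
    fix y assume "y \<in> (\<lambda>j. (?g i - ?g j) / (\<Delta> i + \<Delta> j)) ` {1..m}"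
    then obtain j where j: "j \<in> {1..m}" "y = (?g i - ?g j) / (\<Delta> i + \<Delta> j)" by auto
    show "0 \<le> y" unfolding j(2)
      by (rule divide_nonneg_pos) (use ge[OF j(1)] \<Delta>[OF i(1)] \<Delta>[OF j(1)] in auto)
  qed simp
  then show ?thesis using that i by blast
qed

text \<open>The value of \<open>t\<close> is made for this union bound: a candidate of score 0 keeps
  the normalising sum at least 1, a candidate scoring below \<open>- t\<close> weighs at most
  \<open>\<beta> / m\<close>, and there are at most \<open>m\<close> of them.\<close>

lemma GEM_low_score:
  assumes \<epsilon>: "0 < \<epsilon>" and \<beta>: "0 < \<beta>" and m: "1 \<le> m" and \<Delta>: "\<And>i. i \<in> {1..m} \<Longrightarrow> 0 < \<Delta> i"
  shows "measure_pmf.prob (GEM D q \<Delta> m \<epsilon> \<beta>) {i. gem_score q \<Delta> m \<epsilon> \<beta> D i < - (2 / \<epsilon> * ln (real m / \<beta>))} \<le> \<beta>"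
proof -
  let ?P = "GEM D q \<Delta> m \<epsilon> \<beta>" and ?w = "gem_weight q \<Delta> m \<epsilon> \<beta> D" and ?s = "gem_score q \<Delta> m \<epsilon> \<beta> D"
  let ?t = "2 / \<epsilon> * ln (real m / \<beta>)"
  let ?B = "{i \<in> {1..m}. ?s i < - ?t}"
  obtain i0 where i0: "i0 \<in> {1..m}" "?s i0 = 0" by (rule gem_score_attains_0[OF m \<Delta>])
  have "?w i0 \<le> sum ?w {1..m}"
    by (rule member_le_sum) (use i0 in \<open>auto simp: less_imp_le gem_weight_pos\<close>)
  then have S: "1 \<le> sum ?w {1..m}" using i0 by (simp add: gem_weight_def)
  have p: "pmf ?P i \<le> \<beta> / real m" if "i \<in> ?B" for i
  proof -
    have "?w i \<le> exp (\<epsilon> * (- ?t) / 2)"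
    proof -
      have "\<epsilon> * ?s i / 2 \<le> \<epsilon> * (- ?t) / 2"
        by (intro divide_right_mono mult_left_mono) (use that \<epsilon> in auto)
      then show ?thesis by (simp only: gem_weight_def exp_le_cancel_iff)
    qed
    also have "\<epsilon> * (- ?t) / 2 = - ln (real m / \<beta>)" using \<epsilon> by simp
    also have "exp (- ln (real m / \<beta>)) = \<beta> / real m" using \<beta> m by (simp add: exp_minus)
    finally have "?w i \<le> \<beta> / real m" .
    moreover have "?w i / sum ?w {1..m} \<le> ?w i"
      using S gem_weight_pos[of q \<Delta> m \<epsilon> \<beta> D i] by (simp add: field_simps)
    moreover have "pmf ?P i = ?w i / sum ?w {1..m}" using that unfolding pmf_GEM[OF m] by simp
    ultimately show ?thesis by linarith
  qed
  have "measure_pmf.prob ?P {i. ?s i < - ?t} = measure_pmf.prob ?P ({i. ?s i < - ?t} \<inter> set_pmf ?P)"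
    by (simp add: measure_Int_set_pmf)
  also have "\<dots> \<le> measure_pmf.prob ?P ?B"
    by (rule measure_pmf.finite_measure_mono) (use set_pmf_GEM[OF m, of D q \<Delta> \<epsilon> \<beta>] in auto)
  also have "\<dots> = (\<Sum>i\<in>?B. pmf ?P i)" by (rule measure_measure_pmf_finite) simp
  also have "\<dots> \<le> (\<Sum>i\<in>?B. \<beta> / real m)" by (rule sum_mono) (rule p)
  also have "\<dots> = real (card ?B) * (\<beta> / real m)" by simp
  also have "\<dots> \<le> real m * (\<beta> / real m)"
  proof (rule mult_right_mono)
    have "card ?B \<le> card {1..m}" by (rule card_mono) auto
    then show "real (card ?B) \<le> real m" by simp
  qed (use \<beta> in simp)
  also have "\<dots> = \<beta>" using m by simp
  finally show ?thesis .
qed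

section \<open>Privacy and accuracy\<close>

lemma emeasure_Lap_shift:
  assumes b: "0 < b" and B: "B \<in> sets borel"
  shows "emeasure (Lap b) {x. c + x \<in> B} \<le> ennreal (exp (\<bar>c\<bar> / b)) * emeasure (Lap b) B"
proof -
  let ?f = "\<lambda>x. ennreal (1 / (2 * b) * exp (- \<bar>x\<bar> / b))"
  have "(\<lambda>x. c + x) \<in> borel_measurable borel" by measurable
  from measurable_sets[OF this B] have m: "{x. c + x \<in> B} \<in> sets borel" by (simp add: vimage_def)
  have "emeasure (Lap b) {x. c + x \<in> B} = (\<integral>\<^sup>+x. ?f x * indicator {x. c + x \<in> B} x \<partial>lborel)"
    by (rule emeasure_Lap[OF m])
  also have "\<dots> = (\<integral>\<^sup>+x. ?f (- c + 1 * x) * indicator {x. c + x \<in> B} (- c + 1 * x) \<partial>lborel)"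
    using m by (subst nn_integral_real_affine[where c = 1 and t = "- c"]) auto
  also have "\<dots> \<le> (\<integral>\<^sup>+x. ennreal (exp (\<bar>c\<bar> / b)) * (?f x * indicator B x) \<partial>lborel)"
  proof (rule nn_integral_mono)
    fix x
    have "- \<bar>- c + x\<bar> \<le> \<bar>c\<bar> - \<bar>x\<bar>" by linarith
    then have "- \<bar>- c + x\<bar> / b \<le> (\<bar>c\<bar> - \<bar>x\<bar>) / b" using b by (intro divide_right_mono) auto
    then have "exp (- \<bar>- c + x\<bar> / b) \<le> exp (\<bar>c\<bar> / b) * exp (- \<bar>x\<bar> / b)"
      by (simp add: exp_add[symmetric] diff_divide_distrib)
    then have "1 / (2 * b) * exp (- \<bar>- c + x\<bar> / b) \<le> 1 / (2 * b) * (exp (\<bar>c\<bar> / b) * exp (- \<bar>x\<bar> / b))"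
      using b by (intro mult_left_mono) auto
    then have "?f (- c + 1 * x) \<le> ennreal (exp (\<bar>c\<bar> / b)) * ?f x"
      using b by (subst ennreal_mult[symmetric]) (auto simp: algebra_simps intro!: ennreal_leI)
    then show "?f (- c + 1 * x) * indicator {x. c + x \<in> B} (- c + 1 * x) \<le>
        ennreal (exp (\<bar>c\<bar> / b)) * (?f x * indicator B x)"
      by (auto simp: indicator_def)
  qed
  also have "\<dots> = ennreal (exp (\<bar>c\<bar> / b)) * emeasure (Lap b) B"
    using B by (subst nn_integral_cmult) (auto simp: emeasure_Lap)
  finally show ?thesis .
qed

locale mechanism =
  fixes \<epsilon> \<beta> :: real and n :: nat
  assumes \<epsilon>: "0 < \<epsilon>" and \<beta>: "0 < \<beta>" "\<beta> < 1 / 2" and n: "1 \<le> n"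
begin

abbreviation gem :: "'a dataset \<Rightarrow> nat pmf" where
  "gem D \<equiv> GEM D (dc_query \<epsilon> \<beta>) real n (\<epsilon> / 2) \<beta>"

abbreviation mech :: "'a dataset \<Rightarrow> (nat \<times> real) measure" where
  "mech \<equiv> DPDistinctCount n \<epsilon> \<beta>"

lemma emeasure_mechanism:
  assumes "A \<in> sets output_space"
  shows "emeasure (mech D) A =
    (\<integral>\<^sup>+l. emeasure (Lap (2 * real l / \<epsilon>)) {x. (l, dc_query \<epsilon> \<beta> l D + x) \<in> A} \<partial>measure_pmf (gem D))"
  unfolding emeasure_DPDistinctCount[OF \<epsilon> assms]
  by (rule nn_integral_cong) (rule emeasure_noisy[OF assms, where q = "\<lambda>l. dc_query \<epsilon> \<beta> l D"])

lemma AE_gem: "(\<And>l. l \<in> {1..n} \<Longrightarrow> P l) \<Longrightarrow> AE l in measure_pmf (gem D). P l"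
  by (auto simp: AE_measure_pmf_iff dest!: subsetD[OF set_pmf_GEM[OF n]])

lemma space_mechanism: "space (mech D) = UNIV"
  using sets_eq_imp_space_eq[OF sets_DPDistinctCount] by (simp add: space_pair_measure)

lemma scale_pos: "l \<in> {1..n} \<Longrightarrow> 0 < 2 * real l / \<epsilon>" using \<epsilon> by simp

lemma prob_space_mechanism: "prob_space (mech D)"
proof (rule prob_spaceI)
  have U: "UNIV \<in> sets output_space" using sets.top[of output_space] by (simp add: space_pair_measure)
  have "emeasure (Lap (2 * real l / \<epsilon>)) UNIV = 1" if "l \<in> {1..n}" for l
    using prob_space.emeasure_space_1[OF prob_space_Lap[OF scale_pos[OF that]]] by simp
  then have "(\<integral>\<^sup>+l. emeasure (Lap (2 * real l / \<epsilon>)) UNIV \<partial>measure_pmf (gem D)) = (\<integral>\<^sup>+l. 1 \<partial>measure_pmf (gem D))"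
    by (intro nn_integral_cong_AE AE_gem) auto
  then show "emeasure (mech D) (space (mech D)) = 1"
    unfolding space_mechanism emeasure_mechanism[OF U] by simp
qed

lemma section_borel:
  assumes "A \<in> sets output_space"
  shows "{x. (l, q + x) \<in> A} \<in> sets borel"
proof -
  have "(\<lambda>x::real. (l, q + x)) \<in> measurable borel output_space" by measurable
  from measurable_sets[OF this assms] show ?thesis by (simp add: vimage_def)
qed

lemma mechanism_private: "differentially_private output_space \<epsilon> (mech)"
  unfolding differentially_private_def
proof (intro allI impI ballI)
  fix D D' :: "'a dataset" and A :: "(nat \<times> real) set"
  assume nb: "neighboring D D'" and A: "A \<in> sets output_space"
  let ?K = "\<lambda>D l. emeasure (Lap (2 * real l / \<epsilon>)) {x. (l, dc_query \<epsilon> \<beta> l D + x) \<in> A}"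
  let ?e = "ennreal (exp (\<epsilon> / 2))"
  have sens: "\<bar>dc_query \<epsilon> \<beta> l D - dc_query \<epsilon> \<beta> l D'\<bar> \<le> real l" for l
    using DC_bounded_neighboring[OF nb, of l] by (simp add: dc_query_eq)
  have K: "?K D l \<le> ?e * ?K D' l" if l: "l \<in> {1..n}" for l
  proof -
    let ?b = "2 * real l / \<epsilon>" and ?c = "dc_query \<epsilon> \<beta> l D - dc_query \<epsilon> \<beta> l D'"
    have "{x. (l, dc_query \<epsilon> \<beta> l D + x) \<in> A} = {x. ?c + x \<in> {x. (l, dc_query \<epsilon> \<beta> l D' + x) \<in> A}}"
      by simp
    then have "?K D l \<le> ennreal (exp (\<bar>?c\<bar> / ?b)) * ?K D' l"
      using emeasure_Lap_shift[OF scale_pos[OF l] section_borel[OF A, of l "dc_query \<epsilon> \<beta> l D'"], of ?c] by simp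
    also have "\<bar>?c\<bar> / ?b \<le> real l / ?b" using scale_pos[OF l] sens by (intro divide_right_mono) auto
    \<comment> \<open>The noise scale grows with \<open>l\<close> exactly as the sensitivity does,
      so each cap loses the same \<open>\<epsilon> / 2\<close>.\<close>
    then have "\<bar>?c\<bar> / ?b \<le> \<epsilon> / 2" using l \<epsilon> by simp
    then have "ennreal (exp (\<bar>?c\<bar> / ?b)) * ?K D' l \<le> ?e * ?K D' l"
      by (intro mult_right_mono ennreal_leI) auto
    finally show ?thesis .
  qed
  have "emeasure (mech D) A = (\<integral>\<^sup>+l. ennreal (pmf (gem D) l) * ?K D l \<partial>count_space UNIV)"
    unfolding emeasure_mechanism[OF A] by (rule nn_integral_measure_pmf)
  also have "\<dots> \<le> (\<integral>\<^sup>+l. ennreal (exp \<epsilon>) * (ennreal (pmf (gem D') l) * ?K D' l) \<partial>count_space UNIV)"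
  proof (rule nn_integral_mono)
    fix l
    show "ennreal (pmf (gem D) l) * ?K D l \<le> ennreal (exp \<epsilon>) * (ennreal (pmf (gem D') l) * ?K D' l)"
    proof (cases "l \<in> {1..n}")
      case True
      have "pmf (gem D) l \<le> exp (\<epsilon> / 2) * pmf (gem D') l"
        by (rule pmf_GEM_le[OF _ n]) (use \<epsilon> sens in auto)
      then have "ennreal (pmf (gem D) l) \<le> ?e * ennreal (pmf (gem D') l)"
        by (simp add: ennreal_mult[symmetric] ennreal_leI)
      \<comment> \<open>One factor comes from the changed selection probability, the other from the
        shifted noise.\<close>
      then have "ennreal (pmf (gem D) l) * ?K D l \<le> (?e * ennreal (pmf (gem D') l)) * (?e * ?K D' l)"
        using K[OF True] by (intro mult_mono) auto
      also have "\<dots> = (?e * ?e) * (ennreal (pmf (gem D') l) * ?K D' l)" by (simp add: ac_simps)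
      also have "?e * ?e = ennreal (exp \<epsilon>)" by (simp add: ennreal_mult[symmetric] exp_add[symmetric])
      finally show ?thesis .
    next
      case False
      then have "pmf (gem D) l = 0" by (simp only: pmf_GEM[OF n] if_False)
      then show ?thesis by simp
    qed
  qed
  also have "\<dots> = ennreal (exp \<epsilon>) * (\<integral>\<^sup>+l. ennreal (pmf (gem D') l) * ?K D' l \<partial>count_space UNIV)"
    by (rule nn_integral_cmult) simp
  also have "(\<integral>\<^sup>+l. ennreal (pmf (gem D') l) * ?K D' l \<partial>count_space UNIV) = emeasure (mech D') A"
    unfolding emeasure_mechanism[OF A] by (rule nn_integral_measure_pmf[symmetric])
  finally have le: "emeasure (mech D) A \<le> ennreal (exp \<epsilon>) * emeasure (mech D') A" .
  interpret P: prob_space "mech D" by (rule prob_space_mechanism)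
  interpret P': prob_space "mech D'" by (rule prob_space_mechanism)
  show "measure (mech D) A \<le> exp \<epsilon> * measure (mech D') A"
    using le unfolding P.emeasure_eq_measure P'.emeasure_eq_measure
    by (simp add: ennreal_mult[symmetric])
qed

text \<open>The union bound common to both accuracy claims: \<open>d\<close> accounts for a bad
  selection, \<open>c\<close> for bad noise after a good one.\<close>

lemma mechanism_failure:
  assumes P: "{y. \<not> P y} \<in> sets output_space" and c: "0 \<le> c" "0 \<le> d"
    and good: "measure_pmf.prob (gem D) {l. \<not> G l} \<le> d"
    and tail: "\<And>l. l \<in> {1..n} \<Longrightarrow> G l \<Longrightarrow>
      emeasure (Lap (2 * real l / \<epsilon>)) {x. \<not> P (l, dc_query \<epsilon> \<beta> l D + x)} \<le> ennreal c"
  shows "\<P>(y in mech D. P y) \<ge> 1 - (c + d)"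
proof -
  let ?M = "mech D"
  interpret M: prob_space ?M by (rule prob_space_mechanism)
  let ?K = "\<lambda>l. emeasure (Lap (2 * real l / \<epsilon>)) {x. \<not> P (l, dc_query \<epsilon> \<beta> l D + x)}"
  have "emeasure ?M {y. \<not> P y} = (\<integral>\<^sup>+l. ?K l \<partial>measure_pmf (gem D))"
    using emeasure_mechanism[OF P] by simp
  also have "\<dots> \<le> (\<integral>\<^sup>+l. ennreal c + indicator {l. \<not> G l} l \<partial>measure_pmf (gem D))"
  proof (rule nn_integral_mono_AE, rule AE_gem)
    fix l assume l: "l \<in> {1..n}"
    interpret L: prob_space "Lap (2 * real l / \<epsilon>)" by (rule prob_space_Lap[OF scale_pos[OF l]])
    show "?K l \<le> ennreal c + indicator {l. \<not> G l} l"
    proof (cases "G l")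
      case True
      then show ?thesis using tail[OF l] by simp
    next
      case False
      have "?K l \<le> 1" by (rule L.emeasure_le_1)
      then show ?thesis using False by (simp add: add_increasing)
    qed
  qed
  also have "\<dots> = ennreal c + emeasure (measure_pmf (gem D)) {l. \<not> G l}"
    by (simp add: nn_integral_add)
  also have "\<dots> \<le> ennreal c + ennreal d"
    unfolding measure_pmf.emeasure_eq_measure by (intro add_left_mono ennreal_leI good)
  also have "\<dots> = ennreal (c + d)" using c by simp
  finally have "ennreal (measure ?M {y. \<not> P y}) \<le> ennreal (c + d)"
    unfolding M.emeasure_eq_measure .
  then have "measure ?M {y. \<not> P y} \<le> c + d" using c by (subst (asm) ennreal_le_iff) auto
  moreover have "\<P>(y in ?M. P y) = 1 - measure ?M {y. \<not> P y}"
  proof -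
    have "{y \<in> space ?M. P y} = space ?M - {y. \<not> P y}" by (auto simp: space_mechanism)
    then show ?thesis using M.prob_compl[of "{y. \<not> P y}"] P by (simp add: sets_DPDistinctCount)
  qed
  ultimately show ?thesis by simp
qed

lemma log_term: "0 \<le> ln (1 / (2 * \<beta>))" "exp (- ln (1 / (2 * \<beta>))) / 2 = \<beta>"
  using \<beta> by (simp_all add: exp_minus)

text \<open>The factor 2 inside the logarithm cancels the 1/2 of a one-sided Laplace tail, so the
  tails are exactly \<open>\<beta>\<close>.\<close>

lemma Lap_upper_tail:
  assumes l: "l \<in> {1..n}"
  shows "emeasure (Lap (2 * real l / \<epsilon>)) {2 * real l / \<epsilon> * ln (1 / (2 * \<beta>))<..} = ennreal \<beta>"
    and "emeasure (Lap (2 * real l / \<epsilon>)) {..- (2 * real l / \<epsilon> * ln (1 / (2 * \<beta>)))} = ennreal \<beta>"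
proof -
  let ?b = "2 * real l / \<epsilon>" and ?K = "ln (1 / (2 * \<beta>))"
  have b: "0 < ?b" by (rule scale_pos[OF l])
  have a: "0 \<le> ?b * ?K" using b log_term(1) by (intro mult_nonneg_nonneg) auto
  have "- (b * K) / b = - K" if "0 < b" for b K :: real using that by simp
  then have e: "exp (- (?b * ?K) / ?b) / 2 = \<beta>" by (simp only: b log_term(2))
  show "emeasure (Lap ?b) {?b * ?K<..} = ennreal \<beta>"
    using emeasure_Lap_greaterThan[OF b a] unfolding e .
  show "emeasure (Lap ?b) {..- (?b * ?K)} = ennreal \<beta>"
    using emeasure_Lap_atMost[OF b a] unfolding e .
qed

lemma mechanism_range: "AE y in mech D. fst y \<in> {1..n}"
proof -
  interpret M: prob_space "mech D" by (rule prob_space_mechanism)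
  have m: "fst \<in> measurable output_space (count_space UNIV)" by (rule measurable_fst)
  have S: "{y. \<not> fst y \<in> {1..n}} \<in> sets output_space"
    using measurable_sets[OF m, of "- {1..n}"] by (simp add: vimage_def space_pair_measure)
  have "\<P>(y in mech D. fst y \<in> {1..n}) \<ge> 1 - (0 + 0)"
    by (rule mechanism_failure[where G = "\<lambda>_. True", OF S]) auto
  then have "\<P>(y in mech D. fst y \<in> {1..n}) = 1" using M.prob_le_1 by (simp add: antisym)
  then show ?thesis using M.AE_prob_1[of "{y. fst y \<in> {1..n}}"] by (simp add: space_mechanism)
qed

lemma snd_measurable: "{y. \<not> snd y \<le> (c::real)} \<in> sets output_space" "{y. \<not> c \<le> snd y} \<in> sets output_space"
proof -
  have *: "{y \<in> space output_space. \<not> snd y \<le> c} \<in> sets output_space"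
    "{y \<in> space output_space. \<not> c \<le> snd y} \<in> sets output_space" by measurable
  show "{y. \<not> snd y \<le> (c::real)} \<in> sets output_space" "{y. \<not> c \<le> snd y} \<in> sets output_space"
    using * by (simp_all add: space_pair_measure)
qed

text \<open>The shift inside \<open>dc_query\<close> is the one-sided \<open>\<beta>\<close>
  quantile of its own noise. Exceeding \<open>DC D\<close> therefore needs noise beyond it,
  whichever cap was selected.\<close>

lemma mechanism_lower: "\<P>(y in mech D. snd y \<le> real (DC D)) \<ge> 1 - \<beta>"
proof -
  have "\<P>(y in mech D. snd y \<le> real (DC D)) \<ge> 1 - (\<beta> + 0)"
  proof (rule mechanism_failure[where G = "\<lambda>_. True", OF snd_measurable(1)])
    fix l assume l: "l \<in> {1..n}"
    have "{x. \<not> snd (l, dc_query \<epsilon> \<beta> l D + x) \<le> real (DC D)} \<subseteq> {2 * real l / \<epsilon> * ln (1 / (2 * \<beta>))<..}"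
      using DC_bounded_le_DC[of D l] by (auto simp: dc_query_eq)
    then show "emeasure (Lap (2 * real l / \<epsilon>)) {x. \<not> snd (l, dc_query \<epsilon> \<beta> l D + x) \<le> real (DC D)} \<le> ennreal \<beta>"
      unfolding Lap_upper_tail(1)[OF l, symmetric] by (rule emeasure_mono) simp
  qed (use \<beta> in auto)
  then show ?thesis by simp
qed

text \<open>
  Comparing the selected cap with every \<open>j\<close> bounds the loss of the selected query; comparing it with
  \<open>lA\<close> bounds the selected cap itself, and hence the noise.
\<close>

lemma high_score_bound:
  assumes lA: "is_arg_max (\<lambda>l. real (DC_bounded D l) - real l / \<epsilon> * ln (1 / (2 * \<beta>))) (\<lambda>l. l \<in> {1..n}) lA"
    and l: "l \<in> {1..n}" and j: "j \<in> {1..n}"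
    and s: "- (2 / (\<epsilon> / 2) * ln (real n / \<beta>)) \<le> gem_score (dc_query \<epsilon> \<beta>) real n (\<epsilon> / 2) \<beta> D l"
  shows "real (DC_bounded D j) - (10 * real j + 18 * real lA) / \<epsilon> * ln (real n / \<beta>)
    \<le> dc_query \<epsilon> \<beta> l D - 2 * real l / \<epsilon> * ln (1 / (2 * \<beta>))"
proof -
  let ?L = "ln (real n / \<beta>)" and ?K = "ln (1 / (2 * \<beta>))"
  let ?t = "2 / (\<epsilon> / 2) * ?L"
  define L where "L = ?L / \<epsilon>"
  define K where "K = ?K / \<epsilon>"
  have "1 / (2 * \<beta>) \<le> real n / \<beta>" using \<beta> n by (simp add: field_simps)
  then have KL: "K \<le> L" unfolding K_def L_def using \<epsilon> \<beta> n by (intro divide_right_mono) auto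
  have K0: "0 \<le> K" unfolding K_def using \<epsilon> log_term(1) by simp
  have q: "dc_query \<epsilon> \<beta> i D = real (DC_bounded D i) - 2 * real i * K" for i
    by (simp add: dc_query_eq K_def)
  \<comment> \<open>The selection runs with parameter \<open>\<epsilon> / 2\<close>, which doubles
    the usual factor 2.\<close>
  have t: "?t = 4 * L" using \<epsilon> by (simp add: L_def)
  \<comment> \<open>Clearing the denominator \<open>l + i\<close> cancels the terms
    \<open>t * l\<close>, and those in \<open>i\<close> add up to \<open>2 * t * i\<close>, that is
    \<open>8 * L * i\<close>.\<close>
  have cmp: "dc_query \<epsilon> \<beta> i D - 8 * L * real i \<le> dc_query \<epsilon> \<beta> l D" if i: "i \<in> {1..n}" for i
  proof -
    have "gem_score (dc_query \<epsilon> \<beta>) real n (\<epsilon> / 2) \<beta> D l \<le>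
        ((dc_query \<epsilon> \<beta> l D - ?t * real l) - (dc_query \<epsilon> \<beta> i D - ?t * real i)) / (real l + real i)"
      unfolding gem_score_def Let_def using i by (intro Min_le) auto
    then have "- ?t \<le> ((dc_query \<epsilon> \<beta> l D - ?t * real l) - (dc_query \<epsilon> \<beta> i D - ?t * real i)) / (real l + real i)"
      using s by linarith
    moreover have "0 < real l + real i" using l by simp
    ultimately have "- ?t * (real l + real i) \<le> (dc_query \<epsilon> \<beta> l D - ?t * real l) - (dc_query \<epsilon> \<beta> i D - ?t * real i)"
      by (simp only: pos_le_divide_eq)
    then show ?thesis unfolding t by (simp add: algebra_simps)
  qed
  have A: "lA \<in> {1..n}" "real (DC_bounded D l) - real l * K \<le> real (DC_bounded D lA) - real lA * K"
    using lA l by (auto simp: is_arg_max_def K_def not_less)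
  \<comment> \<open>The objective maximised by \<open>lA\<close> carries half the penalty of the
    query. Subtracting its optimality from the comparison with \<open>lA\<close> therefore leaves
    one spare term \<open>l * K\<close>, which bounds the noise.\<close>
  have "real l * K \<le> real lA * K + 8 * (real lA * L)"
    using cmp[OF A(1)] A(2) unfolding q by (simp add: algebra_simps)
  moreover have "real lA * K \<le> real lA * L" using KL by (intro mult_left_mono) auto
  \<comment> \<open>The constant 18 is 2 (1 + 8).\<close>
  ultimately have "2 * (real l * K) \<le> 18 * (real lA * L)" by linarith
  \<comment> \<open>The constant 10 is 8 from the comparison plus 2 from the shift of query
    \<open>j\<close>.\<close>
  moreover have "real (DC_bounded D j) - 10 * (real j * L) \<le> dc_query \<epsilon> \<beta> l D"
  proof -
    have "real j * K \<le> real j * L" using KL by (intro mult_left_mono) auto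
    then show ?thesis using cmp[OF j] unfolding q[of j] by (simp add: algebra_simps)
  qed
  moreover have "(10 * real j + 18 * real lA) / \<epsilon> * ?L = 10 * (real j * L) + 18 * (real lA * L)"
    by (simp add: L_def add_divide_distrib algebra_simps)
  moreover have "2 * real l / \<epsilon> * ?K = 2 * (real l * K)" by (simp add: K_def)
  ultimately show ?thesis by linarith
qed

lemma mechanism_upper:
  assumes lA: "is_arg_max (\<lambda>l. real (DC_bounded D l) - real l / \<epsilon> * ln (1 / (2 * \<beta>))) (\<lambda>l. l \<in> {1..n}) lA"
  shows "\<P>(y in mech D. snd y \<ge> (MAX l\<in>{1..n}.
    real (DC_bounded D l) - (10 * real l + 18 * real lA) / \<epsilon> * ln (real n / \<beta>))) \<ge> 1 - 2 * \<beta>"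
    (is "\<P>(y in _. snd y \<ge> ?T) \<ge> _")
proof -
  let ?G = "\<lambda>l. - (2 / (\<epsilon> / 2) * ln (real n / \<beta>)) \<le> gem_score (dc_query \<epsilon> \<beta>) real n (\<epsilon> / 2) \<beta> D l"
  \<comment> \<open>One \<open>\<beta>\<close> pays for a low score of the selected cap, the other
    for the lower tail of the noise.\<close>
  have "\<P>(y in mech D. snd y \<ge> ?T) \<ge> 1 - (\<beta> + \<beta>)"
  proof (rule mechanism_failure[where G = ?G, OF snd_measurable(2)])
    show "measure_pmf.prob (gem D) {l. \<not> ?G l} \<le> \<beta>"
      unfolding not_le by (rule GEM_low_score) (use \<epsilon> \<beta> n in auto)
    fix l assume l: "l \<in> {1..n}" and g: "?G l"
    have "?T \<le> dc_query \<epsilon> \<beta> l D - 2 * real l / \<epsilon> * ln (1 / (2 * \<beta>))"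
      using high_score_bound[OF lA l _ g] n by (intro Max.boundedI) auto
    then have "{x. \<not> ?T \<le> snd (l, dc_query \<epsilon> \<beta> l D + x)} \<subseteq> {..- (2 * real l / \<epsilon> * ln (1 / (2 * \<beta>)))}"
      by auto
    then show "emeasure (Lap (2 * real l / \<epsilon>)) {x. \<not> ?T \<le> snd (l, dc_query \<epsilon> \<beta> l D + x)} \<le> ennreal \<beta>"
      unfolding Lap_upper_tail(2)[OF l, symmetric] by (rule emeasure_mono) simp
  qed (use \<beta> in auto)
  then show ?thesis by simp
qed

end

section \<open>Encoded datasets\<close>

locale encoded_dataset =
  fixes rs :: "(nat \<times> nat) list" and D :: "'a dataset" and name :: "'a \<Rightarrow> nat"
  assumes rs_distinct: "distinct rs" and rs_sorted: "sorted (map fst rs)"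
    and name_inj: "inj_on name (\<Union>u\<in>set D. fset u)"
    and rs_set: "set rs = {(i, name x) | i x. i < length D \<and> x |\<in>| D ! i}"
begin

lemma rs_nth: "x < length rs \<Longrightarrow> (array_of (map fst rs) x, array_of (map snd rs) x) = rs ! x"
  by (simp add: array_of_def)

sublocale records "array_of (map fst rs)" "array_of (map snd rs)" "length rs"
proof
  show "array_of (map fst rs) i \<le> array_of (map fst rs) j" if "i \<le> j" "j < length rs" for i j
    using sorted_nth_mono[OF rs_sorted, of i j] that by (simp add: array_of_def)
  show "i = j" if "i < length rs" "j < length rs" "array_of (map fst rs) i = array_of (map fst rs) j"
    "array_of (map snd rs) i = array_of (map snd rs) j" for i j
  proof -
    have "rs ! i = rs ! j" using rs_nth[OF that(1)] rs_nth[OF that(2)] that(3,4) by simp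
    then show ?thesis using nth_eq_iff_index_eq[OF rs_distinct that(1,2)] by simp
  qed
qed

abbreviation "pe \<equiv> array_of (map fst rs)"
abbreviation "ele \<equiv> array_of (map snd rs)"

lemma record_D:
  assumes "x < length rs"
  obtains v where "pe x < length D" "v |\<in>| D ! pe x" "ele x = name v"
proof -
  have "(pe x, ele x) \<in> set rs" using rs_nth[OF assms] assms by simp
  then show ?thesis using that unfolding rs_set by auto
qed

lemma record_I:
  assumes "i < length D" "v |\<in>| D ! i"
  obtains x where "x < length rs" "pe x = i" "ele x = name v"
proof -
  have "(i, name v) \<in> set rs" using assms unfolding rs_set by auto
  then obtain x where "x < length rs" "rs ! x = (i, name v)" by (auto simp: in_set_conv_nth)
  then show ?thesis using that[of x] rs_nth[of x] by simp
qed

lemma name_inj_person: "i < length D \<Longrightarrow> inj_on name (fset (D ! i))"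
  by (rule inj_on_subset[OF name_inj]) (auto intro: nth_mem)

lemma degree:
  assumes r: "r < length rs"
  shows "en r - st r = fcard (D ! pe r)"
proof -
  have pr: "pe r < length D" using record_D[OF r] by blast
  have "en r - st r = card {st r..<en r}" by simp
  also have "{st r..<en r} = {x. x < length rs \<and> pe x = pe r}"
    by (rule set_eqI) (simp add: same_person_iff)
  also have "card \<dots> = card (ele ` {x. x < length rs \<and> pe x = pe r})"
    by (rule card_image[symmetric]) (auto intro!: inj_onI intro: records_distinct)
  also have "ele ` {x. x < length rs \<and> pe x = pe r} = name ` fset (D ! pe r)"
  proof
    show "ele ` {x. x < length rs \<and> pe x = pe r} \<subseteq> name ` fset (D ! pe r)"
    proof
      fix e assume "e \<in> ele ` {x. x < length rs \<and> pe x = pe r}"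
      then obtain x where x: "x < length rs" "pe x = pe r" "e = ele x" by auto
      from record_D[OF x(1)] obtain v where "v |\<in>| D ! pe x" "ele x = name v" by blast
      then show "e \<in> name ` fset (D ! pe r)" using x by auto
    qed
    show "name ` fset (D ! pe r) \<subseteq> ele ` {x. x < length rs \<and> pe x = pe r}"
    proof
      fix e assume "e \<in> name ` fset (D ! pe r)"
      then obtain v where v: "v |\<in>| D ! pe r" "e = name v" by auto
      from record_I[OF pr v(1)] obtain x where "x < length rs" "pe x = pe r" "ele x = name v" by blast
      then show "e \<in> ele ` {x. x < length rs \<and> pe x = pe r}" using v by force
    qed
  qed
  also have "card \<dots> = fcard (D ! pe r)"
    using card_image[OF name_inj_person[OF pr]] by (simp add: fcard.rep_eq)
  finally show ?thesis .
qed

text \<open>The two graphs have a common renaming: positions become copies on the left of one,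
  elements become names on the right of the other.\<close>

lemma max_matching_size_edges: "max_matching_size (edges l) = max_matching_size (contribution_graph D l)"
proof -
  \<comment> \<open>Copies are numbered from 1 in \<open>contribution_graph\<close>, whereas offsets
    within a person's block start at 0.\<close>
  define f where "f r = (pe r, Suc (r - st r))" for r
  have "map_prod f id ` edges l = map_prod id name ` contribution_graph D l"
  proof
    show "map_prod f id ` edges l \<subseteq> map_prod id name ` contribution_graph D l"
    proof
      fix y assume "y \<in> map_prod f id ` edges l"
      then obtain r x where y: "y = (f r, ele x)" "r \<in> copies l" "x < length rs" "pe x = pe r"
        by (auto simp: edges_def)
      have r: "r < length rs" "r < st r + l" using y by (auto simp: copies_def)
      from record_D[OF y(3)] obtain v where v: "pe r < length D" "v |\<in>| D ! pe r" "ele x = name v"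
        using y by metis
      have "Suc (r - st r) \<le> l" "Suc (r - st r) \<le> en r - st r"
        using st_le[OF r(1)] less_en[OF r(1)] r by linarith+
      then have "Suc (r - st r) \<le> min l (fcard (D ! pe r))" by (simp add: degree[OF r(1)])
      then have "(f r, v) \<in> contribution_graph D l"
        using v by (simp add: contribution_graph_def f_def)
      then show "y \<in> map_prod id name ` contribution_graph D l"
        using y v by (intro image_eqI[of _ _ "(f r, v)"]) auto
    qed
    show "map_prod id name ` contribution_graph D l \<subseteq> map_prod f id ` edges l"
    proof
      fix y assume "y \<in> map_prod id name ` contribution_graph D l"
      then obtain i j v where y: "y = ((i, j), name v)" "i < length D" "1 \<le> j" "j \<le> min l (fcard (D ! i))" "v |\<in>| D ! i"
        by (auto simp: contribution_graph_def)
      from record_I[OF y(2,5)] obtain x where x: "x < length rs" "pe x = i" "ele x = name v" by blast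
      define r where "r = st x + (j - 1)"
      have "j \<le> en x - st x" using degree[OF x(1)] y x by simp
      then have "r < en x" using y(3) unfolding r_def by linarith
      then have r: "r < length rs \<and> pe r = pe x" using same_person_iff[of r x] by (simp add: r_def)
      then have st: "st r = st x" by (simp add: st_def)
      have "r < st x + l" using y(3,4) unfolding r_def by (simp only: min.bounded_iff) linarith
      then have "r \<in> copies l" using r st by (simp add: copies_def)
      then have "(r, ele x) \<in> edges l"
        unfolding edges_def by (intro CollectI exI[of _ r] exI[of _ x]) (use r x in simp)
      moreover have "f r = (i, j)" using r st y x by (simp add: f_def r_def)
      ultimately show "y \<in> map_prod f id ` edges l"
        using y x by (intro image_eqI[of _ _ "(r, ele x)"]) auto
    qed
  qed
  moreover have "max_matching_size (map_prod f id ` edges l) = max_matching_size (edges l)"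
  proof (rule max_matching_size_image[OF finite_edges])
    show "inj_on f (fst ` edges l)"
    proof (rule inj_onI)
      fix r r' assume "r \<in> fst ` edges l" "r' \<in> fst ` edges l" and f: "f r = f r'"
      then have "r < length rs" "r' < length rs" by (auto dest: edgesD)
      then have "st r \<le> r" "st r' \<le> r'" by (auto intro: st_le)
      moreover have "st r = st r'" using f by (simp add: f_def st_def)
      moreover have "r - st r = r' - st r'" using f by (simp add: f_def)
      ultimately show "r = r'" by linarith
    qed
  qed simp
  moreover have "max_matching_size (map_prod id name ` contribution_graph D l) = max_matching_size (contribution_graph D l)"
  proof (rule max_matching_size_image[OF finite_contribution_graph])
    show "inj_on name (snd ` contribution_graph D l)"
      by (rule inj_on_subset[OF name_inj]) (auto simp: contribution_graph_def intro: nth_mem)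
  qed simp
  ultimately show ?thesis by simp
qed

lemma length_le_data_size: "length rs \<le> data_size D"
proof -
  have "length rs = card (set rs)" using rs_distinct by (simp add: distinct_card)
  also have "set rs = (\<Union>i<length D. Pair i ` name ` fset (D ! i))" unfolding rs_set by auto
  also have "card \<dots> \<le> (\<Sum>i<length D. card (Pair i ` name ` fset (D ! i)))"
    by (rule card_UN_le) simp
  also have "\<dots> \<le> (\<Sum>i<length D. fcard (D ! i))"
    by (rule sum_mono) (simp add: fcard.rep_eq image_image card_image_le)
  also have "\<dots> = data_size D"
    by (simp add: data_size_def sum_list_sum_nth atLeast0LessThan)
  finally show ?thesis .
qed

end

section \<open>Running time\<close>

definition dp_distinct_count_prog :: com where
  "dp_distinct_count_prog = query_prog ;; sample_prog"

text \<open>\<open>M\<close> is instantiated by the data size or 1, whichever is larger. Its lower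
  bound 1 absorbs the additive constants, so that the empty dataset is covered as well.\<close>

lemma time_bound:
  fixes M :: real
  assumes m: "real m \<le> M" "1 \<le> M" and n: "1 \<le> n"
  shows "real (1 + 10500 * ((n + 1) * ((nat \<lfloor>sqrt (real m)\<rfloor> + 1 + 1) * ((n + 2) * (m + 1)))) + (n + 1) * ((n + 1) * 1000))
    \<le> 400000 * M powr (3 / 2) * real n ^ 2"
proof -
  have s1: "1 \<le> sqrt M" using m by simp
  have powr: "M powr (3 / 2) = M * sqrt M"
  proof -
    have "M powr (3 / 2) = M powr (1 + 1 / 2)" by simp
    also have "\<dots> = M powr 1 * M powr (1 / 2)" by (rule powr_add)
    finally show ?thesis using m by (simp add: powr_half_sqrt)
  qed
  have k: "real (nat \<lfloor>sqrt (real m)\<rfloor> + 1 + 1) \<le> 3 * sqrt M"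
  proof -
    have "real (nat \<lfloor>sqrt (real m)\<rfloor>) \<le> sqrt (real m)" by simp
    also have "\<dots> \<le> sqrt M" using m by simp
    finally show ?thesis using s1 by linarith
  qed
  have 1: "real (n + 1) \<le> 2 * real n" "real (n + 2) \<le> 3 * real n" "real (m + 1) \<le> 2 * M" using m n by auto
  have P: "1 \<le> real n ^ 2 * (M * sqrt M)"
    using mult_mono[of 1 "real n ^ 2" 1 "M * sqrt M"] mult_mono[of 1 M 1 "sqrt M"] n m s1 by simp
  have Q: "real n ^ 2 \<le> real n ^ 2 * (M * sqrt M)"
    using mult_left_mono[of 1 "M * sqrt M" "real n ^ 2"] mult_mono[of 1 M 1 "sqrt M"] m s1 by simp
  have "real ((n + 1) * ((nat \<lfloor>sqrt (real m)\<rfloor> + 1 + 1) * ((n + 2) * (m + 1)))) \<le>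
      (2 * real n) * ((3 * sqrt M) * ((3 * real n) * (2 * M)))"
    unfolding of_nat_mult
    by (intro mult_mono 1 k) (use s1 m in auto)
  also have "\<dots> = 36 * (real n ^ 2 * (M * sqrt M))" by (simp add: power2_eq_square)
  finally have A: "real ((n + 1) * ((nat \<lfloor>sqrt (real m)\<rfloor> + 1 + 1) * ((n + 2) * (m + 1)))) \<le>
      36 * (real n ^ 2 * (M * sqrt M))" .
  have "real ((n + 1) * ((n + 1) * 1000)) \<le> (2 * real n) * ((2 * real n) * 1000)"
    unfolding of_nat_mult by (intro mult_mono 1) auto
  also have "\<dots> = 4000 * real n ^ 2" by (simp add: power2_eq_square)
  finally have B: "real ((n + 1) * ((n + 1) * 1000)) \<le> 4000 * real n ^ 2" .
  have "real (1 + 10500 * X + Y) = 1 + 10500 * real X + real Y" for X Y :: nat by simp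
  \<comment> \<open>The constant is large enough because \<open>10500 * 36 + 4000 + 1\<close> is
    below \<open>400000\<close>.\<close>
  then have "real (1 + 10500 * ((n + 1) * ((nat \<lfloor>sqrt (real m)\<rfloor> + 1 + 1) * ((n + 2) * (m + 1)))) + (n + 1) * ((n + 1) * 1000))
    \<le> 400000 * (real n ^ 2 * (M * sqrt M))"
    using A B P Q by linarith
  then show ?thesis by (simp only: powr ac_simps)
qed

lemma program_samples:
  fixes D :: "'a dataset"
  assumes \<epsilon>: "0 < \<epsilon>" and \<beta>: "0 < \<beta>" "\<beta> < 1 / 2" and n: "1 \<le> n" and enc: "encodes rs D"
  shows "samples_within dp_distinct_count_prog (input_state rs n \<epsilon> \<beta>)
    (400000 * max 1 (real (data_size D)) powr (3 / 2) * real n ^ 2) (DPDistinctCount n \<epsilon> \<beta> D)"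
proof -
  obtain name :: "'a \<Rightarrow> nat" where "encoded_dataset rs D name"
    using enc unfolding encodes_def encoded_dataset_def by auto
  then interpret encoded_dataset rs D name .
  let ?s0 = "input_state rs n \<epsilon> \<beta>" and ?m = "length rs"
  let ?q = "\<lambda>l. dc_query \<epsilon> \<beta> l D"
  let ?w = "gem_weight (dc_query \<epsilon> \<beta>) real n (\<epsilon> / 2) \<beta> D"
  let ?\<kappa> = "nat \<lfloor>sqrt (real ?m)\<rfloor> + 1"
  let ?sel = "\<lambda>\<omega>. selection ?w n (\<omega> 0 * sum ?w {1..n})"
  let ?T = "1 + 10500 * ((n + 1) * ((?\<kappa> + 1) * ((n + 2) * (?m + 1)))) + (n + 1) * ((n + 1) * 1000)"
  let ?out = "\<lambda>\<omega>. let i = ?sel \<omega> in (i, ?q i + laplace_quantile (2 * real i / \<epsilon>) (\<omega> 1))"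
  have \<kappa>: "k \<le> ?\<kappa>" if "(k - 1) * (k - 1) \<le> ?m" for k
  proof -
    have "real (k - 1) * real (k - 1) \<le> real ?m" using that by (metis of_nat_le_iff of_nat_mult)
    then have "real (k - 1) \<le> sqrt (real ?m)" by (intro real_le_rsqrt) (simp add: power2_eq_square)
    then have "k - 1 \<le> nat \<lfloor>sqrt (real ?m)\<rfloor>" by (simp add: le_nat_floor)
    then show ?thesis by simp
  qed
  have run: "runs \<omega> dp_distinct_count_prog ?s0 ?T (\<lambda>s. (nmem s ''l_hat'' 0, rmem s ''nu_hat'' 0) = ?out \<omega>)" for \<omega>
    unfolding dp_distinct_count_prog_def
  proof (rule runs_Seq[OF query_prog_runs])
    show "k \<le> ?\<kappa>" if "(k - 1) * (k - 1) \<le> ?m" for k using \<kappa>[OF that] .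
    fix s assume q: "\<forall>l\<in>{1..n}. rmem s ''q'' l =
        real (max_matching_size (edges l)) - 2 * real l / \<epsilon> * ln (1 / (2 * \<beta>))"
      and ag: "agree query_prog ?s0 s"
    note defs = query_prog_def index_prog_def start_body_def sqrt_body_def query_body_def matching_prog_def
      reset_body_def auction_body_def phase_body_def prepare_body_def search_body_def augment_body_def
    have s: "nmem s ''l_max'' 0 = n" "rmem s ''eps'' 0 = \<epsilon>" "rmem s ''beta'' 0 = \<beta>" "drawn s = 0"
      using agree_nmem[OF ag] agree_rmem[OF ag] agree_drawn[OF ag]
      by (simp_all add: defs input_state_def array_of_def)
    have q': "\<forall>l\<in>{1..n}. rmem s ''q'' l = ?q l"
      using q by (simp add: dc_query_def max_matching_size_edges)
    show "runs \<omega> sample_prog s ((n + 1) * ((n + 1) * 1000)) (\<lambda>s. (nmem s ''l_hat'' 0, rmem s ''nu_hat'' 0) = ?out \<omega>)"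
      unfolding Let_def
      by (rule sample_prog_runs[OF s(1) n s(2,3) q' s(4) refl _ refl]) (simp add: gem_weight_def gem_score_def)
  qed (simp_all add: input_state_def array_of_def)
  have T: "real ?T \<le> 400000 * max 1 (real (data_size D)) powr (3 / 2) * real n ^ 2"
    by (rule time_bound) (use length_le_data_size n in auto)
  show ?thesis
    unfolding samples_within_def
  proof (intro bexI[of _ ?out] conjI ballI)
    show "distr coins output_space ?out = DPDistinctCount n \<epsilon> \<beta> D" by (rule sampler_law(2)[OF \<epsilon> n])
    show "?out \<in> measurable coins output_space" by (rule sampler_law(1)[OF \<epsilon> n])
    fix \<omega> :: "nat \<Rightarrow> real"
    obtain t s where "exec \<omega> dp_distinct_count_prog ?s0 t s" and t: "t \<le> ?T" and "(nmem s ''l_hat'' 0, rmem s ''nu_hat'' 0) = ?out \<omega>"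
      using run[of \<omega>] unfolding runs_def by blast
    moreover have "real t \<le> 400000 * max 1 (real (data_size D)) powr (3 / 2) * real n ^ 2"
      by (rule order_trans[OF of_nat_mono[OF t] T])
    ultimately show "\<exists>t s'. exec \<omega> dp_distinct_count_prog ?s0 t s' \<and>
        real t \<le> 400000 * max 1 (real (data_size D)) powr (3 / 2) * real n ^ 2 \<and>
        ?out \<omega> = (nmem s' ''l_hat'' 0, rmem s' ''nu_hat'' 0)" by metis
  qed
qed

theorem theorem1p1:
  shows "(\<forall>(\<epsilon>::real) (\<beta>::real) (lmax::nat). \<epsilon> > 0 \<longrightarrow> 0 < \<beta> \<longrightarrow> \<beta> < 1 / 2 \<longrightarrow> lmax \<ge> 1 \<longrightarrow>
      (let M = (DPDistinctCount lmax \<epsilon> \<beta> :: 'a dataset \<Rightarrow> (nat \<times> real) measure) in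
        (\<forall>D. prob_space (M D) \<and> sets (M D) = sets output_space \<and> (AE y in M D. fst y \<in> {1..lmax})) \<and>
        differentially_private output_space \<epsilon> M \<and>
        (\<forall>D. \<P>(y in M D. snd y \<le> real (DC D)) \<ge> 1 - \<beta>) \<and>
        (\<forall>D lA. is_arg_max (\<lambda>l. real (DC_bounded D l) - real l / \<epsilon> * ln (1 / (2 * \<beta>)))
                  (\<lambda>l. l \<in> {1..lmax}) lA \<longrightarrow>
           \<P>(y in M D. snd y \<ge> (MAX l\<in>{1..lmax}.
              real (DC_bounded D l)
                - (10 * real l + 18 * real lA) / \<epsilon> * ln (real lmax / \<beta>))) \<ge> 1 - 2 * \<beta>)))
    \<and> (\<exists>(P::com) (C::real). \<forall>(\<epsilon>::real) (\<beta>::real) (lmax::nat) (D::'a dataset) rs.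
      \<epsilon> > 0 \<longrightarrow> 0 < \<beta> \<longrightarrow> \<beta> < 1 / 2 \<longrightarrow> lmax \<ge> 1 \<longrightarrow> encodes rs D \<longrightarrow>
        samples_within P (input_state rs lmax \<epsilon> \<beta>)
          (C * max 1 (real (data_size D)) powr (3 / 2) * real lmax ^ 2)
          (DPDistinctCount lmax \<epsilon> \<beta> D))"
  (is "?A \<and> ?B")
proof
  show ?A
    unfolding Let_def
    by (intro allI impI conjI sets_DPDistinctCount
        mechanism.prob_space_mechanism[OF mechanism.intro] mechanism.mechanism_range[OF mechanism.intro]
        mechanism.mechanism_private[OF mechanism.intro] mechanism.mechanism_lower[OF mechanism.intro]
        mechanism.mechanism_upper[OF mechanism.intro]) assumption+
  show ?B
    using program_samples by blast
qed

end
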